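(* Let $n\ge 5$ be an integer, let $l,r$ be nonzero complex numbers, and assume that $(r^2)^k\neq 1$ for every $k\in\{1,\dots,n\}$. There exists an irreducible $\frac{(n-1)(n-2)}{2}$-dimensional invariant subspace of the Lawrence-Krammer space $\mathcal V^{(n)}$ if and only if $l=-r^3$. If so, it is unique.
   Context: Let $l,r$ be nonzero complex numbers with $r^2\ne1$, $m=\frac1r-r$ and $F=\mathbb{Q}(l,r)\subset\mathbb{C}$. The BMW algebra $B(A_{n-1})$ is the unital associative $F$-algebra generated by invertible elements $g_1,\dots,g_{n-1}$, with $e_i:=\frac{l}{m}(g_i^2+m g_i-1)$, subject to: $g_ig_j=g_jg_i$ for $|i-j|\ge2$; $g_ig_{i+1}g_i=g_{i+1}g_ig_{i+1}$; $g_ie_i=l^{-1}e_i$; $e_ig_{i+1}e_i=l e_i$; $e_ig_{i-1}e_i=l e_i$ (whenever the indices make sense). The Lawrence-Krammer space $\mathcal V^{(n)}$ is the $F$-vector space with basis $\{w_{ij}:1\le i<j\le n\}$. It is a $B(A_{n-1})$-module, $g_k$ acting by the endomorphism $\nu_k$ defined, for $1\le k\le n-1$, by: - $\nu_k(w_{ij})=r\,w_{ij}$ if $\{i,j\}\cap\{k,k+1\}=\emptyset$; - $\nu_k(w_{k,k+1})=l^{-1}w_{k,k+1}$; - $\nu_k(w_{k,j})=w_{k+1,j}$ for $j\ge k+2$; - $\nu_k(w_{k+1,j})=w_{k,j}+m\,r^{j-k-2}\,w_{k,k+1}-m\,w_{k+1,j}$ for $j\ge k+2$; - $\nu_k(w_{i,k})=w_{i,k+1}$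 for $i\le k-1$; - $\nu_k(w_{i,k+1})=w_{i,k}+\frac{m}{l\,r^{k-1-i}}\,w_{k,k+1}-m\,w_{i,k+1}$ for $i\le k-1$. Invariant subspaces are $F$-subspaces stable under $B(A_{n-1})$; an invariant subspace is irreducible if it is nonzero and contains no invariant subspaces other than $0$ and itself; dimensions are over $F$. *)

theory Defs
  imports
    "Jordan_Normal_Form.VS_Connect"
    "HOL-Algebra.Generated_Fields"
    "HOL-Algebra.QuotRing"
    "HOL-Library.Poly_Mapping"
    Complex_Main
begin

definition base_field :: "complex \<Rightarrow> complex \<Rightarrow> complex ring" where
  "base_field l r = class_ring\<lparr>carrier := generate_field class_ring {l, r}\<rparr>"

definition bmw_m :: "complex \<Rightarrow> complex" where
  "bmw_m r = 1 / r - r"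

section \<open>The BMW algebra\<close>

text \<open>The free algebra on the letters \<open>g\<^sub>k\<close>, \<open>g\<^sub>k\<^sup>-\<^sup>1\<close> is the monoid algebra of the monoid of words.
  \<^typ>\<open>'a \<Rightarrow>\<^sub>0 'b\<close> is a monoid algebra for an additively written monoid, so concatenation of words
  is written as addition.\<close>

datatype bmw_letter = G nat | Ginv nat

datatype bmw_word = Word "bmw_letter list"

instantiation bmw_word :: monoid_add
begin

definition zero_bmw_word :: bmw_word where
  "zero_bmw_word = Word []"

fun plus_bmw_word :: "bmw_word \<Rightarrow> bmw_word \<Rightarrow> bmw_word" where
  "plus_bmw_word (Word xs) (Word ys) = Word (xs @ ys)"

instance
proof
  fix a b c :: bmw_word
  show "a + b + c = a + (b + c)" by (cases a; cases b; cases c) simp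
  show "0 + a = a" by (cases a) (simp add: zero_bmw_word_def)
  show "a + 0 = a" by (cases a) (simp add: zero_bmw_word_def)
qed

end

type_synonym bmw_free_elem = "bmw_word \<Rightarrow>\<^sub>0 complex"

definition bmw_words :: "nat \<Rightarrow> bmw_word set" where
  "bmw_words n = Word ` lists (G ` {1..<n} \<union> Ginv ` {1..<n})"

definition bmw_free :: "complex \<Rightarrow> complex \<Rightarrow> nat \<Rightarrow> bmw_free_elem ring" where
  "bmw_free l r n = class_ring\<lparr>carrier :=
     {x. Poly_Mapping.keys x \<subseteq> bmw_words n \<and>
         (\<forall>w. Poly_Mapping.lookup x w \<in> carrier (base_field l r))}\<rparr>"

definition scal :: "complex \<Rightarrow> bmw_free_elem" where
  "scal c = Poly_Mapping.single 0 c"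

definition gen :: "nat \<Rightarrow> bmw_free_elem" where
  "gen k = Poly_Mapping.single (Word [G k]) 1"

definition gen_inv :: "nat \<Rightarrow> bmw_free_elem" where
  "gen_inv k = Poly_Mapping.single (Word [Ginv k]) 1"

definition gen_e :: "complex \<Rightarrow> complex \<Rightarrow> nat \<Rightarrow> bmw_free_elem" where
  "gen_e l r k = scal (l / bmw_m r) * (gen k ^ 2 + scal (bmw_m r) * gen k - 1)"

definition bmw_relators :: "complex \<Rightarrow> complex \<Rightarrow> nat \<Rightarrow> bmw_free_elem set" where
  "bmw_relators l r n =
     {gen i * gen_inv i - 1 | i. i \<in> {1..<n}} \<union>
     {gen_inv i * gen i - 1 | i. i \<in> {1..<n}} \<union>
     {gen i * gen j - gen j * gen i | i j.
        i \<in> {1..<n} \<and> j \<in> {1..<n} \<and> \<bar>int i - int j\<bar> \<ge> 2} \<union>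
     {gen i * gen (i + 1) * gen i - gen (i + 1) * gen i * gen (i + 1) | i.
        i \<in> {1..<n} \<and> i + 1 \<in> {1..<n}} \<union>
     {gen i * gen_e l r i - scal (1 / l) * gen_e l r i | i. i \<in> {1..<n}} \<union>
     {gen_e l r i * gen (i + 1) * gen_e l r i - scal l * gen_e l r i | i.
        i \<in> {1..<n} \<and> i + 1 \<in> {1..<n}} \<union>
     {gen_e l r i * gen (i - 1) * gen_e l r i - scal l * gen_e l r i | i.
        i \<in> {1..<n} \<and> i - 1 \<in> {1..<n}}"

definition bmw_algebra :: "complex \<Rightarrow> complex \<Rightarrow> nat \<Rightarrow> bmw_free_elem set ring" where
  "bmw_algebra l r n =
     bmw_free l r n Quot (Idl\<^bsub>bmw_free l r n\<^esub> (bmw_relators l r n))"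

section \<open>The Lawrence-Krammer space\<close>

type_synonym lk_vec = "nat \<times> nat \<Rightarrow> complex"

definition lk_index :: "nat \<Rightarrow> (nat \<times> nat) set" where
  "lk_index n = {(i, j). 1 \<le> i \<and> i < j \<and> j \<le> n}"

text \<open>The fields \<^const>\<open>mult\<close> and \<^const>\<open>one\<close> are present only because the record of modules
  extends that of rings; they play no role.\<close>

definition lk_space :: "complex \<Rightarrow> complex \<Rightarrow> nat \<Rightarrow> (complex, lk_vec) module" where
  "lk_space l r n =
     \<lparr>carrier = {v. (\<forall>p \<in> lk_index n. v p \<in> carrier (base_field l r)) \<and>
                    (\<forall>p. p \<notin> lk_index n \<longrightarrow> v p = 0)},
      mult = undefined, one = undefined,
      zero = (\<lambda>p. 0), add = (\<lambda>u v p. u p + v p), smult = (\<lambda>c v p. c * v p)\<rparr>"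

definition lk_w :: "nat \<Rightarrow> nat \<Rightarrow> lk_vec" where
  "lk_w i j = (\<lambda>p. if p = (i, j) then 1 else 0)"

text \<open>The image of \<open>w\<^sub>i\<^sub>j\<close> under \<open>\<nu>\<^sub>k\<close>, for \<open>i < j\<close>.\<close>

definition lk_nu_w :: "complex \<Rightarrow> complex \<Rightarrow> nat \<Rightarrow> nat \<Rightarrow> nat \<Rightarrow> lk_vec" where
  "lk_nu_w l r k i j = (let m = bmw_m r in
     if {i, j} \<inter> {k, k + 1} = {} then (\<lambda>p. r * lk_w i j p)
     else if i = k \<and> j = k + 1 then (\<lambda>p. 1 / l * lk_w k (k + 1) p)
     else if i = k then lk_w (k + 1) j
     else if i = k + 1 then
       (\<lambda>p. lk_w k j p + m * r ^ (j - k - 2) * lk_w k (k + 1) p - m * lk_w (k + 1) j p)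
     else if j = k then lk_w i (k + 1)
     else
       (\<lambda>p. lk_w i k p + m / (l * r ^ (k - 1 - i)) * lk_w k (k + 1) p - m * lk_w i (k + 1) p))"

definition lk_nu :: "complex \<Rightarrow> complex \<Rightarrow> nat \<Rightarrow> nat \<Rightarrow> lk_vec \<Rightarrow> lk_vec" where
  "lk_nu l r n k v = (\<lambda>p. \<Sum>(i, j) \<in> lk_index n. v (i, j) * lk_nu_w l r k i j p)"

fun lk_letter :: "complex \<Rightarrow> complex \<Rightarrow> nat \<Rightarrow> bmw_letter \<Rightarrow> lk_vec \<Rightarrow> lk_vec" where
  "lk_letter l r n (G k) = lk_nu l r n k"
| "lk_letter l r n (Ginv k) = inv_into (carrier (lk_space l r n)) (lk_nu l r n k)"

fun lk_word :: "complex \<Rightarrow> complex \<Rightarrow> nat \<Rightarrow> bmw_word \<Rightarrow> lk_vec \<Rightarrow> lk_vec" where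
  "lk_word l r n (Word xs) = foldr (lk_letter l r n) xs"

definition lk_free_act ::
    "complex \<Rightarrow> complex \<Rightarrow> nat \<Rightarrow> bmw_free_elem \<Rightarrow> lk_vec \<Rightarrow> lk_vec" where
  "lk_free_act l r n x v =
     (\<lambda>p. \<Sum>w \<in> Poly_Mapping.keys x. Poly_Mapping.lookup x w * lk_word l r n w v p)"

text \<open>The action of a coset is the common action of its elements; that it does not depend on the
  representative is \<open>lk_act_coset\<close> below.\<close>

definition lk_act :: "complex \<Rightarrow> complex \<Rightarrow> nat \<Rightarrow> bmw_free_elem set \<Rightarrow> lk_vec \<Rightarrow> lk_vec" where
  "lk_act l r n b v = the_elem ((\<lambda>x. lk_free_act l r n x v) ` b)"

definition invariant_subspace :: "complex \<Rightarrow> complex \<Rightarrow> nat \<Rightarrow> lk_vec set \<Rightarrow> bool" where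
  "invariant_subspace l r n W \<longleftrightarrow>
     VectorSpace.subspace (base_field l r) W (lk_space l r n) \<and>
     (\<forall>b \<in> carrier (bmw_algebra l r n). \<forall>v \<in> W. lk_act l r n b v \<in> W)"

definition irreducible_subspace :: "complex \<Rightarrow> complex \<Rightarrow> nat \<Rightarrow> lk_vec set \<Rightarrow> bool" where
  "irreducible_subspace l r n W \<longleftrightarrow>
     invariant_subspace l r n W \<and> W \<noteq> {\<zero>\<^bsub>lk_space l r n\<^esub>} \<and>
     (\<forall>U. invariant_subspace l r n U \<and> U \<subseteq> W \<longrightarrow> U = {\<zero>\<^bsub>lk_space l r n\<^esub>} \<or> U = W)"

definition lk_dim :: "complex \<Rightarrow> complex \<Rightarrow> nat \<Rightarrow> lk_vec set \<Rightarrow> nat" where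
  "lk_dim l r n W = vectorspace.dim (base_field l r) (lk_space l r n\<lparr>carrier := W\<rparr>)"

section \<open>The base field and the vector space\<close>

lemma field_base_field: "field (base_field l r)"
  unfolding base_field_def
  using ring.subfield_iff(2)[OF class_ring.ring_axioms] field.generate_field_is_subfield[OF class_field, of "{l, r}"]
  by simp

lemma base_field_simps [simp]:
  "mult (base_field l r) = (*)" "add (base_field l r) = (+)"
  "\<one>\<^bsub>base_field l r\<^esub> = 1" "\<zero>\<^bsub>base_field l r\<^esub> = 0"
  by (simp_all add: base_field_def)

lemma base_field_closed [simp, intro]:
  "0 \<in> carrier (base_field l r)" "1 \<in> carrier (base_field l r)"
  "l \<in> carrier (base_field l r)" "r \<in> carrier (base_field l r)"
  "a \<in> carrier (base_field l r) \<Longrightarrow> b \<in> carrier (base_field l r) \<Longrightarrow> a + b \<in> carrier (base_field l r)"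
  "a \<in> carrier (base_field l r) \<Longrightarrow> b \<in> carrier (base_field l r) \<Longrightarrow> a * b \<in> carrier (base_field l r)"
  "a \<in> carrier (base_field l r) \<Longrightarrow> - a \<in> carrier (base_field l r)"
proof -
  interpret F: field "base_field l r" by (rule field_base_field)
  show "0 \<in> carrier (base_field l r)" "1 \<in> carrier (base_field l r)"
    using F.zero_closed F.one_closed by simp_all
  show "l \<in> carrier (base_field l r)" "r \<in> carrier (base_field l r)"
    by (simp_all add: base_field_def generate_field.incl)
  show "a + b \<in> carrier (base_field l r)" if "a \<in> carrier (base_field l r)" "b \<in> carrier (base_field l r)"
    using F.a_closed[OF that] by simp
  show "a * b \<in> carrier (base_field l r)" if "a \<in> carrier (base_field l r)" "b \<in> carrier (base_field l r)"
    using F.m_closed[OF that] by simp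
  show "- a \<in> carrier (base_field l r)" if "a \<in> carrier (base_field l r)"
    using that generate_field.a_inv[of a class_ring "{l,r}"] by (simp add: base_field_def class_ring_simps)
qed

lemma base_field_inverse [simp, intro]:
  "a \<in> carrier (base_field l r) \<Longrightarrow> inverse a \<in> carrier (base_field l r)"
proof (cases "a = 0")
  case False
  assume a: "a \<in> carrier (base_field l r)"
  interpret F: field "base_field l r" by (rule field_base_field)
  have "a \<in> Units (base_field l r)" using a False F.field_Units by simp
  then obtain b where "b \<in> carrier (base_field l r)" "a * b = 1"
    by (auto simp: Units_def)
  with False show ?thesis by (metis inverse_unique)
qed simp

lemma base_field_closed' [simp, intro]:
  "a \<in> carrier (base_field l r) \<Longrightarrow> b \<in> carrier (base_field l r) \<Longrightarrow> a - b \<in> carrier (base_field l r)"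
  "a \<in> carrier (base_field l r) \<Longrightarrow> b \<in> carrier (base_field l r) \<Longrightarrow> a / b \<in> carrier (base_field l r)"
  "a \<in> carrier (base_field l r) \<Longrightarrow> a ^ k \<in> carrier (base_field l r)"
  "bmw_m r \<in> carrier (base_field l r)"
proof -
  show 1: "\<And>a b. a \<in> carrier (base_field l r) \<Longrightarrow> b \<in> carrier (base_field l r) \<Longrightarrow> a - b \<in> carrier (base_field l r)"
    using base_field_closed(5,7) by (metis add_uminus_conv_diff)
  show 2: "\<And>a b. a \<in> carrier (base_field l r) \<Longrightarrow> b \<in> carrier (base_field l r) \<Longrightarrow> a / b \<in> carrier (base_field l r)"
    by (simp add: divide_inverse)
  show "a \<in> carrier (base_field l r) \<Longrightarrow> a ^ k \<in> carrier (base_field l r)"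
    by (induction k) auto
  show "bmw_m r \<in> carrier (base_field l r)"
    unfolding bmw_m_def by (intro 1 2) auto
qed

lemma base_field_sum [intro]:
  "(\<And>x. x \<in> A \<Longrightarrow> f x \<in> carrier (base_field l r)) \<Longrightarrow> sum f A \<in> carrier (base_field l r)"
  by (induction A rule: infinite_finite_induct) auto

lemma vectorspace_lk_space: "vectorspace (base_field l r) (lk_space l r n)"
proof -
  interpret F: field "base_field l r" by (rule field_base_field)
  have "abelian_group (lk_space l r n)"
  proof (rule abelian_groupI)
    fix x assume x: "x \<in> carrier (lk_space l r n)"
    show "\<exists>y\<in>carrier (lk_space l r n). y \<oplus>\<^bsub>lk_space l r n\<^esub> x = \<zero>\<^bsub>lk_space l r n\<^esub>"
      using x by (intro bexI[of _ "\<lambda>p. - x p"]) (auto simp: lk_space_def)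
  qed (auto simp: lk_space_def fun_eq_iff)
  then have "Module.module (base_field l r) (lk_space l r n)"
    by (intro Module.moduleI F.cring_axioms) (auto simp: lk_space_def fun_eq_iff algebra_simps)
  then show ?thesis
    by (intro vectorspace.intro field_base_field)
qed

lemma finite_lk_index [simp]: "finite (lk_index n)"
  by (rule finite_subset[of _ "{..n} \<times> {..n}"]) (auto simp: lk_index_def)

lemma bmw_free_ring: "ring (bmw_free l r n)"
proof -
  have words: "u \<in> bmw_words n \<Longrightarrow> v \<in> bmw_words n \<Longrightarrow> u + v \<in> bmw_words n" for u v
    unfolding bmw_words_def by (force simp: image_iff)
  have mult: "x * y \<in> carrier (bmw_free l r n)"
    if "x \<in> carrier (bmw_free l r n)" "y \<in> carrier (bmw_free l r n)" for x y
  proof -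
    have "Poly_Mapping.keys (x * y) \<subseteq> bmw_words n"
    proof
      fix w assume "w \<in> Poly_Mapping.keys (x * y)"
      then obtain u v where "w = u + v" "u \<in> Poly_Mapping.keys x" "v \<in> Poly_Mapping.keys y"
        using keys_mult[of x y] by blast
      then show "w \<in> bmw_words n"
        using words that unfolding bmw_free_def partial_object.simps mem_Collect_eq
          partial_object.update_convs by blast
    qed
    moreover have "Poly_Mapping.lookup (x * y) w \<in> carrier (base_field l r)" for w
      using that unfolding lookup_mult Sum_any.expand_set
      by (intro base_field_sum base_field_closed) (auto simp: bmw_free_def when_def)
    ultimately show ?thesis by (simp add: bmw_free_def)
  qed
  have "subring (carrier (bmw_free l r n)) (class_ring :: bmw_free_elem ring)"
  proof (rule ring.subringI[OF class_ring.ring_axioms])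
    show "\<one>\<^bsub>class_ring\<^esub> \<in> carrier (bmw_free l r n)"
      by (auto simp: bmw_free_def lookup_one when_def bmw_words_def zero_bmw_word_def)
  next
    fix h assume "h \<in> carrier (bmw_free l r n)"
    then show "\<ominus>\<^bsub>class_ring\<^esub> h \<in> carrier (bmw_free l r n)"
      by (simp add: bmw_free_def class_ring_simps)
  next
    fix x y assume "x \<in> carrier (bmw_free l r n)" "y \<in> carrier (bmw_free l r n)"
    then show "x \<oplus>\<^bsub>class_ring\<^esub> y \<in> carrier (bmw_free l r n)"
      using Poly_Mapping.keys_add[of x y] by (auto simp: bmw_free_def lookup_add)
  qed (use mult in auto)
  then show ?thesis
    using ring.subring_is_ring[OF class_ring.ring_axioms] by (fastforce simp: bmw_free_def)
qed

section \<open>The operators satisfy the relations of the BMW algebra\<close>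

definition lk_supp :: "nat \<Rightarrow> lk_vec set" where
  "lk_supp n = {v. \<forall>p. p \<notin> lk_index n \<longrightarrow> v p = 0}"

lemma lk_suppD: "v \<in> lk_supp n \<Longrightarrow> p \<notin> lk_index n \<Longrightarrow> v p = 0"
  by (simp add: lk_supp_def del: split_paired_All)

lemma lk_supp_ops [intro]:
  "(\<lambda>p. 0) \<in> lk_supp n"
  "u \<in> lk_supp n \<Longrightarrow> v \<in> lk_supp n \<Longrightarrow> (\<lambda>p. u p + v p) \<in> lk_supp n"
  "u \<in> lk_supp n \<Longrightarrow> v \<in> lk_supp n \<Longrightarrow> (\<lambda>p. u p - v p) \<in> lk_supp n"
  "v \<in> lk_supp n \<Longrightarrow> (\<lambda>p. c * v p) \<in> lk_supp n"
  "v \<in> lk_supp n \<Longrightarrow> (\<lambda>p. v p / c) \<in> lk_supp n"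
  by (auto simp: lk_supp_def)

lemma lk_supp_w [intro]: "(i, j) \<in> lk_index n \<Longrightarrow> lk_w i j \<in> lk_supp n"
  by (auto simp: lk_supp_def lk_w_def)

lemma carrier_lk_space: "carrier (lk_space l r n) =
   {v \<in> lk_supp n. \<forall>p. v p \<in> carrier (base_field l r)}"
proof (rule Set.set_eqI)
  fix v
  have "(\<forall>p\<in>lk_index n. v p \<in> carrier (base_field l r)) \<longleftrightarrow> (\<forall>p. v p \<in> carrier (base_field l r))"
    if v: "\<forall>p. p \<notin> lk_index n \<longrightarrow> v p = 0"
  proof (intro iffI allI ballI)
    fix p assume "\<forall>p\<in>lk_index n. v p \<in> carrier (base_field l r)"
    with v show "v p \<in> carrier (base_field l r)"
      by (cases "p \<in> lk_index n") (simp_all del: split_paired_All)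
  qed blast
  then show "v \<in> carrier (lk_space l r n) \<longleftrightarrow>
      v \<in> {v \<in> lk_supp n. \<forall>p. v p \<in> carrier (base_field l r)}"
    unfolding lk_space_def lk_supp_def partial_object.simps mem_Collect_eq by metis
qed

lemma lk_nu_add: "lk_nu l r n k (\<lambda>p. u p + v p) = (\<lambda>p. lk_nu l r n k u p + lk_nu l r n k v p)"
  by (simp add: lk_nu_def algebra_simps sum.distrib case_prod_unfold)

lemma lk_nu_diff: "lk_nu l r n k (\<lambda>p. u p - v p) = (\<lambda>p. lk_nu l r n k u p - lk_nu l r n k v p)"
  by (simp add: lk_nu_def algebra_simps sum_subtractf case_prod_unfold)

lemma lk_nu_scale: "lk_nu l r n k (\<lambda>p. c * v p) = (\<lambda>p. c * lk_nu l r n k v p)"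
  by (simp add: lk_nu_def sum_distrib_left mult.assoc case_prod_unfold)

lemma lk_nu_divide: "lk_nu l r n k (\<lambda>p. v p / c) = (\<lambda>p. lk_nu l r n k v p / c)"
  by (simp add: lk_nu_def sum_divide_distrib case_prod_unfold)

lemma lk_nu_basis:
  assumes "(i, j) \<in> lk_index n"
  shows "lk_nu l r n k (lk_w i j) = lk_nu_w l r k i j"
proof
  fix p
  have "lk_nu l r n k (lk_w i j) p = (\<Sum>q\<in>lk_index n. if q = (i, j) then lk_nu_w l r k i j p else 0)"
    unfolding lk_nu_def by (intro sum.cong) (auto simp: lk_w_def split: if_splits)
  then show "lk_nu l r n k (lk_w i j) p = lk_nu_w l r k i j p"
    using assms by simp
qed

lemma lk_nu_w_closed:
  "lk_nu_w l r k i j p \<in> carrier (base_field l r)"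
proof -
  have w: "lk_w a b p \<in> carrier (base_field l r)" for a b by (simp add: lk_w_def)
  show ?thesis unfolding lk_nu_w_def Let_def
    by (auto intro!: w base_field_closed base_field_closed')
qed

lemma lk_nu_w_supp:
  assumes "(i, j) \<in> lk_index n" "k \<in> {1..<n}"
  shows "lk_nu_w l r k i j \<in> lk_supp n"
  using assms unfolding lk_nu_w_def Let_def
  by (auto intro!: lk_supp_ops lk_supp_w simp: lk_index_def)

lemma lk_nu_supp:
  assumes "k \<in> {1..<n}"
  shows "lk_nu l r n k v \<in> lk_supp n"
  unfolding lk_supp_def lk_nu_def mem_Collect_eq
proof (intro allI impI sum.neutral ballI)
  fix p q assume p: "p \<notin> lk_index n" and q: "q \<in> lk_index n"
  obtain i j where "q = (i, j)" by (cases q)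
  then show "(case q of (i, j) \<Rightarrow> v (i, j) * lk_nu_w l r k i j p) = 0"
    using lk_nu_w_supp[of i j n k l r] p q assms by (cases p) (auto simp: lk_supp_def)
qed

lemma lk_nu_closed:
  assumes "k \<in> {1..<n}" "v \<in> carrier (lk_space l r n)"
  shows "lk_nu l r n k v \<in> carrier (lk_space l r n)"
  using assms lk_nu_supp[OF assms(1)] unfolding carrier_lk_space
  by (auto simp: lk_nu_def intro!: base_field_sum base_field_closed lk_nu_w_closed)

definition lk_lin :: "nat \<Rightarrow> (lk_vec \<Rightarrow> lk_vec) \<Rightarrow> bool" where
  "lk_lin n A \<longleftrightarrow> (\<forall>v \<in> lk_supp n. A v \<in> lk_supp n) \<and>
     (\<forall>u \<in> lk_supp n. \<forall>v \<in> lk_supp n. A (\<lambda>p. u p + v p) = (\<lambda>p. A u p + A v p)) \<and>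
     (\<forall>c. \<forall>v \<in> lk_supp n. A (\<lambda>p. c * v p) = (\<lambda>p. c * A v p))"

lemma lk_linD:
  assumes "lk_lin n A"
  shows "v \<in> lk_supp n \<Longrightarrow> A v \<in> lk_supp n"
    "u \<in> lk_supp n \<Longrightarrow> v \<in> lk_supp n \<Longrightarrow> A (\<lambda>p. u p + v p) = (\<lambda>p. A u p + A v p)"
    "v \<in> lk_supp n \<Longrightarrow> A (\<lambda>p. c * v p) = (\<lambda>p. c * A v p)"
    "A (\<lambda>p. 0) = (\<lambda>p. 0)"
proof -
  show scale: "v \<in> lk_supp n \<Longrightarrow> A (\<lambda>p. c * v p) = (\<lambda>p. c * A v p)" for c v
    using assms by (simp add: lk_lin_def)
  show "A (\<lambda>p. 0) = (\<lambda>p. 0)"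
    using scale[of "\<lambda>p. 0" 0] lk_supp_ops(1) by simp
qed (use assms in \<open>simp_all add: lk_lin_def\<close>)

lemma lk_lin_nu [intro]: "k \<in> {1..<n} \<Longrightarrow> lk_lin n (lk_nu l r n k)"
  by (auto simp: lk_lin_def lk_nu_add lk_nu_scale intro!: lk_nu_supp)

lemma lk_lin_eqI:
  assumes A: "lk_lin n A" and B: "lk_lin n B" and v: "v \<in> lk_supp n"
    and eq: "\<And>i j. (i, j) \<in> lk_index n \<Longrightarrow> A (lk_w i j) = B (lk_w i j)"
  shows "A v = B v"
proof -
  have *: "(\<lambda>p. \<Sum>q\<in>Q. v q * lk_w (fst q) (snd q) p) \<in> lk_supp n \<and>
      A (\<lambda>p. \<Sum>q\<in>Q. v q * lk_w (fst q) (snd q) p) = B (\<lambda>p. \<Sum>q\<in>Q. v q * lk_w (fst q) (snd q) p)"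
    if "finite Q" "Q \<subseteq> lk_index n" for Q
    using that
  proof (induction Q)
    case empty
    show ?case using lk_linD(4)[OF A] lk_linD(4)[OF B] by (simp add: lk_supp_ops(1))
  next
    case (insert q Q)
    define s where "s = (\<lambda>p. \<Sum>q\<in>Q. v q * lk_w (fst q) (snd q) p)"
    define t where "t = (\<lambda>p. v q * lk_w (fst q) (snd q) p)"
    have s: "s \<in> lk_supp n" "A s = B s" using insert by (simp_all add: s_def)
    have w: "lk_w (fst q) (snd q) \<in> lk_supp n" using insert by (simp add: lk_supp_w)
    then have t: "t \<in> lk_supp n" unfolding t_def by (rule lk_supp_ops(4))
    have "A t = B t"
      using eq[of "fst q" "snd q"] insert.prems
      unfolding t_def lk_linD(3)[OF A w] lk_linD(3)[OF B w] by simp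
    then have "A (\<lambda>p. t p + s p) = B (\<lambda>p. t p + s p)"
      unfolding lk_linD(2)[OF A t s(1)] lk_linD(2)[OF B t s(1)] using s(2) by simp
    moreover have "(\<lambda>p. \<Sum>q\<in>insert q Q. v q * lk_w (fst q) (snd q) p) = (\<lambda>p. t p + s p)"
      using insert by (simp add: s_def t_def)
    ultimately show ?case using s(1) t lk_supp_ops(2) by simp
  qed
  have "v = (\<lambda>p. \<Sum>q\<in>lk_index n. v q * lk_w (fst q) (snd q) p)"
  proof
    fix p
    have "(\<Sum>q\<in>lk_index n. v q * lk_w (fst q) (snd q) p) = (\<Sum>q\<in>lk_index n. if q = p then v p else 0)"
      by (intro sum.cong) (auto simp: lk_w_def)
    then show "v p = (\<Sum>q\<in>lk_index n. v q * lk_w (fst q) (snd q) p)"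
      using v by (auto dest: lk_suppD)
  qed
  with *[of "lk_index n"] show ?thesis by simp
qed

lemma lk_lin_comp: "lk_lin n A \<Longrightarrow> lk_lin n B \<Longrightarrow> lk_lin n (\<lambda>v. A (B v))"
  by (auto simp: lk_lin_def)

lemma lk_lin_add: "lk_lin n A \<Longrightarrow> lk_lin n B \<Longrightarrow> lk_lin n (\<lambda>v p. A v p + B v p)"
  by (auto simp: lk_lin_def algebra_simps lk_supp_def)

lemma lk_lin_diff: "lk_lin n A \<Longrightarrow> lk_lin n B \<Longrightarrow> lk_lin n (\<lambda>v p. A v p - B v p)"
  by (auto simp: lk_lin_def algebra_simps lk_supp_def)

lemma lk_lin_scale: "lk_lin n A \<Longrightarrow> lk_lin n (\<lambda>v p. c * A v p)"
  by (auto simp: lk_lin_def algebra_simps lk_supp_def)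

lemma lk_lin_id: "lk_lin n (\<lambda>v. v)"
  by (auto simp: lk_lin_def)

lemma lk_nu_rules:
  assumes "k \<in> {1..<n}"
  shows
    "1 \<le> i \<Longrightarrow> i < j \<Longrightarrow> j \<le> n \<Longrightarrow> i \<noteq> k \<Longrightarrow> i \<noteq> Suc k \<Longrightarrow> j \<noteq> k \<Longrightarrow> j \<noteq> Suc k \<Longrightarrow>
       lk_nu l r n k (lk_w i j) = (\<lambda>p. r * lk_w i j p)"
    "lk_nu l r n k (lk_w k (Suc k)) = (\<lambda>p. 1 / l * lk_w k (Suc k) p)"
    "Suc k < j \<Longrightarrow> j \<le> n \<Longrightarrow> lk_nu l r n k (lk_w k j) = lk_w (Suc k) j"
    "Suc k < j \<Longrightarrow> j \<le> n \<Longrightarrow> lk_nu l r n k (lk_w (Suc k) j) =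
       (\<lambda>p. lk_w k j p + bmw_m r * r ^ (j - k - 2) * lk_w k (Suc k) p - bmw_m r * lk_w (Suc k) j p)"
    "1 \<le> i \<Longrightarrow> i < k \<Longrightarrow> lk_nu l r n k (lk_w i k) = lk_w i (Suc k)"
    "1 \<le> i \<Longrightarrow> i < k \<Longrightarrow> lk_nu l r n k (lk_w i (Suc k)) =
       (\<lambda>p. lk_w i k p + bmw_m r / (l * r ^ (k - 1 - i)) * lk_w k (Suc k) p - bmw_m r * lk_w i (Suc k) p)"
  using assms
  by (subst lk_nu_basis; force simp: lk_index_def lk_nu_w_def Let_def)+

lemma lk_nu_braid:
  assumes lr: "l \<noteq> 0" "r \<noteq> 0" and i: "i \<in> {1..<n}" "Suc i \<in> {1..<n}" and v: "v \<in> lk_supp n"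
  shows "lk_nu l r n i (lk_nu l r n (Suc i) (lk_nu l r n i v)) =
         lk_nu l r n (Suc i) (lk_nu l r n i (lk_nu l r n (Suc i) v))"
proof (rule lk_lin_eqI[OF lk_lin_comp[OF lk_lin_nu lk_lin_comp[OF lk_lin_nu lk_lin_nu]]
      lk_lin_comp[OF lk_lin_nu lk_lin_comp[OF lk_lin_nu lk_lin_nu]] v])
  fix a b assume "(a, b) \<in> lk_index n"
  then have ab: "1 \<le> a" "a < b" "b \<le> n" by (auto simp: lk_index_def)
  note rules = lk_nu_rules[OF i(1)] lk_nu_rules[OF i(2)] lk_nu_add lk_nu_diff lk_nu_scale lk_nu_divide
  let ?L = "lk_nu l r n i (lk_nu l r n (Suc i) (lk_nu l r n i (lk_w a b)))"
  let ?R = "lk_nu l r n (Suc i) (lk_nu l r n i (lk_nu l r n (Suc i) (lk_w a b)))"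
  note fin = i ab lr
  consider "b < i" | "a < i" "b \<in> {i, Suc i, Suc (Suc i)}" | "a < i" "b > Suc (Suc i)"
    | "a = i" "b = Suc i" | "a = i" "b = Suc (Suc i)" | "a = i" "b > Suc (Suc i)"
    | "a = Suc i" "b = Suc (Suc i)" | "a = Suc i" "b > Suc (Suc i)"
    | "a = Suc (Suc i)" | "a > Suc (Suc i)"
    using ab(2) by (metis (no_types, lifting) insertCI linorder_neqE_nat not_less_eq)
  then show "?L = ?R"
  proof cases
    case 1
    then show ?thesis using fin by (simp add: rules)
  next
    case 2
    then have "r ^ (i - a) = r * r ^ (i - Suc a)"
      by (simp flip: power_Suc add: Suc_diff_Suc)
    with 2 show ?thesis by (elim insertE; insert fin) (simp_all add: rules, ((rule ext, simp add: bmw_m_def field_simps)+)?)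
  next
    case 3
    then show ?thesis using fin by (simp add: rules)
  next
    case 6
    then have eq: "r ^ (b - Suc (Suc i)) = r * r ^ (b - Suc (Suc (Suc i)))"
      by (simp flip: power_Suc add: Suc_diff_Suc)
    show ?thesis by (insert 6 fin, simp add: rules eq, (rule ext, simp add: algebra_simps )?)
  next
    case 8
    then have eq: "r ^ (b - Suc (Suc i)) = r * r ^ (b - Suc (Suc (Suc i)))"
      by (simp flip: power_Suc add: Suc_diff_Suc)
    show ?thesis by (insert 8 fin, simp add: rules eq, rule ext, simp add: algebra_simps)
  next
    case 9
    with ab have eq: "r ^ (b - Suc (Suc i)) = r * r ^ (b - Suc (Suc (Suc i)))"
      by (simp flip: power_Suc add: Suc_diff_Suc)
    show ?thesis by (insert 9 fin, simp add: rules eq, rule ext, simp add: bmw_m_def field_simps)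
  next
    case 4
    then show ?thesis using fin by (simp add: rules)
  next
    case 5
    show ?thesis by (insert 5 fin, simp add: rules, (rule ext, simp add: bmw_m_def field_simps)?)
  next
    case 7
    show ?thesis by (insert 7 fin, simp add: rules, (rule ext, simp add: bmw_m_def field_simps)?)
  next
    case 10
    then show ?thesis using fin by (simp add: rules)
  qed
qed (use i in auto)

lemma lk_nu_commute:
  assumes lr: "l \<noteq> 0" "r \<noteq> 0" and i: "i \<in> {1..<n}" "j \<in> {1..<n}" "Suc i < j" and v: "v \<in> lk_supp n"
  shows "lk_nu l r n i (lk_nu l r n j v) = lk_nu l r n j (lk_nu l r n i v)"
proof (rule lk_lin_eqI[OF lk_lin_comp[OF lk_lin_nu lk_lin_nu] lk_lin_comp[OF lk_lin_nu lk_lin_nu] v])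
  fix a b assume "(a, b) \<in> lk_index n"
  then have ab: "1 \<le> a" "a < b" "b \<le> n" by (auto simp: lk_index_def)
  note rules = lk_nu_rules[OF i(1)] lk_nu_rules[OF i(2)] lk_nu_add lk_nu_diff lk_nu_scale lk_nu_divide
  have eq: "r ^ (j - Suc i) = r * r ^ (j - Suc (Suc i))"
    using i(3) by (simp flip: power_Suc add: Suc_diff_Suc)
  consider "a = i" | "a = Suc i" | "a = j" | "a = Suc j" | "a \<notin> {i, Suc i, j, Suc j}" by blast
  then show "lk_nu l r n i (lk_nu l r n j (lk_w a b)) = lk_nu l r n j (lk_nu l r n i (lk_w a b))"
  proof cases
    case 1
    consider "b = Suc i" | "b = j" | "b = Suc j" | "b \<notin> {i, Suc i, j, Suc j}"
      using 1 ab by blast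
    then show ?thesis
      by cases (insert 1 i ab lr, simp_all add: rules eq, ((rule ext, ((simp add: algebra_simps; fail) | (simp add: algebra_simps add_divide_distrib diff_divide_distrib; fail) | (simp add: divide_inverse algebra_simps; fail) | (simp add: field_simps; fail) | (simp add: bmw_m_def field_simps; fail)))+)?)
  next
    case 2
    consider "b = j" | "b = Suc j" | "b \<notin> {i, Suc i, j, Suc j}"
      using 2 ab by auto
    then show ?thesis
      by cases (insert 2 i ab lr, simp_all add: rules eq, ((rule ext, ((simp add: algebra_simps; fail) | (simp add: algebra_simps add_divide_distrib diff_divide_distrib; fail) | (simp add: divide_inverse algebra_simps; fail) | (simp add: field_simps; fail) | (simp add: bmw_m_def field_simps; fail)))+)?)
  next
    case 3
    consider "b = Suc j" | "b \<notin> {i, Suc i, j, Suc j}"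
      using 3 i ab by auto
    then show ?thesis
      by cases (insert 3 i ab lr, simp_all add: rules eq, ((rule ext, ((simp add: algebra_simps; fail) | (simp add: algebra_simps add_divide_distrib diff_divide_distrib; fail) | (simp add: divide_inverse algebra_simps; fail) | (simp add: field_simps; fail) | (simp add: bmw_m_def field_simps; fail)))+)?)
  next
    case 4
    have b: "b \<notin> {i, Suc i, j, Suc j}"
      using 4 i ab by auto
    show ?thesis
      by (insert b 4 i ab lr, simp add: rules eq, (rule ext, ((simp add: algebra_simps; fail) | (simp add: algebra_simps add_divide_distrib diff_divide_distrib; fail) | (simp add: divide_inverse algebra_simps; fail) | (simp add: field_simps; fail) | (simp add: bmw_m_def field_simps; fail)))?)
  next
    case 5
    consider "b = i" | "b = Suc i" | "b = j" | "b = Suc j" | "b \<notin> {i, Suc i, j, Suc j}"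
      by blast
    then show ?thesis
      by cases (insert 5 i ab lr, simp_all add: rules eq, ((rule ext, ((simp add: algebra_simps; fail) | (simp add: algebra_simps add_divide_distrib diff_divide_distrib; fail) | (simp add: divide_inverse algebra_simps; fail) | (simp add: field_simps; fail) | (simp add: bmw_m_def field_simps; fail)))+)?)
  qed
qed (use i in auto)

definition lk_e :: "complex \<Rightarrow> complex \<Rightarrow> nat \<Rightarrow> nat \<Rightarrow> lk_vec \<Rightarrow> lk_vec" where
  "lk_e l r n k v = (\<lambda>p. l / bmw_m r * (lk_nu l r n k (lk_nu l r n k v) p + bmw_m r * lk_nu l r n k v p - v p))"

lemma lk_lin_e: "k \<in> {1..<n} \<Longrightarrow> lk_lin n (lk_e l r n k)"
  unfolding lk_e_def [abs_def]
  by (rule lk_lin_scale[OF lk_lin_diff[OF lk_lin_add[OF lk_lin_comp[OF lk_lin_nu lk_lin_nu] lk_lin_scale[OF lk_lin_nu]] lk_lin_id]])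

definition lk_c :: "complex \<Rightarrow> complex \<Rightarrow> nat \<Rightarrow> nat \<times> nat \<Rightarrow> complex" where
  "lk_c l r k = (\<lambda>(i, j).
     if {i, j} \<inter> {k, k + 1} = {} then 0
     else if i = k \<and> j = k + 1 then l / bmw_m r * (1 / l ^ 2 + bmw_m r / l - 1)
     else if i = k then l * r ^ (j - k - 2)
     else if i = k + 1 then r ^ (j - k - 2)
     else if j = k then 1 / r ^ (k - 1 - i)
     else 1 / (l * r ^ (k - 1 - i)))"

lemma lk_e_basis:
  assumes lr: "l \<noteq> 0" "r \<noteq> 0" "bmw_m r \<noteq> 0" and k: "k \<in> {1..<n}" and ab: "(a, b) \<in> lk_index n"
  shows "lk_e l r n k (lk_w a b) = (\<lambda>p. lk_c l r k (a, b) * lk_w k (Suc k) p)"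
proof -
  have ab: "1 \<le> a" "a < b" "b \<le> n" using ab by (auto simp: lk_index_def)
  have q: "r * (r * x) + bmw_m r * (r * x) = x" for x
    using lr by (simp add: bmw_m_def algebra_simps)
  note rules = lk_nu_rules[OF k] lk_nu_add lk_nu_diff lk_nu_scale lk_nu_divide
  consider "{a, b} \<inter> {k, Suc k} = {}" | "a = k" "b = Suc k" | "a = k" "b > Suc k" | "a = Suc k"
    | "b = k" | "a < k" "b = Suc k"
    using ab by force
  then show ?thesis
    by cases (insert k ab lr, simp_all add: rules lk_e_def lk_c_def q fun_eq_iff,
        (simp_all add: field_simps power2_eq_square)?)
qed

lemma lk_e_image:
  assumes lr: "l \<noteq> 0" "r \<noteq> 0" "bmw_m r \<noteq> 0" and k: "k \<in> {1..<n}" and v: "v \<in> lk_supp n"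
  obtains c where "lk_e l r n k v = (\<lambda>p. c * lk_w k (Suc k) p)"
proof
  define B where "B = (\<lambda>v::lk_vec. \<lambda>p. (\<Sum>q\<in>lk_index n. v q * lk_c l r k q) * lk_w k (Suc k) p)"
  have w: "lk_w k (Suc k) \<in> lk_supp n" using k by (intro lk_supp_w) (auto simp: lk_index_def)
  have "lk_lin n B"
    unfolding lk_lin_def B_def
  proof (intro conjI ballI allI)
    show "(\<lambda>p. (\<Sum>q\<in>lk_index n. v q * lk_c l r k q) * lk_w k (Suc k) p) \<in> lk_supp n" for v
      by (rule lk_supp_ops(4)[OF w])
  qed (simp_all add: sum.distrib distrib_right mult.assoc flip: sum_distrib_left)
  then have "lk_e l r n k v = B v"
  proof (rule lk_lin_eqI[OF lk_lin_e[OF k] _ v])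
    fix a b assume ab: "(a, b) \<in> lk_index n"
    have "(\<Sum>q\<in>lk_index n. lk_w a b q * lk_c l r k q) = (\<Sum>q\<in>lk_index n. if q = (a, b) then lk_c l r k (a, b) else 0)"
      by (intro sum.cong) (auto simp: lk_w_def split: if_splits)
    then show "lk_e l r n k (lk_w a b) = B (lk_w a b)"
      using ab by (simp add: lk_e_basis[OF lr k ab] B_def)
  qed
  then show "lk_e l r n k v = (\<lambda>p. (\<Sum>q\<in>lk_index n. v q * lk_c l r k q) * lk_w k (Suc k) p)"
    by (simp add: B_def)
qed

lemma lk_nu_e:
  assumes lr: "l \<noteq> 0" "r \<noteq> 0" "bmw_m r \<noteq> 0" and k: "k \<in> {1..<n}" and v: "v \<in> lk_supp n"
  shows "lk_nu l r n k (lk_e l r n k v) = (\<lambda>p. 1 / l * lk_e l r n k v p)"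
proof -
  obtain c where c: "lk_e l r n k v = (\<lambda>p. c * lk_w k (Suc k) p)" by (rule lk_e_image[OF assms])
  show ?thesis unfolding c lk_nu_scale lk_nu_rules(2)[OF k] by simp
qed

lemma lk_e_nu_e:
  assumes lr: "l \<noteq> 0" "r \<noteq> 0" "bmw_m r \<noteq> 0" and k: "k \<in> {1..<n}" and j: "j \<in> {1..<n}" "j = Suc k \<or> k = Suc j"
    and v: "v \<in> lk_supp n"
  shows "lk_e l r n k (lk_nu l r n j (lk_e l r n k v)) = (\<lambda>p. l * lk_e l r n k v p)"
proof -
  obtain c where c: "lk_e l r n k v = (\<lambda>p. c * lk_w k (Suc k) p)" by (rule lk_e_image[OF lr k v])
  have E: "lk_lin n (lk_e l r n k)" by (rule lk_lin_e[OF k])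
  have w: "lk_w k (Suc k) \<in> lk_supp n" using k by (intro lk_supp_w) (auto simp: lk_index_def)
  have "lk_e l r n k (lk_nu l r n j (lk_w k (Suc k))) = (\<lambda>p. l * lk_w k (Suc k) p)"
    using j(2)
  proof
    assume "j = Suc k"
    then show ?thesis using k j(1) lr
      by (simp add: lk_nu_rules lk_e_basis lk_index_def lk_c_def)
  next
    assume kj: "k = Suc j"
    have in1: "(j, Suc k) \<in> lk_index n" "(j, k) \<in> lk_index n" "(k, Suc k) \<in> lk_index n"
      using kj k j by (auto simp: lk_index_def)
    have s: "lk_w j (Suc k) \<in> lk_supp n" "lk_w j k \<in> lk_supp n" "lk_w k (Suc k) \<in> lk_supp n"
      using in1 by (auto intro: lk_supp_w)
    have e1: "lk_nu l r n j (lk_w k (Suc k)) =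
        (\<lambda>p. (lk_w j (Suc k) p + bmw_m r * lk_w j k p) + (- bmw_m r) * lk_w k (Suc k) p)"
      using kj k lk_nu_rules(4)[OF j(1), of "Suc k"] by simp
    have e2: "lk_e l r n k (\<lambda>p. (lk_w j (Suc k) p + bmw_m r * lk_w j k p) + (- bmw_m r) * lk_w k (Suc k) p) =
        (\<lambda>p. (lk_e l r n k (lk_w j (Suc k)) p + bmw_m r * lk_e l r n k (lk_w j k) p)
        + (- bmw_m r) * lk_e l r n k (lk_w k (Suc k)) p)"
      using s by (simp only: lk_linD[OF E] lk_supp_ops)
    show ?thesis unfolding e1 e2
    proof
      fix p
      have c: "lk_c l r k (j, Suc k) = 1 / l" "lk_c l r k (j, k) = 1"
          "lk_c l r k (k, Suc k) = l / bmw_m r * (1 / l ^ 2 + bmw_m r / l - 1)"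
        unfolding kj by (simp_all add: lk_c_def)
      have "1 / l * x + bmw_m r * (1 * x) + - bmw_m r * (l / bmw_m r * (1 / l ^ 2 + bmw_m r / l - 1) * x) = l * x"
        for x using lr by (simp add: field_simps power2_eq_square)
      then show "lk_e l r n k (lk_w j (Suc k)) p + bmw_m r * lk_e l r n k (lk_w j k) p +
          - bmw_m r * lk_e l r n k (lk_w k (Suc k)) p = l * lk_w k (Suc k) p"
        unfolding in1[THEN lk_e_basis[OF lr k]] c .
    qed
  qed
  then show ?thesis
    unfolding c lk_nu_scale lk_linD(3)[OF E lk_nu_supp[OF j(1)]] by (simp add: mult.left_commute)
qed

section \<open>The action of the BMW algebra is well defined\<close>

declare split_paired_All [simp del]

definition lk_nu_inv :: "complex \<Rightarrow> complex \<Rightarrow> nat \<Rightarrow> nat \<Rightarrow> lk_vec \<Rightarrow> lk_vec" where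
  "lk_nu_inv l r n k v = (\<lambda>p. - l * (lk_nu l r n k (lk_nu l r n k v) p +
     ((bmw_m r - 1 / l) * lk_nu l r n k v p - (1 + bmw_m r / l) * v p)))"

lemma lk_lin_nu_inv: "k \<in> {1..<n} \<Longrightarrow> lk_lin n (lk_nu_inv l r n k)"
  unfolding lk_nu_inv_def [abs_def]
  by (rule lk_lin_scale[OF lk_lin_add[OF lk_lin_comp[OF lk_lin_nu lk_lin_nu]
        lk_lin_diff[OF lk_lin_scale[OF lk_lin_nu] lk_lin_scale[OF lk_lin_id]]]])

lemma lk_nu_inv:
  assumes lr: "l \<noteq> 0" "r \<noteq> 0" "bmw_m r \<noteq> 0" and k: "k \<in> {1..<n}" and v: "v \<in> lk_supp n"
  shows "lk_nu l r n k (lk_nu_inv l r n k v) = v" "lk_nu_inv l r n k (lk_nu l r n k v) = v"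
proof -
  let ?g = "lk_nu l r n k"
  have "?g (lk_e l r n k v) p = 1 / l * lk_e l r n k v p" for p
    using lk_nu_e[OF assms] by (rule fun_cong)
  then have "l / bmw_m r * (?g (?g (?g v)) p + bmw_m r * ?g (?g v) p - ?g v p) =
      1 / l * (l / bmw_m r * (?g (?g v) p + bmw_m r * ?g v p - v p))" for p
    by (simp only: lk_e_def lk_nu_scale lk_nu_diff lk_nu_add)
  moreover have "X = Y / l" if "l / bmw_m r * X = 1 / l * (l / bmw_m r * Y)" for X Y
    using that lr by (simp add: field_simps)
  ultimately have *: "?g (?g (?g v)) p + (bmw_m r * ?g (?g v) p - ?g v p) =
      (?g (?g v) p + bmw_m r * ?g v p - v p) / l" for p
    by (metis add_diff_eq)
  have **: "- l * (?g (?g (?g v)) p + ((bmw_m r - 1 / l) * ?g (?g v) p - (1 + bmw_m r / l) * ?g v p)) = v p" for p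
  proof -
    have "?g (?g (?g v)) p + ((bmw_m r - 1 / l) * ?g (?g v) p - (1 + bmw_m r / l) * ?g v p) = - v p / l"
      using *[of p] by (simp add: algebra_simps add_divide_distrib diff_divide_distrib)
    then show ?thesis using lr by simp
  qed
  show "?g (lk_nu_inv l r n k v) = v" "lk_nu_inv l r n k (?g v) = v"
    using ** by (simp_all only: lk_nu_inv_def lk_nu_scale lk_nu_add lk_nu_diff)
qed

lemma lk_nu_inv_closed:
  assumes "k \<in> {1..<n}" "v \<in> carrier (lk_space l r n)"
  shows "lk_nu_inv l r n k v \<in> carrier (lk_space l r n)"
proof -
  have v: "v \<in> lk_supp n" "v p \<in> carrier (base_field l r)" for p
    using assms(2) by (simp_all add: carrier_lk_space)
  have g: "lk_nu l r n k v p \<in> carrier (base_field l r)"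
    "lk_nu l r n k (lk_nu l r n k v) p \<in> carrier (base_field l r)" for p
    using lk_nu_closed[OF assms] lk_nu_closed[OF assms(1) lk_nu_closed[OF assms]]
    by (simp_all add: carrier_lk_space)
  have "lk_nu_inv l r n k v p \<in> carrier (base_field l r)" for p
    unfolding lk_nu_inv_def
    by (intro base_field_closed base_field_closed' g v)
  then show ?thesis
    using lk_linD(1)[OF lk_lin_nu_inv[OF assms(1)] v(1)] by (simp add: carrier_lk_space)
qed

lemma lk_nu_bij:
  assumes lr: "l \<noteq> 0" "r \<noteq> 0" "bmw_m r \<noteq> 0" and k: "k \<in> {1..<n}"
  shows "bij_betw (lk_nu l r n k) (carrier (lk_space l r n)) (carrier (lk_space l r n))"
  by (rule bij_betw_byWitness[where f' = "lk_nu_inv l r n k"])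
    (use lk_nu_inv[OF lr k] lk_nu_closed[OF k] lk_nu_inv_closed[OF k] in
      \<open>auto simp: carrier_lk_space\<close>)

lemma lk_letter_Ginv:
  assumes lr: "l \<noteq> 0" "r \<noteq> 0" "bmw_m r \<noteq> 0" and k: "k \<in> {1..<n}"
    and v: "v \<in> carrier (lk_space l r n)"
  shows "lk_letter l r n (Ginv k) v = lk_nu_inv l r n k v"
proof -
  have "v \<in> lk_supp n" using v by (simp add: carrier_lk_space)
  then show ?thesis
    unfolding lk_letter.simps
    by (intro inv_into_f_eq lk_nu_inv[OF lr k] lk_nu_inv_closed[OF k] v
        bij_betw_imp_inj_on[OF lk_nu_bij[OF lr k]])
qed

fun lk_letter' :: "complex \<Rightarrow> complex \<Rightarrow> nat \<Rightarrow> bmw_letter \<Rightarrow> lk_vec \<Rightarrow> lk_vec" where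
  "lk_letter' l r n (G k) = lk_nu l r n k"
| "lk_letter' l r n (Ginv k) = lk_nu_inv l r n k"

fun lk_word' :: "complex \<Rightarrow> complex \<Rightarrow> nat \<Rightarrow> bmw_word \<Rightarrow> lk_vec \<Rightarrow> lk_vec" where
  "lk_word' l r n (Word xs) = foldr (lk_letter' l r n) xs"

definition lk_free_act' where
  "lk_free_act' l r n x v =
     (\<lambda>p. \<Sum>w \<in> Poly_Mapping.keys x. Poly_Mapping.lookup x w * lk_word' l r n w v p)"

lemma lk_word'_plus: "lk_word' l r n (u + w) v = lk_word' l r n u (lk_word' l r n w v)"
  by (cases u; cases w) simp

lemma lk_word'_zero: "lk_word' l r n 0 v = v"
  by (simp add: zero_bmw_word_def)

lemma bmw_wordsE:
  assumes "w \<in> bmw_words n"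
  obtains xs where "w = Word xs" "set xs \<subseteq> G ` {1..<n} \<union> Ginv ` {1..<n}"
  using assms by (auto simp: bmw_words_def in_lists_conv_set subset_iff simp del: One_nat_def)

lemma lk_lin_word':
  assumes "w \<in> bmw_words n"
  shows "lk_lin n (lk_word' l r n w)"
proof -
  have "set xs \<subseteq> G ` {1..<n} \<union> Ginv ` {1..<n} \<Longrightarrow> lk_lin n (foldr (lk_letter' l r n) xs)" for xs
  proof (induction xs)
    case Nil
    then show ?case by (simp add: id_def lk_lin_id)
  next
    case (Cons x xs)
    then have "lk_lin n (lk_letter' l r n x)"
      by (auto simp del: One_nat_def intro!: lk_lin_nu lk_lin_nu_inv)
    with Cons show ?case by (simp add: o_def lk_lin_comp)
  qed
  moreover obtain xs where "w = Word xs" "set xs \<subseteq> G ` {1..<n} \<union> Ginv ` {1..<n}"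
    by (rule bmw_wordsE[OF assms])
  ultimately show ?thesis by simp
qed

lemma lk_word_eq:
  assumes lr: "l \<noteq> 0" "r \<noteq> 0" "bmw_m r \<noteq> 0"
    and w: "w \<in> bmw_words n" and v: "v \<in> carrier (lk_space l r n)"
  shows "lk_word l r n w v = lk_word' l r n w v"
proof -
  have "foldr (lk_letter l r n) xs v = foldr (lk_letter' l r n) xs v \<and>
        foldr (lk_letter l r n) xs v \<in> carrier (lk_space l r n)"
    if "set xs \<subseteq> G ` {1..<n} \<union> Ginv ` {1..<n}" for xs
    using that
  proof (induction xs)
    case Nil
    then show ?case using v by simp
  next
    case (Cons x xs)
    define u where "u = foldr (lk_letter l r n) xs v"
    have u: "u = foldr (lk_letter' l r n) xs v" "u \<in> carrier (lk_space l r n)"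
      using Cons by (auto simp: u_def)
    consider k where "k \<in> {1..<n}" "x = G k" | k where "k \<in> {1..<n}" "x = Ginv k"
      using Cons.prems by auto
    then have "lk_letter l r n x u = lk_letter' l r n x u \<and> lk_letter l r n x u \<in> carrier (lk_space l r n)"
    proof cases
      case 1
      then show ?thesis using lk_nu_closed[OF _ u(2)] by simp
    next
      case 2
      then show ?thesis using lk_nu_inv_closed[OF _ u(2)] lk_letter_Ginv[OF lr _ u(2), of k]
        by simp
    qed
    then show ?case by (auto simp: u(1)[symmetric] simp flip: u_def)
  qed
  moreover obtain xs where "w = Word xs" "set xs \<subseteq> G ` {1..<n} \<union> Ginv ` {1..<n}"
    by (rule bmw_wordsE[OF w])
  ultimately show ?thesis by simp
qed

lemma lk_free_act_eq:
  assumes lr: "l \<noteq> 0" "r \<noteq> 0" "bmw_m r \<noteq> 0"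
    and x: "x \<in> carrier (bmw_free l r n)" and v: "v \<in> carrier (lk_space l r n)"
  shows "lk_free_act l r n x v = lk_free_act' l r n x v"
proof -
  have "Poly_Mapping.keys x \<subseteq> bmw_words n" using x by (simp add: bmw_free_def)
  then show ?thesis
    unfolding lk_free_act_def lk_free_act'_def
    by (intro ext sum.cong refl) (metis (no_types) lk_word_eq[OF lr _ v] subsetD)
qed

lemma lk_free_act'_superset:
  assumes "finite S" "Poly_Mapping.keys x \<subseteq> S"
  shows "lk_free_act' l r n x v p = (\<Sum>w\<in>S. Poly_Mapping.lookup x w * lk_word' l r n w v p)"
  unfolding lk_free_act'_def using assms
  by (intro sum.mono_neutral_left) (auto simp: in_keys_iff)

lemma lk_free_act'_add: "lk_free_act' l r n (x + y) v = (\<lambda>p. lk_free_act' l r n x v p + lk_free_act' l r n y v p)"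
proof
  fix p
  let ?S = "Poly_Mapping.keys x \<union> Poly_Mapping.keys y"
  have "Poly_Mapping.keys (x + y) \<subseteq> ?S" by (rule Poly_Mapping.keys_add)
  then show "lk_free_act' l r n (x + y) v p = lk_free_act' l r n x v p + lk_free_act' l r n y v p"
    by (simp add: lk_free_act'_superset[of ?S] lookup_add algebra_simps sum.distrib)
qed

lemma lk_free_act'_uminus: "lk_free_act' l r n (- x) v = (\<lambda>p. - lk_free_act' l r n x v p)"
  by (simp add: lk_free_act'_def sum_negf)

lemma lk_free_act'_diff: "lk_free_act' l r n (x - y) v = (\<lambda>p. lk_free_act' l r n x v p - lk_free_act' l r n y v p)"
  unfolding diff_conv_add_uminus[of x y] lk_free_act'_add lk_free_act'_uminus by simp

lemma lk_free_act'_single: "lk_free_act' l r n (Poly_Mapping.single w c) v = (\<lambda>p. c * lk_word' l r n w v p)"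
  by (simp add: lk_free_act'_def)

lemma lk_free_act'_zero: "lk_free_act' l r n 0 v = (\<lambda>p. 0)"
  by (simp add: lk_free_act'_def)

lemma lk_free_act'_sum:
  "lk_free_act' l r n (sum f A) v = (\<lambda>p. \<Sum>a\<in>A. lk_free_act' l r n (f a) v p)"
  by (induction A rule: infinite_finite_induct) (simp_all add: lk_free_act'_zero lk_free_act'_add)

lemma lk_lin_sum:
  assumes "\<And>a. a \<in> A \<Longrightarrow> lk_lin n (f a)"
  shows "lk_lin n (\<lambda>v p. \<Sum>a\<in>A. f a v p)"
  using assms
proof (induction A rule: infinite_finite_induct)
  case (insert a A)
  then have "lk_lin n (\<lambda>v p. f a v p + (\<Sum>a\<in>A. f a v p))"
    by (intro lk_lin_add) auto
  with insert show ?case by simp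
qed (simp_all add: lk_lin_def lk_supp_ops(1))

lemma lk_lin_free_act':
  assumes "Poly_Mapping.keys x \<subseteq> bmw_words n"
  shows "lk_lin n (lk_free_act' l r n x)"
  unfolding lk_free_act'_def [abs_def]
  by (intro lk_lin_sum lk_lin_scale lk_lin_word') (use assms in auto)

lemma lk_lin_apply_sum:
  assumes A: "lk_lin n A" and f: "\<And>a. a \<in> S \<Longrightarrow> f a \<in> lk_supp n"
  shows "A (\<lambda>p. \<Sum>a\<in>S. f a p) = (\<lambda>p. \<Sum>a\<in>S. A (f a) p)"
proof -
  have "(\<lambda>p. \<Sum>a\<in>S. f a p) \<in> lk_supp n \<and> A (\<lambda>p. \<Sum>a\<in>S. f a p) = (\<lambda>p. \<Sum>a\<in>S. A (f a) p)"
    using f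
  proof (induction S rule: infinite_finite_induct)
    case (insert a S)
    then show ?case by (simp add: lk_supp_ops(2) lk_linD(2)[OF A])
  qed (simp_all add: lk_linD(4)[OF A] lk_supp_ops(1))
  then show ?thesis by simp
qed

lemma lk_free_act'_mult:
  assumes x: "Poly_Mapping.keys x \<subseteq> bmw_words n" and y: "Poly_Mapping.keys y \<subseteq> bmw_words n"
    and v: "v \<in> lk_supp n"
  shows "lk_free_act' l r n (x * y) v = lk_free_act' l r n x (lk_free_act' l r n y v)"
proof -
  let ?s = "\<lambda>x w. Poly_Mapping.single w (Poly_Mapping.lookup x w)"
  have dec: "x = (\<Sum>w\<in>Poly_Mapping.keys x. ?s x w)" for x :: bmw_free_elem
  proof (rule poly_mapping_eqI)
    fix k
    have "(\<Sum>w\<in>Poly_Mapping.keys x. Poly_Mapping.lookup (?s x w) k) =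
        (\<Sum>w\<in>Poly_Mapping.keys x. if w = k then Poly_Mapping.lookup x k else 0)"
      by (intro sum.cong) (auto simp: lookup_single when_def)
    then show "Poly_Mapping.lookup x k = Poly_Mapping.lookup (\<Sum>w\<in>Poly_Mapping.keys x. ?s x w) k"
      by (simp add: lookup_sum in_keys_iff)
  qed
  have "x * y = (\<Sum>u\<in>Poly_Mapping.keys x. \<Sum>w\<in>Poly_Mapping.keys y.
      Poly_Mapping.single (u + w) (Poly_Mapping.lookup x u * Poly_Mapping.lookup y w))"
    by (subst (1) dec[of x], subst (1) dec[of y]) (simp only: sum_product mult_single)
  then have 1: "lk_free_act' l r n (x * y) v = (\<lambda>p. \<Sum>u\<in>Poly_Mapping.keys x. \<Sum>w\<in>Poly_Mapping.keys y.
      Poly_Mapping.lookup x u * Poly_Mapping.lookup y w * lk_word' l r n u (lk_word' l r n w v) p)"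
    by (simp add: lk_free_act'_sum lk_free_act'_single lk_word'_plus)
  have sy: "lk_word' l r n w v \<in> lk_supp n" if "w \<in> Poly_Mapping.keys y" for w
    using lk_linD(1)[OF lk_lin_word' v] that y by blast
  have "lk_word' l r n u (lk_free_act' l r n y v) =
      (\<lambda>p. \<Sum>w\<in>Poly_Mapping.keys y. Poly_Mapping.lookup y w * lk_word' l r n u (lk_word' l r n w v) p)"
    if "u \<in> Poly_Mapping.keys x" for u
  proof -
    have u: "lk_lin n (lk_word' l r n u)" using lk_lin_word' that x by blast
    show ?thesis unfolding lk_free_act'_def
      by (subst lk_lin_apply_sum[OF u]) (auto simp: sy lk_supp_ops(4) lk_linD(3)[OF u])
  qed
  then have "lk_free_act' l r n x (lk_free_act' l r n y v) = (\<lambda>p. \<Sum>u\<in>Poly_Mapping.keys x.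
      Poly_Mapping.lookup x u * (\<Sum>w\<in>Poly_Mapping.keys y. Poly_Mapping.lookup y w * lk_word' l r n u (lk_word' l r n w v) p))"
    unfolding lk_free_act'_def[of l r n x] by (intro ext sum.cong) simp_all
  with 1 show ?thesis by (simp add: sum_distrib_left mult.assoc)
qed

lemma bmw_free_simps [simp]:
  "mult (bmw_free l r n) = (*)" "add (bmw_free l r n) = (+)"
  "\<one>\<^bsub>bmw_free l r n\<^esub> = 1" "\<zero>\<^bsub>bmw_free l r n\<^esub> = 0"
  by (simp_all add: bmw_free_def)

lemma bmw_free_gens:
  assumes "k \<in> {1..<n}"
  shows "gen k \<in> carrier (bmw_free l r n)" "gen_inv k \<in> carrier (bmw_free l r n)"
  using assms
  by (auto simp: bmw_free_def gen_def gen_inv_def bmw_words_def lookup_single when_def simp del: One_nat_def)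

lemma bmw_free_scal:
  "c \<in> carrier (base_field l r) \<Longrightarrow> scal c \<in> carrier (bmw_free l r n)"
  by (auto simp: bmw_free_def scal_def bmw_words_def zero_bmw_word_def lookup_single when_def)

lemma bmw_free_closed:
  "1 \<in> carrier (bmw_free l r n)"
  "x \<in> carrier (bmw_free l r n) \<Longrightarrow> y \<in> carrier (bmw_free l r n) \<Longrightarrow> x + y \<in> carrier (bmw_free l r n)"
  "x \<in> carrier (bmw_free l r n) \<Longrightarrow> y \<in> carrier (bmw_free l r n) \<Longrightarrow> x * y \<in> carrier (bmw_free l r n)"
  "x \<in> carrier (bmw_free l r n) \<Longrightarrow> - x \<in> carrier (bmw_free l r n)"
  "x \<in> carrier (bmw_free l r n) \<Longrightarrow> y \<in> carrier (bmw_free l r n) \<Longrightarrow> x - y \<in> carrier (bmw_free l r n)"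
proof -
  interpret R: ring "bmw_free l r n" by (rule bmw_free_ring)
  show "1 \<in> carrier (bmw_free l r n)" using R.one_closed by simp
  show add: "x + y \<in> carrier (bmw_free l r n)"
    if "x \<in> carrier (bmw_free l r n)" "y \<in> carrier (bmw_free l r n)" for x y
    using R.a_closed[OF that] by simp
  show "x * y \<in> carrier (bmw_free l r n)"
    if "x \<in> carrier (bmw_free l r n)" "y \<in> carrier (bmw_free l r n)" for x y
    using R.m_closed[OF that] by simp
  show minus: "- x \<in> carrier (bmw_free l r n)" if "x \<in> carrier (bmw_free l r n)" for x
    using that by (simp add: bmw_free_def)
  show "x - y \<in> carrier (bmw_free l r n)"
    if "x \<in> carrier (bmw_free l r n)" "y \<in> carrier (bmw_free l r n)" for x y
    using add[OF that(1) minus[OF that(2)]] by simp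
qed

lemma bmw_free_e:
  assumes "k \<in> {1..<n}"
  shows "gen_e l r k \<in> carrier (bmw_free l r n)"
  unfolding gen_e_def power2_eq_square
  by (intro bmw_free_closed bmw_free_gens bmw_free_scal base_field_closed base_field_closed' assms)

lemma lk_free_act'_base:
  "lk_free_act' l r n 1 v = v"
  "lk_free_act' l r n (scal c) v = (\<lambda>p. c * v p)"
  "lk_free_act' l r n (gen k) v = lk_nu l r n k v"
  "lk_free_act' l r n (gen_inv k) v = lk_nu_inv l r n k v"
  by (simp_all add: scal_def gen_def gen_inv_def lk_free_act'_single lk_word'_zero flip: single_one)

lemma bmw_free_keys: "x \<in> carrier (bmw_free l r n) \<Longrightarrow> Poly_Mapping.keys x \<subseteq> bmw_words n"
  by (simp add: bmw_free_def)

lemma lk_free_act'_times: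
  assumes "x \<in> carrier (bmw_free l r n)" "y \<in> carrier (bmw_free l r n)" "v \<in> lk_supp n"
  shows "lk_free_act' l r n (x * y) v = lk_free_act' l r n x (lk_free_act' l r n y v)"
  by (intro lk_free_act'_mult bmw_free_keys[OF assms(1)] bmw_free_keys[OF assms(2)] assms(3))

lemma lk_free_act'_e:
  assumes "k \<in> {1..<n}" "v \<in> lk_supp n"
  shows "lk_free_act' l r n (gen_e l r k) v = lk_e l r n k v"
proof -
  note carr = bmw_free_closed bmw_free_gens[OF assms(1)] bmw_free_scal base_field_closed base_field_closed'
  show ?thesis
    unfolding gen_e_def power2_eq_square lk_e_def
    by (subst lk_free_act'_times; (intro carr assms(2))?)
      (simp add: lk_free_act'_base lk_free_act'_diff lk_free_act'_add
        lk_free_act'_times[OF _ _ assms(2)] carr)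
qed

lemma lk_free_act_closed:
  assumes lr: "l \<noteq> 0" "r \<noteq> 0" "bmw_m r \<noteq> 0"
    and x: "x \<in> carrier (bmw_free l r n)" and v: "v \<in> carrier (lk_space l r n)"
  shows "lk_free_act l r n x v \<in> carrier (lk_space l r n)"
proof -
  have v': "v \<in> lk_supp n" using v by (simp add: carrier_lk_space)
  have "lk_letter' l r n a u \<in> carrier (lk_space l r n)"
    if "a \<in> G ` {1..<n} \<union> Ginv ` {1..<n}" "u \<in> carrier (lk_space l r n)" for a u
    using that(1) lk_nu_closed[OF _ that(2)] lk_nu_inv_closed[OF _ that(2)]
    by (auto simp del: One_nat_def)
  then have word: "foldr (lk_letter' l r n) xs v \<in> carrier (lk_space l r n)"
    if "set xs \<subseteq> G ` {1..<n} \<union> Ginv ` {1..<n}" for xs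
    using that v by (induction xs) (simp_all del: One_nat_def)
  have "lk_word' l r n w v p \<in> carrier (base_field l r)" if w: "w \<in> Poly_Mapping.keys x" for w p
  proof -
    obtain xs where xs: "w = Word xs" "set xs \<subseteq> G ` {1..<n} \<union> Ginv ` {1..<n}"
      using w bmw_free_keys[OF x] bmw_wordsE by blast
    show ?thesis using word[OF xs(2)] by (simp add: xs(1) carrier_lk_space)
  qed
  moreover have "Poly_Mapping.lookup x w \<in> carrier (base_field l r)" for w
    using x by (simp add: bmw_free_def)
  ultimately have "lk_free_act' l r n x v p \<in> carrier (base_field l r)" for p
    unfolding lk_free_act'_def by (intro base_field_sum base_field_closed)
  moreover have "lk_free_act' l r n x v \<in> lk_supp n"
    by (rule lk_linD(1)[OF lk_lin_free_act'[OF bmw_free_keys[OF x]] v'])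
  ultimately show ?thesis
    by (simp add: lk_free_act_eq[OF lr x v] carrier_lk_space)
qed

lemma bmw_relators_carrier: "bmw_relators l r n \<subseteq> carrier (bmw_free l r n)"
proof
  fix x assume "x \<in> bmw_relators l r n"
  then show "x \<in> carrier (bmw_free l r n)"
    unfolding bmw_relators_def Un_iff mem_Collect_eq
    by (elim disjE exE conjE; hypsubst)
      (intro bmw_free_closed bmw_free_gens bmw_free_e bmw_free_scal
        base_field_closed base_field_closed'; assumption)+
qed

lemma lk_relators:
  assumes lr: "l \<noteq> 0" "r \<noteq> 0" "bmw_m r \<noteq> 0" and x: "x \<in> bmw_relators l r n" and v: "v \<in> lk_supp n"
  shows "lk_free_act' l r n x v = (\<lambda>p. 0)"
proof -
  have nu: "lk_nu l r n k u \<in> lk_supp n" if "k \<in> {1..<n}" for k u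
    by (rule lk_nu_supp[OF that])
  have nu_inv: "lk_nu_inv l r n k u \<in> lk_supp n" "lk_e l r n k u \<in> lk_supp n"
    if "k \<in> {1..<n}" "u \<in> lk_supp n" for k u
    using lk_linD(1)[OF lk_lin_nu_inv that(2)] lk_linD(1)[OF lk_lin_e that(2)] that(1) by blast+
  note carr = bmw_free_closed bmw_free_gens bmw_free_e bmw_free_scal base_field_closed base_field_closed'
  note act = lk_free_act'_base lk_free_act'_e
  note times = lk_free_act'_times[where l = l and r = r and n = n]
  consider
      (inv1) i where "x = gen i * gen_inv i - 1" "i \<in> {1..<n}"
    | (inv2) i where "x = gen_inv i * gen i - 1" "i \<in> {1..<n}"
    | (comm) i j where "x = gen i * gen j - gen j * gen i" "i \<in> {1..<n}" "j \<in> {1..<n}" "\<bar>int i - int j\<bar> \<ge> 2"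
    | (braid) i where "x = gen i * gen (i + 1) * gen i - gen (i + 1) * gen i * gen (i + 1)"
        "i \<in> {1..<n}" "i + 1 \<in> {1..<n}"
    | (ge) i where "x = gen i * gen_e l r i - scal (1 / l) * gen_e l r i" "i \<in> {1..<n}"
    | (ege) i j where "x = gen_e l r i * gen j * gen_e l r i - scal l * gen_e l r i"
        "i \<in> {1..<n}" "j \<in> {1..<n}" "j = Suc i \<or> i = Suc j"
  proof -
    from x show ?thesis
      unfolding bmw_relators_def Un_iff mem_Collect_eq
      apply (elim disjE exE conjE)
      subgoal by (rule inv1)
      subgoal by (rule inv2)
      subgoal by (rule comm)
      subgoal by (rule braid)
      subgoal by (rule ge)
      subgoal for i by (rule ege[of i "i + 1"]) auto
      subgoal for i by (rule ege[of i "i - 1"]) auto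
      done
  qed
  then show ?thesis
  proof cases
    case inv1
    then show ?thesis
      by (simp add: lk_free_act'_diff times carr act v lk_nu_inv[OF lr] del: One_nat_def)
  next
    case inv2
    then show ?thesis
      by (simp add: lk_free_act'_diff times carr act v lk_nu_inv[OF lr] del: One_nat_def)
  next
    case comm
    have "lk_nu l r n i (lk_nu l r n j v) = lk_nu l r n j (lk_nu l r n i v)"
    proof (cases "i < j")
      case True
      then show ?thesis using comm lk_nu_commute[OF lr(1,2) _ _ _ v, of i j] by simp
    next
      case False
      then show ?thesis using comm lk_nu_commute[OF lr(1,2) _ _ _ v, of j i] by simp
    qed
    then show ?thesis using comm(1-3)
      by (simp add: lk_free_act'_diff times carr act v del: One_nat_def)
  next
    case braid
    then show ?thesis
      using lk_nu_braid[OF lr(1,2) _ _ v, of i, unfolded Suc_eq_plus1] nu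
      by (simp add: lk_free_act'_diff times carr act v del: One_nat_def)
  next
    case ge
    then show ?thesis
      by (simp add: lk_free_act'_diff times carr act v lk_nu_e[OF lr] del: One_nat_def)
  next
    case ege
    then show ?thesis
      using lk_e_nu_e[OF lr ege(2-4) v] nu nu_inv
      by (simp add: lk_free_act'_diff times carr act v del: One_nat_def)
  qed
qed

lemma lk_annihilator_ideal:
  "ideal {x \<in> carrier (bmw_free l r n). \<forall>v \<in> lk_supp n. lk_free_act' l r n x v = (\<lambda>p. 0)} (bmw_free l r n)"
  (is "ideal ?I _")
proof -
  interpret R: ring "bmw_free l r n" by (rule bmw_free_ring)
  show ?thesis
  proof (rule idealI)
    show "subgroup ?I (add_monoid (bmw_free l r n))"
    proof (rule R.add.subgroupI)
      show "?I \<noteq> {}"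
        using R.zero_closed by (auto simp: lk_free_act'_zero)
      fix a assume a: "a \<in> ?I"
      then have "\<ominus>\<^bsub>bmw_free l r n\<^esub> a = - a"
        using bmw_free_closed(4) by (intro R.minus_equality) auto
      then show "\<ominus>\<^bsub>bmw_free l r n\<^esub> a \<in> ?I"
        using a by (simp add: bmw_free_closed lk_free_act'_uminus)
    qed (auto simp: bmw_free_closed lk_free_act'_add)
  next
    fix a x assume a: "a \<in> ?I" and x: "x \<in> carrier (bmw_free l r n)"
    have X: "lk_lin n (lk_free_act' l r n x)"
      by (rule lk_lin_free_act'[OF bmw_free_keys[OF x]])
    from a x show "x \<otimes>\<^bsub>bmw_free l r n\<^esub> a \<in> ?I"
      by (simp add: bmw_free_closed lk_free_act'_times lk_linD(4)[OF X])
    from a x show "a \<otimes>\<^bsub>bmw_free l r n\<^esub> x \<in> ?I"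
      by (simp add: bmw_free_closed lk_free_act'_times lk_linD(1)[OF X])
  qed (rule bmw_free_ring)
qed

theorem lk_act_coset:
  assumes lr: "l \<noteq> 0" "r \<noteq> 0" "r\<^sup>2 \<noteq> 1"
    and x: "x \<in> carrier (bmw_free l r n)" and v: "v \<in> carrier (lk_space l r n)"
  defines "J \<equiv> Idl\<^bsub>bmw_free l r n\<^esub> (bmw_relators l r n)"
  shows "lk_act l r n (J +>\<^bsub>bmw_free l r n\<^esub> x) v = lk_free_act l r n x v"
proof -
  interpret R: ring "bmw_free l r n" by (rule bmw_free_ring)
  have "bmw_m r \<noteq> 0"
    using lr by (simp add: bmw_m_def field_simps power2_eq_square)
  note lr = lr(1,2) this
  interpret J: ideal J "bmw_free l r n"
    unfolding J_def by (rule R.genideal_ideal[OF bmw_relators_carrier])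
  have v': "v \<in> lk_supp n" using v by (simp add: carrier_lk_space)
  have J: "J \<subseteq> {x \<in> carrier (bmw_free l r n). \<forall>v \<in> lk_supp n. lk_free_act' l r n x v = (\<lambda>p. 0)}"
    unfolding J_def
    by (rule R.genideal_minimal[OF lk_annihilator_ideal])
      (use bmw_relators_carrier lk_relators[OF lr] in blast)
  have "(\<lambda>y. lk_free_act l r n y v) ` (J +>\<^bsub>bmw_free l r n\<^esub> x) = {lk_free_act l r n x v}"
  proof -
    have "lk_free_act l r n (h + x) v = lk_free_act l r n x v" if h: "h \<in> J" for h
    proof -
      have hc: "h \<in> carrier (bmw_free l r n)" "lk_free_act' l r n h v = (\<lambda>p. 0)" using J h v' by auto
      then show ?thesis
        by (simp add: lk_free_act_eq[OF lr _ v] x bmw_free_closed lk_free_act'_add)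
    qed
    moreover have "J \<noteq> {}" using J.zero_closed by blast
    ultimately show ?thesis
      by (auto simp: a_r_coset_def' image_iff)
  qed
  then show ?thesis by (simp add: lk_act_def)
qed

declare split_paired_All [simp]

end

theory Submission
  imports Defs
begin

text \<open>
  Functionals on the space are coefficient vectors. The element \<open>e\<^sub>k\<close> acts as
  \<open>v \<mapsto> c\<^sub>k(v) w\<^sub>k\<^sub>,\<^sub>k\<^sub>+\<^sub>1\<close>, and \<open>w\<^sub>k\<^sub>,\<^sub>k\<^sub>+\<^sub>1\<close> generates the whole space, so all \<open>c\<^sub>k\<close> and all their
  translates vanish on a proper invariant subspace. The required dimension leaves room for only
  \<open>n - 1\<close> independent functionals. If \<open>l \<noteq> - r\<^sup>3\<close>, the \<open>c\<^sub>k\<close> are independent, and there is one more: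
  for \<open>l \<noteq> r\<close> the translate of \<open>c\<^sub>2\<close> by \<open>g\<^sub>3\<close>, which is nonzero on
  \<open>w\<^sub>2\<^sub>5 - r w\<^sub>1\<^sub>5 - r w\<^sub>2\<^sub>4 + r\<^sup>2 w\<^sub>1\<^sub>4\<close> whereas the \<open>c\<^sub>k\<close> are zero; for \<open>l = r\<close> the \<open>n\<close> independent functionals
  \<open>\<phi>\<^sub>i\<close> with \<open>c\<^sub>k = \<phi>\<^sub>k\<^sub>+\<^sub>1 + \<phi>\<^sub>k\<close> all vanish.

  If \<open>l = - r\<^sup>3\<close>, the common kernel of the \<open>\<phi>\<^sub>i\<close> is a deformation of the cycle space of the
  complete graph on \<open>n\<close> vertices: it is invariant and spanned by deformed triangles
  \<open>t\<^sub>a\<^sub>b\<^sub>c\<close>, which are all obtained from \<open>t\<^sub>1\<^sub>2\<^sub>3\<close>. A nonzero invariant subspace of it contains a nonzero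
  \<open>v\<close> with \<open>g\<^sub>1 v = - v / r\<close>. For such \<open>v\<close>, \<open>(g\<^sub>1 - r) g\<^sub>2 v + r\<^sup>2 v\<close> is a multiple \<open>\<beta>(v) t\<^sub>1\<^sub>2\<^sub>3\<close>, and
  \<open>\<beta>\<close> cannot vanish on everything obtained from \<open>v\<close> by \<open>g\<^sub>3, \<dots>, g\<^sub>n\<^sub>-\<^sub>1\<close>, because that would force
  \<open>1 + r\<^sup>2 + \<dots> + (r\<^sup>2)\<^bsup>n - 1\<^esup> = 0\<close>. Two different irreducible subspaces meet in \<open>0\<close>, and two of this
  dimension do not fit into the space.
\<close>

declare split_paired_All [simp del]

section \<open>Invariance expressed through the generators\<close>

definition lk_stable :: "complex \<Rightarrow> complex \<Rightarrow> nat \<Rightarrow> lk_vec set \<Rightarrow> bool" where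
  "lk_stable l r n W \<longleftrightarrow> W \<subseteq> carrier (lk_space l r n) \<and> (\<lambda>p. 0) \<in> W \<and>
     (\<forall>u\<in>W. \<forall>v\<in>W. (\<lambda>p. u p + v p) \<in> W) \<and>
     (\<forall>c\<in>carrier (base_field l r). \<forall>v\<in>W. (\<lambda>p. c * v p) \<in> W) \<and>
     (\<forall>k\<in>{1..<n}. \<forall>v\<in>W. lk_nu l r n k v \<in> W)"

lemma lk_space_simps [simp]:
  "\<zero>\<^bsub>lk_space l r n\<^esub> = (\<lambda>p. 0)"
  "u \<oplus>\<^bsub>lk_space l r n\<^esub> v = (\<lambda>p. u p + v p)"
  "c \<odot>\<^bsub>lk_space l r n\<^esub> v = (\<lambda>p. c * v p)"
  by (simp_all add: lk_space_def)

lemma subspace_lk_space_iff: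
  "VectorSpace.subspace (base_field l r) W (lk_space l r n) \<longleftrightarrow>
     W \<subseteq> carrier (lk_space l r n) \<and> (\<lambda>p. 0) \<in> W \<and>
     (\<forall>u\<in>W. \<forall>v\<in>W. (\<lambda>p. u p + v p) \<in> W) \<and>
     (\<forall>c\<in>carrier (base_field l r). \<forall>v\<in>W. (\<lambda>p. c * v p) \<in> W)"
  using vectorspace_lk_space[of l r n]
  by (auto simp: VectorSpace.subspace_def submodule_def vectorspace_def)

lemma lk_stableD:
  assumes "lk_stable l r n W"
  shows "v \<in> W \<Longrightarrow> v \<in> carrier (lk_space l r n)" "v \<in> W \<Longrightarrow> v \<in> lk_supp n" "(\<lambda>p. 0) \<in> W"
    "u \<in> W \<Longrightarrow> v \<in> W \<Longrightarrow> (\<lambda>p. u p + v p) \<in> W"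
    "c \<in> carrier (base_field l r) \<Longrightarrow> v \<in> W \<Longrightarrow> (\<lambda>p. c * v p) \<in> W"
    "u \<in> W \<Longrightarrow> v \<in> W \<Longrightarrow> (\<lambda>p. u p - v p) \<in> W"
    "k \<in> {1..<n} \<Longrightarrow> v \<in> W \<Longrightarrow> lk_nu l r n k v \<in> W"
proof -
  note * = assms[unfolded lk_stable_def]
  show "v \<in> W \<Longrightarrow> v \<in> carrier (lk_space l r n)" "(\<lambda>p. 0) \<in> W"
    "k \<in> {1..<n} \<Longrightarrow> v \<in> W \<Longrightarrow> lk_nu l r n k v \<in> W"
    using * by blast+
  then show "v \<in> W \<Longrightarrow> v \<in> lk_supp n" by (simp add: carrier_lk_space)
  show add: "u \<in> W \<Longrightarrow> v \<in> W \<Longrightarrow> (\<lambda>p. u p + v p) \<in> W" for u v using * by blast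
  show scale: "c \<in> carrier (base_field l r) \<Longrightarrow> v \<in> W \<Longrightarrow> (\<lambda>p. c * v p) \<in> W" for c v using * by blast
  show "u \<in> W \<Longrightarrow> v \<in> W \<Longrightarrow> (\<lambda>p. u p - v p) \<in> W"
    using add[of u "\<lambda>p. - 1 * v p"] scale[of "- 1" v] by simp
qed

lemma lk_stable_sum:
  assumes "lk_stable l r n W" "\<And>a. a \<in> A \<Longrightarrow> f a \<in> W"
  shows "(\<lambda>p. \<Sum>a\<in>A. f a p) \<in> W"
  using assms(2)
  by (induction A rule: infinite_finite_induct) (simp_all add: lk_stableD[OF assms(1)])

text \<open>The cubic relation satisfied by \<open>g_k\<close> makes its inverse a quadratic
  polynomial in \<open>g_k\<close> over F, so stability under the generators carries over to their
  inverses.\<close>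

lemma lk_stable_nu_inv:
  assumes "lk_stable l r n W" "k \<in> {1..<n}" "v \<in> W"
  shows "lk_nu_inv l r n k v \<in> W"
  unfolding lk_nu_inv_def
  by (intro lk_stableD[OF assms(1)] base_field_closed base_field_closed' assms(2,3))

lemma lk_stable_e:
  assumes "lk_stable l r n W" "k \<in> {1..<n}" "v \<in> W"
  shows "lk_e l r n k v \<in> W"
  unfolding lk_e_def
  by (intro lk_stableD[OF assms(1)] base_field_closed base_field_closed' assms(2,3))

text \<open>By \<open>lk_act_coset\<close> a coset acts as any of its representatives, and a
  representative acts as an F-combination of words in the generators and their inverses. Since
  \<open>r ^ 2\<close> is not 1, \<open>bmw_m r\<close> is nonzero and this action is well
  defined.\<close>

lemma invariant_subspace_iff:
  assumes lr: "l \<noteq> 0" "r \<noteq> 0" "r\<^sup>2 \<noteq> 1"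
  shows "invariant_subspace l r n W \<longleftrightarrow> lk_stable l r n W"
proof -
  have m: "bmw_m r \<noteq> 0"
    using lr by (simp add: bmw_m_def field_simps power2_eq_square)
  define J where "J = Idl\<^bsub>bmw_free l r n\<^esub> (bmw_relators l r n)"
  have carr: "carrier (bmw_algebra l r n) = (\<lambda>x. J +>\<^bsub>bmw_free l r n\<^esub> x) ` carrier (bmw_free l r n)"
    unfolding bmw_algebra_def J_def[symmetric] FactRing_def A_RCOSETS_def'
    by auto
  have act: "lk_act l r n (J +>\<^bsub>bmw_free l r n\<^esub> x) v = lk_free_act' l r n x v"
    if "x \<in> carrier (bmw_free l r n)" "v \<in> carrier (lk_space l r n)" for x v
    using lk_act_coset[OF lr that] lk_free_act_eq[OF lr(1,2) m that] by (simp add: J_def)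
  have *: "(\<forall>b \<in> carrier (bmw_algebra l r n). \<forall>v \<in> W. lk_act l r n b v \<in> W) \<longleftrightarrow>
      (\<forall>x\<in>carrier (bmw_free l r n). \<forall>v\<in>W. lk_free_act' l r n x v \<in> W)"
    if "W \<subseteq> carrier (lk_space l r n)"
    unfolding carr ball_simps(9) by (intro ball_cong refl) (simp add: act subsetD[OF that])
  show ?thesis
  proof
    assume inv: "invariant_subspace l r n W"
    then have sub: "VectorSpace.subspace (base_field l r) W (lk_space l r n)"
      by (simp add: invariant_subspace_def)
    then have W: "W \<subseteq> carrier (lk_space l r n)" by (simp add: subspace_lk_space_iff)
    have "lk_nu l r n k v \<in> W" if "k \<in> {1..<n}" "v \<in> W" for k v
      using inv that bmw_free_gens(1)[OF that(1), of l r] *[OF W]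
      unfolding invariant_subspace_def by (metis lk_free_act'_base(3))
    with sub show "lk_stable l r n W" by (simp add: lk_stable_def subspace_lk_space_iff)
  next
    assume st: "lk_stable l r n W"
    then have sub: "VectorSpace.subspace (base_field l r) W (lk_space l r n)"
      by (simp add: lk_stable_def subspace_lk_space_iff)
    then have W: "W \<subseteq> carrier (lk_space l r n)" by (simp add: subspace_lk_space_iff)
    have word: "lk_word' l r n w v \<in> W" if wv: "w \<in> bmw_words n" "v \<in> W" for w v
    proof -
      obtain xs where xs: "w = Word xs" "set xs \<subseteq> G ` {1..<n} \<union> Ginv ` {1..<n}"
        by (rule bmw_wordsE[OF wv(1)])
      have "foldr (lk_letter' l r n) xs v \<in> W"
        using xs(2)
      proof (induction xs)
        case (Cons x xs)
        then have IH: "foldr (lk_letter' l r n) xs v \<in> W" by simp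
        from Cons.prems consider k where "k \<in> {1..<n}" "x = G k" | k where "k \<in> {1..<n}" "x = Ginv k"
          by auto
        then show ?case
          by cases (simp_all add: IH lk_stable_nu_inv[OF st] lk_stableD(7)[OF st] del: One_nat_def)
      qed (use wv in simp)
      with xs(1) show ?thesis by simp
    qed
    have "lk_free_act' l r n x v \<in> W" if x: "x \<in> carrier (bmw_free l r n)" and v: "v \<in> W" for x v
      unfolding lk_free_act'_def
    proof (rule lk_stable_sum[OF st])
      fix w assume w: "w \<in> Poly_Mapping.keys x"
      have "Poly_Mapping.lookup x w \<in> carrier (base_field l r)"
        using x by (simp add: bmw_free_def)
      moreover have "lk_word' l r n w v \<in> W"
        using word[OF _ v] bmw_free_keys[OF x] w by blast
      ultimately show "(\<lambda>p. Poly_Mapping.lookup x w * lk_word' l r n w v p) \<in> W"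
        by (rule lk_stableD(5)[OF st])
    qed
    then show "invariant_subspace l r n W"
      using sub *[OF W] by (simp add: invariant_subspace_def)
  qed
qed

section \<open>Dimensions of subspaces\<close>

lemma finsum_lk_space:
  assumes "f \<in> A \<rightarrow> carrier (lk_space l r n)"
  shows "finsum (lk_space l r n) f A = (\<lambda>p. \<Sum>a\<in>A. f a p)"
proof -
  interpret V: vectorspace "base_field l r" "lk_space l r n" by (rule vectorspace_lk_space)
  show ?thesis using assms
  proof (induction A rule: infinite_finite_induct)
    case (insert a A)
    then show ?case by (subst V.M.finsum_insert) auto
  qed (simp_all add: V.M.finsum_infinite)
qed

lemma lincomb_lk_space:
  assumes "A \<subseteq> carrier (lk_space l r n)" "a \<in> A \<rightarrow> carrier (base_field l r)"
  shows "LinearCombinations.module.lincomb (lk_space l r n) a A = (\<lambda>p. \<Sum>v\<in>A. a v * v p)"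
proof -
  interpret V: vectorspace "base_field l r" "lk_space l r n" by (rule vectorspace_lk_space)
  have "(\<lambda>v. a v \<odot>\<^bsub>lk_space l r n\<^esub> v) \<in> A \<rightarrow> carrier (lk_space l r n)"
    using assms V.smult_closed by blast
  from finsum_lk_space[OF this] show ?thesis by (simp add: V.lincomb_def)
qed

lemma lk_w_carrier: "(i, j) \<in> lk_index n \<Longrightarrow> lk_w i j \<in> carrier (lk_space l r n)"
  by (auto simp: carrier_lk_space lk_supp_w) (simp add: lk_w_def)

lemma lk_w_inj: "inj (\<lambda>(i, j). lk_w i j)"
  by (auto simp: inj_def lk_w_def fun_eq_iff split: if_splits)

lemma lk_supp_expand:
  assumes "v \<in> lk_supp n"
  shows "v p = (\<Sum>q\<in>lk_index n. v q * lk_w (fst q) (snd q) p)"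
proof -
  have "(\<Sum>q\<in>lk_index n. v q * lk_w (fst q) (snd q) p) = (\<Sum>q\<in>lk_index n. if q = p then v p else 0)"
    by (intro sum.cong) (auto simp: lk_w_def)
  then show ?thesis using assms by (auto dest: lk_suppD)
qed

lemma
  shows lk_space_fin_dim: "vectorspace.fin_dim (base_field l r) (lk_space l r n)"
    and lk_space_dim: "vectorspace.dim (base_field l r) (lk_space l r n) = card (lk_index n)"
proof -
  interpret V: vectorspace "base_field l r" "lk_space l r n" by (rule vectorspace_lk_space)
  define B where "B = (\<lambda>(i, j). lk_w i j) ` lk_index n"
  have fin: "finite B" by (simp add: B_def)
  have B: "B \<subseteq> carrier (lk_space l r n)" by (auto simp: B_def lk_w_carrier)
  have inj: "inj_on (\<lambda>(i, j). lk_w i j) (lk_index n)"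
    using lk_w_inj by (rule inj_on_subset) simp
  have lc: "V.lincomb a B p = (\<Sum>q\<in>lk_index n. a (lk_w (fst q) (snd q)) * lk_w (fst q) (snd q) p)"
    if "a \<in> B \<rightarrow> carrier (base_field l r)" for a p
    using inj that unfolding lincomb_lk_space[OF B that]
    by (simp add: B_def sum.reindex case_prod_unfold)
  have lc': "V.lincomb a B p = (if p \<in> lk_index n then a (lk_w (fst p) (snd p)) else 0)"
    if "a \<in> B \<rightarrow> carrier (base_field l r)" for a p
  proof -
    have "V.lincomb a B p = (\<Sum>q\<in>lk_index n. if q = p then a (lk_w (fst p) (snd p)) else 0)"
      unfolding lc[OF that] by (intro sum.cong) (auto simp: lk_w_def)
    then show ?thesis by simp
  qed
  have "V.lin_indpt B"
  proof (rule V.finite_lin_indpt2[OF fin B])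
    fix a assume a: "a \<in> B \<rightarrow> carrier (base_field l r)" "V.lincomb a B = \<zero>\<^bsub>lk_space l r n\<^esub>"
    show "\<forall>v\<in>B. a v = \<zero>\<^bsub>base_field l r\<^esub>"
    proof
      fix v assume "v \<in> B"
      then obtain i j where ij: "(i, j) \<in> lk_index n" "v = lk_w i j" by (auto simp: B_def)
      have "V.lincomb a B (i, j) = 0" using a(2) by simp
      then show "a v = \<zero>\<^bsub>base_field l r\<^esub>" using ij by (simp add: lc'[OF a(1)])
    qed
  qed
  moreover have gen: "V.gen_set B"
  proof
    show "V.span B \<subseteq> carrier (lk_space l r n)" using B by (rule V.span_is_subset2)
    show "carrier (lk_space l r n) \<subseteq> V.span B"
    proof
      fix v assume v: "v \<in> carrier (lk_space l r n)"
      define a where "a = (\<lambda>w. v (inv_into (lk_index n) (\<lambda>(i, j). lk_w i j) w))"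
      have aw: "a (lk_w i j) = v (i, j)" if "(i, j) \<in> lk_index n" for i j
        using inv_into_f_f[OF inj that] by (simp add: a_def)
      have a: "a \<in> B \<rightarrow> carrier (base_field l r)"
        using v aw by (auto simp: B_def carrier_lk_space)
      have "v p = V.lincomb a B p" for p
        using v aw[of "fst p" "snd p"] by (auto simp: lc'[OF a] carrier_lk_space dest: lk_suppD)
      then have "v = V.lincomb a B" by blast
      then show "v \<in> V.span B" using a fin B by (auto simp: V.finite_span)
    qed
  qed
  ultimately have "V.basis B" using B by (simp add: V.basis_def)
  from V.dim_basis[OF fin this] show "V.dim = card (lk_index n)"
    using inj by (simp add: B_def card_image)
  show "V.fin_dim" using fin B gen by (auto simp: V.fin_dim_def)
qed

lemma card_lk_index: "card (lk_index n) = n * (n - 1) div 2"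
proof (induction n)
  case 0
  have "lk_index 0 = {}" by (auto simp: lk_index_def)
  then show ?case by simp
next
  case (Suc n)
  have "lk_index (Suc n) = lk_index n \<union> (\<lambda>i. (i, Suc n)) ` {1..n}"
    by (auto simp: lk_index_def)
  moreover have "lk_index n \<inter> (\<lambda>i. (i, Suc n)) ` {1..n} = {}" by (auto simp: lk_index_def)
  ultimately have "card (lk_index (Suc n)) = card (lk_index n) + n"
    by (simp add: card_Un_disjoint card_image inj_on_def)
  also have "\<dots> = Suc n * (Suc n - 1) div 2"
    unfolding Suc by (cases n) (simp_all add: algebra_simps)
  finally show ?case .
qed

text \<open>\<open>lk_dim\<close> refers to the structure with carrier \<open>W\<close>. A basis is
  carried over to the ambient space, where span and independence can be compared for different
  subspaces.\<close>

lemma lk_subspace_basis: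
  assumes "VectorSpace.subspace (base_field l r) W (lk_space l r n)"
  obtains B where "finite B" "B \<subseteq> W" "LinearCombinations.module.lin_indpt (base_field l r) (lk_space l r n) B"
    "card B = lk_dim l r n W" "LinearCombinations.module.span (base_field l r) (lk_space l r n) B = W"
proof -
  interpret V: vectorspace "base_field l r" "lk_space l r n" by (rule vectorspace_lk_space)
  note fd = lk_space_fin_dim[of l r n]
  have sub: "submodule (base_field l r) W (lk_space l r n)"
    using assms by simp
  have WV: "W \<subseteq> carrier (lk_space l r n)" using sub by (simp add: submodule_def)
  have WI: "vectorspace (base_field l r) (lk_space l r n\<lparr>carrier := W\<rparr>)"
    using assms by (rule V.subspace_is_vs)
  interpret W: vectorspace "base_field l r" "lk_space l r n\<lparr>carrier := W\<rparr>" by (rule WI)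
  have small: "finite A \<and> card A \<le> V.dim" if "A \<subseteq> W \<and> W.lin_indpt A" for A
  proof -
    have "A \<subseteq> carrier (lk_space l r n)" "V.lin_indpt A"
      using that WV V.span_li_not_depend(2)[OF _ sub, of A] by blast+
    then show ?thesis using V.li_le_dim[OF fd, of A] by blast
  qed
  \<comment> \<open>Finite dimension of \<open>W\<close> has to be established first: independent
    subsets of \<open>W\<close> stay independent in the ambient space, so their size is bounded and
    a maximal one exists.\<close>
  have "\<exists>A. finite A \<and> maximal A (\<lambda>S. S \<subseteq> carrier (lk_space l r n\<lparr>carrier := W\<rparr>) \<and> W.lin_indpt S)"
  proof (rule maximal_exists[where N = V.dim and B = "{}"])
    show "{} \<subseteq> carrier (lk_space l r n\<lparr>carrier := W\<rparr>) \<and> W.lin_indpt {}"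
      by (intro conjI W.finite_lin_indpt2) simp_all
  qed (use small in simp)
  then obtain A where A: "finite A" "maximal A (\<lambda>S. S \<subseteq> carrier (lk_space l r n\<lparr>carrier := W\<rparr>) \<and> W.lin_indpt S)"
    by blast
  have basis: "W.basis A" by (rule W.max_li_is_basis[OF A(2)])
  have AW: "A \<subseteq> W" using basis by (simp add: W.basis_def)
  show ?thesis
  proof
    show "finite A" "A \<subseteq> W" by fact+
    show "V.lin_indpt A" using basis V.span_li_not_depend(2)[OF AW sub] by (simp add: W.basis_def)
    show "card A = lk_dim l r n W" using W.dim_basis[OF A(1) basis] by (simp add: lk_dim_def)
    show "V.span A = W" using basis V.span_li_not_depend(1)[OF AW sub] by (simp add: W.basis_def)
  qed
qed

lemma lin_indpt_card_add_le:
  assumes A: "finite A" "A \<subseteq> carrier (lk_space l r n)"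
      "LinearCombinations.module.lin_indpt (base_field l r) (lk_space l r n) A"
    and B: "finite B" "B \<subseteq> carrier (lk_space l r n)"
      "LinearCombinations.module.lin_indpt (base_field l r) (lk_space l r n) B"
    and disj: "LinearCombinations.module.span (base_field l r) (lk_space l r n) A \<inter>
      LinearCombinations.module.span (base_field l r) (lk_space l r n) B \<subseteq> {\<lambda>p. 0}"
  shows "card A + card B \<le> card (lk_index n)"
proof -
  interpret V: vectorspace "base_field l r" "lk_space l r n" by (rule vectorspace_lk_space)
  have "v = (\<lambda>p. 0)" if "v \<in> A" "v \<in> B" for v
    using that V.in_own_span[OF A(2)] V.in_own_span[OF B(2)] disj by blast
  then have AB: "A \<inter> B = {}"
    using V.vs_zero_lin_dep[OF A(2,3)] by auto
  have "V.lin_indpt (A \<union> B)"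
  proof (rule V.finite_lin_indpt2)
    fix a assume a: "a \<in> A \<union> B \<rightarrow> carrier (base_field l r)"
      "V.lincomb a (A \<union> B) = \<zero>\<^bsub>lk_space l r n\<^esub>"
    then have aA: "a \<in> A \<rightarrow> carrier (base_field l r)" and aB: "a \<in> B \<rightarrow> carrier (base_field l r)"
      and aB': "(\<lambda>v. - a v) \<in> B \<rightarrow> carrier (base_field l r)"
      by auto
    have 0: "(\<Sum>v\<in>A. a v * v p) + (\<Sum>v\<in>B. a v * v p) = 0" for p
    proof -
      have "V.lincomb a (A \<union> B) = (\<lambda>p. \<Sum>v\<in>A\<union>B. a v * v p)"
        by (rule lincomb_lk_space) (use A B a in auto)
      then have "(\<Sum>v\<in>A\<union>B. a v * v p) = 0" using a(2) by (metis lk_space_simps(1))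
      then show ?thesis using A(1) B(1) AB by (simp add: sum.union_disjoint)
    qed
    \<comment> \<open>Moving the part over \<open>B\<close> to the other side gives a vector common
      to both spans. It is zero, so the relation splits into one over \<open>A\<close> and one over
      \<open>B\<close>.\<close>
    have "V.lincomb a A = V.lincomb (\<lambda>v. - a v) B"
      unfolding lincomb_lk_space[OF A(2) aA] lincomb_lk_space[OF B(2) aB']
      using 0 by (simp add: sum_negf fun_eq_iff eq_neg_iff_add_eq_0)
    moreover have "V.lincomb a A \<in> V.span A" "V.lincomb (\<lambda>v. - a v) B \<in> V.span B"
      using A B aA aB' by (auto simp: V.finite_span)
    ultimately have lA: "V.lincomb a A = (\<lambda>p. 0)" using disj by auto
    have "(\<Sum>v\<in>A. a v * v p) = 0" for p
      using fun_cong[OF lA, of p] unfolding lincomb_lk_space[OF A(2) aA] .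
    then have lB: "V.lincomb a B = (\<lambda>p. 0)"
      using 0 unfolding lincomb_lk_space[OF B(2) aB] by simp
    have "a \<in> A \<rightarrow> {\<zero>\<^bsub>base_field l r\<^esub>}"
      by (rule V.not_lindepD[OF A(3,1) subset_refl aA]) (simp add: lA)
    moreover have "a \<in> B \<rightarrow> {\<zero>\<^bsub>base_field l r\<^esub>}"
      by (rule V.not_lindepD[OF B(3,1) subset_refl aB]) (simp add: lB)
    ultimately show "\<forall>v\<in>A \<union> B. a v = \<zero>\<^bsub>base_field l r\<^esub>" by auto
  qed (use A B in auto)
  moreover have "A \<union> B \<subseteq> carrier (lk_space l r n)" using A B by blast
  ultimately have "card (A \<union> B) \<le> V.dim"
    by (intro V.li_le_dim(2)[OF lk_space_fin_dim])
  then show ?thesis using A(1) B(1) AB by (simp add: lk_space_dim card_Un_disjoint)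
qed

lemma lk_dim_add_le:
  assumes U: "VectorSpace.subspace (base_field l r) U (lk_space l r n)"
    and W: "VectorSpace.subspace (base_field l r) W (lk_space l r n)"
    and disj: "U \<inter> W \<subseteq> {\<lambda>p. 0}"
  shows "lk_dim l r n U + lk_dim l r n W \<le> card (lk_index n)"
proof -
  obtain A where A: "finite A" "A \<subseteq> U" "LinearCombinations.module.lin_indpt (base_field l r) (lk_space l r n) A"
    "card A = lk_dim l r n U" "LinearCombinations.module.span (base_field l r) (lk_space l r n) A = U"
    by (rule lk_subspace_basis[OF U])
  obtain B where B: "finite B" "B \<subseteq> W" "LinearCombinations.module.lin_indpt (base_field l r) (lk_space l r n) B"
    "card B = lk_dim l r n W" "LinearCombinations.module.span (base_field l r) (lk_space l r n) B = W"
    by (rule lk_subspace_basis[OF W])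
  have "A \<subseteq> carrier (lk_space l r n)" "B \<subseteq> carrier (lk_space l r n)"
    using A(2) B(2) U W by (auto simp: subspace_lk_space_iff)
  then have "card A + card B \<le> card (lk_index n)"
    by (rule lin_indpt_card_add_le[OF A(1) _ A(3) B(1) _ B(3), unfolded A(5) B(5), OF _ _ disj])
  then show ?thesis by (simp add: A(4) B(4))
qed

section \<open>The coordinate pairing, and codimension counted by functionals\<close>

definition lk_pair :: "nat \<Rightarrow> lk_vec \<Rightarrow> lk_vec \<Rightarrow> complex" where
  "lk_pair n f v = (\<Sum>q\<in>lk_index n. f q * v q)"

lemma lk_pair_add: "lk_pair n f (\<lambda>p. u p + v p) = lk_pair n f u + lk_pair n f v"
  and lk_pair_diff: "lk_pair n f (\<lambda>p. u p - v p) = lk_pair n f u - lk_pair n f v"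
  and lk_pair_scale: "lk_pair n f (\<lambda>p. c * v p) = c * lk_pair n f v"
  and lk_pair_divide: "lk_pair n f (\<lambda>p. v p / c) = lk_pair n f v / c"
  and lk_pair_zero: "lk_pair n f (\<lambda>p. 0) = 0"
  by (simp_all add: lk_pair_def algebra_simps sum.distrib sum_subtractf sum_distrib_left sum_divide_distrib)

lemma lk_pair_sum: "lk_pair n f (\<lambda>p. \<Sum>a\<in>A. g a p) = (\<Sum>a\<in>A. lk_pair n f (g a))"
  unfolding lk_pair_def by (simp add: sum_distrib_left) (rule sum.swap)

lemma lk_pair_add_left: "lk_pair n (\<lambda>p. f p + g p) v = lk_pair n f v + lk_pair n g v"
  and lk_pair_scale_left: "lk_pair n (\<lambda>p. c * f p) v = c * lk_pair n f v"
  by (simp_all add: lk_pair_def algebra_simps sum.distrib sum_distrib_left)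

lemma lk_pair_cong:
  "(\<And>q. q \<in> lk_index n \<Longrightarrow> f q = g q) \<Longrightarrow> lk_pair n f v = lk_pair n g v"
  by (simp add: lk_pair_def)

lemma lk_pair_w: "(i, j) \<in> lk_index n \<Longrightarrow> lk_pair n f (lk_w i j) = f (i, j)"
proof -
  assume *: "(i, j) \<in> lk_index n"
  have "lk_pair n f (lk_w i j) = (\<Sum>q\<in>lk_index n. if q = (i, j) then f (i, j) else 0)"
    unfolding lk_pair_def by (intro sum.cong) (auto simp: lk_w_def)
  with * show ?thesis by simp
qed

lemma lk_pair_w_left: "(i, j) \<in> lk_index n \<Longrightarrow> lk_pair n (lk_w i j) v = v (i, j)"
  using lk_pair_w[of i j n v] by (simp add: lk_pair_def mult.commute)

lemma lk_pair_closed: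
  "(\<And>p. f p \<in> carrier (base_field l r)) \<Longrightarrow> (\<And>p. v p \<in> carrier (base_field l r)) \<Longrightarrow>
    lk_pair n f v \<in> carrier (base_field l r)"
  unfolding lk_pair_def by (intro base_field_sum base_field_closed)

text \<open>Induction in the manner of Gram-Schmidt yields vectors dual to independent functionals.
  The coefficients \<open>a\<close> range over all complex numbers, whereas the dual vectors have
  coordinates in F.\<close>

lemma dual_family:
  assumes "finite S"
    and "\<And>s p. s \<in> S \<Longrightarrow> f s p \<in> carrier (base_field l r)"
    and "\<And>a. \<forall>p\<in>lk_index n. (\<Sum>s\<in>S. a s * f s p) = 0 \<Longrightarrow> \<forall>s\<in>S. a s = 0"
  shows "\<exists>v. (\<forall>s\<in>S. v s \<in> carrier (lk_space l r n)) \<and>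
     (\<forall>s\<in>S. \<forall>t\<in>S. lk_pair n (f s) (v t) = (if s = t then 1 else 0))"
  using assms
proof (induction S)
  case empty
  then show ?case by simp
next
  case (insert s S)
  have "\<forall>t\<in>S. a t = 0" if a: "\<forall>p\<in>lk_index n. (\<Sum>s\<in>S. a s * f s p) = 0" for a
  proof -
    have "(\<Sum>t\<in>insert s S. (a(s := 0)) t * f t p) = (\<Sum>t\<in>S. a t * f t p)" for p
      using insert.hyps by (auto intro!: sum.cong)
    then have "\<forall>t\<in>insert s S. (a(s := 0)) t = 0"
      using a by (intro insert.prems(2)) simp
    then show ?thesis using insert.hyps(2) by (metis fun_upd_other insertI2)
  qed
  then obtain v where v: "\<And>t. t \<in> S \<Longrightarrow> v t \<in> carrier (lk_space l r n)"
    "\<And>t u. t \<in> S \<Longrightarrow> u \<in> S \<Longrightarrow> lk_pair n (f t) (v u) = (if t = u then 1 else 0)"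
    using insert.IH insert.prems(1) by blast
  \<comment> \<open>This is \<open>f s\<close> with its components along the old functionals
    removed. It vanishes on every old dual vector and, by independence, is nonzero at some index
    pair.\<close>
  define g where "g p = f s p - (\<Sum>t\<in>S. lk_pair n (f s) (v t) * f t p)" for p
  have "\<exists>p\<in>lk_index n. g p \<noteq> 0"
  proof (rule ccontr)
    assume *: "\<not> ?thesis"
    define a where "a = (\<lambda>t. if t = s then 1 else - lk_pair n (f s) (v t))"
    have "(\<Sum>t\<in>insert s S. a t * f t p) = g p" for p
    proof -
      have "(\<Sum>t\<in>S. a t * f t p) = (\<Sum>t\<in>S. - lk_pair n (f s) (v t) * f t p)"
        using insert.hyps by (intro sum.cong) (auto simp: a_def)
      then show ?thesis using insert.hyps by (simp add: a_def g_def sum_negf)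
    qed
    with * have "\<forall>t\<in>insert s S. a t = 0" by (intro insert.prems(2)) simp
    then show False by (simp add: a_def)
  qed
  then obtain i j where ij: "(i, j) \<in> lk_index n" "g (i, j) \<noteq> 0" by auto
  have F: "f t p \<in> carrier (base_field l r)" if "t \<in> insert s S" for t p using insert.prems(1)[OF that] .
  have vF: "v t p \<in> carrier (base_field l r)" "v t \<in> lk_supp n" if "t \<in> S" for t p
    using v(1)[OF that] by (simp_all add: carrier_lk_space)
  have pF: "lk_pair n (f s) (v t) \<in> carrier (base_field l r)" if "t \<in> S" for t
    using F vF that by (intro lk_pair_closed) auto
  have gF: "g (i, j) \<in> carrier (base_field l r)"
    unfolding g_def using F pF by (intro base_field_closed' base_field_sum base_field_closed) auto
  \<comment> \<open>The basis vector at that pair is corrected so that all old functionals vanish on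
    it, then scaled so that \<open>f s\<close> takes the value 1.\<close>
  define x where "x = (\<lambda>p. (lk_w i j p - (\<Sum>t\<in>S. f t (i, j) * v t p)) / g (i, j))"
  have px: "lk_pair n h x = (h (i, j) - (\<Sum>t\<in>S. f t (i, j) * lk_pair n h (v t))) / g (i, j)" for h
    unfolding x_def lk_pair_divide lk_pair_diff lk_pair_sum lk_pair_scale lk_pair_w[OF ij(1)] by simp
  have x1: "lk_pair n (f s) x = 1"
    unfolding px using ij(2) by (simp add: g_def mult.commute)
  have x0: "lk_pair n (f t) x = 0" if "t \<in> S" for t
  proof -
    have "(\<Sum>u\<in>S. f u (i, j) * lk_pair n (f t) (v u)) = (\<Sum>u\<in>S. if u = t then f t (i, j) else 0)"
      using v(2)[OF that] by (intro sum.cong) auto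
    then show ?thesis using that insert.hyps by (simp add: px)
  qed
  have xF: "x \<in> carrier (lk_space l r n)"
  proof -
    have wF: "lk_w i j p \<in> carrier (base_field l r)" for p by (simp add: lk_w_def)
    have "x p \<in> carrier (base_field l r)" for p
      unfolding x_def using F vF gF wF by (intro base_field_closed' base_field_sum base_field_closed) auto
    moreover have "x \<in> lk_supp n"
      unfolding lk_supp_def x_def using vF lk_supp_w[OF ij(1)] by (auto simp: lk_supp_def)
    ultimately show ?thesis by (simp add: carrier_lk_space)
  qed
  \<comment> \<open>Multiples of \<open>x\<close> are subtracted from the old dual vectors to make
    \<open>f s\<close> vanish on them. The old functionals kill \<open>x\<close>, so their values do
    not change.\<close>
  define w where "w = (\<lambda>t. if t = s then x else (\<lambda>p. v t p - lk_pair n (f s) (v t) * x p))"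
  have pw: "lk_pair n h (w t) = (if t = s then lk_pair n h x
      else lk_pair n h (v t) - lk_pair n (f s) (v t) * lk_pair n h x)" for h t
    by (simp add: w_def lk_pair_diff lk_pair_scale)
  have "w t \<in> carrier (lk_space l r n)" if "t \<in> insert s S" for t
  proof (cases "t = s")
    case False
    then have t: "t \<in> S" using that by simp
    have "v t p - lk_pair n (f s) (v t) * x p \<in> carrier (base_field l r)" for p
      using xF vF(1)[OF t] pF[OF t] by (intro base_field_closed' base_field_closed) (auto simp: carrier_lk_space)
    with False show ?thesis
      using xF vF(2)[OF t] by (auto simp: w_def carrier_lk_space intro!: lk_supp_ops)
  qed (simp add: w_def xF)
  moreover have "lk_pair n (f t) (w u) = (if t = u then 1 else 0)"
    if "t \<in> insert s S" "u \<in> insert s S" for t u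
    using that insert.hyps v(2) x0 x1 by (auto simp: pw)
  ultimately show ?case by (intro exI[of _ w] conjI ballI)
qed

lemma lk_dim_codim_le:
  assumes W: "VectorSpace.subspace (base_field l r) W (lk_space l r n)"
    and S: "finite S" "\<And>s p. s \<in> S \<Longrightarrow> f s p \<in> carrier (base_field l r)"
    and ind: "\<And>a. \<forall>p\<in>lk_index n. (\<Sum>s\<in>S. a s * f s p) = 0 \<Longrightarrow> \<forall>s\<in>S. a s = 0"
    and van: "\<And>s v. s \<in> S \<Longrightarrow> v \<in> W \<Longrightarrow> lk_pair n (f s) v = 0"
  shows "lk_dim l r n W + card S \<le> card (lk_index n)"
proof -
  interpret V: vectorspace "base_field l r" "lk_space l r n" by (rule vectorspace_lk_space)
  have "\<exists>v. (\<forall>s\<in>S. v s \<in> carrier (lk_space l r n)) \<and>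
     (\<forall>s\<in>S. \<forall>t\<in>S. lk_pair n (f s) (v t) = (if s = t then 1 else 0))"
    by (rule dual_family[OF S ind])
  then obtain v where v0: "\<forall>s\<in>S. v s \<in> carrier (lk_space l r n)"
     "\<forall>s\<in>S. \<forall>t\<in>S. lk_pair n (f s) (v t) = (if s = t then 1 else 0)"
    by (elim exE conjE)
  then have v: "t \<in> S \<Longrightarrow> v t \<in> carrier (lk_space l r n)"
    "t \<in> S \<Longrightarrow> u \<in> S \<Longrightarrow> lk_pair n (f t) (v u) = (if t = u then 1 else 0)" for t u
    by simp_all
  have inj: "inj_on v S"
    by (rule inj_onI) (metis v(2) zero_neq_one)
  have B: "finite (v ` S)" "v ` S \<subseteq> carrier (lk_space l r n)" using S(1) v(1) by auto
  have pair: "lk_pair n (f s) (V.lincomb a (v ` S)) = a (v s)"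
    if a: "a \<in> v ` S \<rightarrow> carrier (base_field l r)" and s: "s \<in> S" for a s
  proof -
    have "lk_pair n (f s) (V.lincomb a (v ` S)) = (\<Sum>u\<in>S. a (v u) * lk_pair n (f s) (v u))"
      unfolding lincomb_lk_space[OF B(2) a] by (simp add: lk_pair_sum lk_pair_scale sum.reindex[OF inj])
    also have "\<dots> = (\<Sum>u\<in>S. if u = s then a (v s) else 0)"
      using v(2)[OF s] by (intro sum.cong) auto
    finally show ?thesis using s S(1) by simp
  qed
  have ind: "V.lin_indpt (v ` S)"
  proof (rule V.finite_lin_indpt2[OF B])
    fix a assume a: "a \<in> v ` S \<rightarrow> carrier (base_field l r)"
      "V.lincomb a (v ` S) = \<zero>\<^bsub>lk_space l r n\<^esub>"
    have "a (v s) = 0" if "s \<in> S" for s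
      using pair[OF a(1) that] by (simp add: a(2) lk_pair_zero)
    then show "\<forall>v\<in>v ` S. a v = \<zero>\<^bsub>base_field l r\<^esub>" by simp
  qed
  obtain A where A: "finite A" "A \<subseteq> W" "V.lin_indpt A" "card A = lk_dim l r n W" "V.span A = W"
    by (rule lk_subspace_basis[OF W])
  have "W \<inter> V.span (v ` S) \<subseteq> {\<lambda>p. 0}"
  proof
    fix x assume x: "x \<in> W \<inter> V.span (v ` S)"
    then obtain a where a: "a \<in> v ` S \<rightarrow> carrier (base_field l r)" "x = V.lincomb a (v ` S)"
      using B by (auto simp: V.finite_span)
    have "a u = 0" if "u \<in> v ` S" for u
      using pair[OF a(1)] van x that by (auto simp: a(2))
    then have "x = (\<lambda>p. 0)" unfolding a(2) lincomb_lk_space[OF B(2) a(1)] by simp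
    then show "x \<in> {\<lambda>p. 0}" by simp
  qed
  moreover have "A \<subseteq> carrier (lk_space l r n)" using A(2) W by (auto simp: subspace_lk_space_iff)
  ultimately have "card A + card (v ` S) \<le> card (lk_index n)"
    using lin_indpt_card_add_le[OF A(1) _ A(3) B ind, unfolded A(5)] by blast
  then show ?thesis using A(4) inj by (simp add: card_image)
qed

lemma lk_dim_eq:
  assumes W: "VectorSpace.subspace (base_field l r) W (lk_space l r n)"
    and lin: "\<And>u v. u \<in> W \<Longrightarrow> v \<in> W \<Longrightarrow> T (\<lambda>p. u p + v p) = (\<lambda>p. T u p + T v p)"
      "\<And>c v. c \<in> carrier (base_field l r) \<Longrightarrow> v \<in> W \<Longrightarrow> T (\<lambda>p. c * v p) = (\<lambda>p. c * T v p)"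
    and bij: "bij_betw T W (carrier (lk_space l r m))"
  shows "lk_dim l r n W = card (lk_index m)"
proof -
  interpret V: vectorspace "base_field l r" "lk_space l r n" by (rule vectorspace_lk_space)
  interpret W: vectorspace "base_field l r" "lk_space l r n\<lparr>carrier := W\<rparr>"
    using W by (rule V.subspace_is_vs)
  interpret M: vectorspace "base_field l r" "lk_space l r m" by (rule vectorspace_lk_space)
  have hom: "T \<in> LinearCombinations.module_hom (base_field l r) (lk_space l r n\<lparr>carrier := W\<rparr>) (lk_space l r m)"
    using lin bij by (auto simp: LinearCombinations.module_hom_def bij_betw_def)
  interpret T: linear_map "base_field l r" "lk_space l r n\<lparr>carrier := W\<rparr>" "lk_space l r m" T
    by unfold_locales (rule hom)
  obtain A where A: "finite A" "A \<subseteq> W" "V.lin_indpt A" "card A = lk_dim l r n W" "V.span A = W"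
    by (rule lk_subspace_basis[OF W])
  have "W.span A = W"
    using A(5) V.span_li_not_depend(1)[OF A(2), of] W by simp
  then have "W.fin_dim" using A(1,2) by (auto simp: W.fin_dim_def)
  from T.dim_eq[OF this] have "W.dim = M.dim"
    using bij by (simp add: bij_betw_def)
  then show ?thesis by (simp add: lk_dim_def lk_space_dim)
qed

section \<open>Functionals and the transposed action\<close>

text \<open>The entry at \<open>(i, j)\<close> is the value of \<open>f\<close> on the image of
  \<open>w_ij\<close> under \<open>g_k\<close>, so this is the transpose of \<open>g_k\<close>; see
  \<open>lk_pair_nu\<close>.\<close>

definition lk_nuT :: "complex \<Rightarrow> complex \<Rightarrow> nat \<Rightarrow> lk_vec \<Rightarrow> lk_vec" where
  "lk_nuT l r k f = (\<lambda>(i, j). let m = bmw_m r in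
     if {i, j} \<inter> {k, k + 1} = {} then r * f (i, j)
     else if i = k \<and> j = k + 1 then f (k, k + 1) / l
     else if i = k then f (k + 1, j)
     else if i = k + 1 then f (k, j) + m * r ^ (j - k - 2) * f (k, k + 1) - m * f (k + 1, j)
     else if j = k then f (i, k + 1)
     else f (i, k) + m / (l * r ^ (k - 1 - i)) * f (k, k + 1) - m * f (i, k + 1))"

lemma lk_nuT_rules:
  shows
    "i \<noteq> k \<Longrightarrow> i \<noteq> Suc k \<Longrightarrow> j \<noteq> k \<Longrightarrow> j \<noteq> Suc k \<Longrightarrow> lk_nuT l r k f (i, j) = r * f (i, j)"
    "lk_nuT l r k f (k, Suc k) = f (k, Suc k) / l"
    "Suc k < j \<Longrightarrow> lk_nuT l r k f (k, j) = f (Suc k, j)"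
    "Suc k < j \<Longrightarrow> lk_nuT l r k f (Suc k, j) =
       f (k, j) + bmw_m r * r ^ (j - k - 2) * f (k, Suc k) - bmw_m r * f (Suc k, j)"
    "i < k \<Longrightarrow> lk_nuT l r k f (i, k) = f (i, Suc k)"
    "i < k \<Longrightarrow> lk_nuT l r k f (i, Suc k) =
       f (i, k) + bmw_m r / (l * r ^ (k - 1 - i)) * f (k, Suc k) - bmw_m r * f (i, Suc k)"
  by (auto simp: lk_nuT_def Let_def)

lemma lk_pair_nu:
  assumes k: "k \<in> {1..<n}"
  shows "lk_pair n f (lk_nu l r n k v) = lk_pair n (lk_nuT l r k f) v"
proof -
  have *: "lk_pair n f (lk_nu_w l r k i j) = lk_nuT l r k f (i, j)" if ij: "(i, j) \<in> lk_index n" for i j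
  proof -
    have ij': "1 \<le> i" "i < j" "j \<le> n" using ij by (auto simp: lk_index_def)
    consider "{i, j} \<inter> {k, Suc k} = {}" | "i = k" "j = Suc k" | "i = k" "Suc k < j"
      | "i = Suc k" "Suc k < j" | "j = k" "i < k" | "j = Suc k" "i < k"
      using ij' by force
    then show ?thesis
    proof cases
      case 1
      then show ?thesis using ij
        by (simp add: lk_nu_w_def lk_nuT_def lk_pair_scale lk_pair_w)
    qed (insert ij' k, simp_all add: lk_nu_w_def lk_nuT_def Let_def lk_pair_add lk_pair_diff
          lk_pair_scale lk_pair_divide lk_pair_w lk_index_def)
  qed
  have "lk_pair n f (lk_nu l r n k v) =
      (\<Sum>p\<in>lk_index n. \<Sum>q\<in>lk_index n. v q * (f p * lk_nu_w l r k (fst q) (snd q) p))"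
    by (simp add: lk_pair_def lk_nu_def sum_distrib_left case_prod_unfold mult.left_commute)
  also have "\<dots> = (\<Sum>q\<in>lk_index n. v q * lk_pair n f (lk_nu_w l r k (fst q) (snd q)))"
    by (subst sum.swap) (simp add: lk_pair_def sum_distrib_left)
  also have "\<dots> = (\<Sum>q\<in>lk_index n. v q * lk_nuT l r k f q)"
    using * by (intro sum.cong) auto
  finally show ?thesis by (simp add: lk_pair_def mult.commute)
qed

lemma lk_nuT_w:
  assumes "i < j" "a < b"
  shows "i \<noteq> k \<Longrightarrow> i \<noteq> Suc k \<Longrightarrow> j \<noteq> k \<Longrightarrow> j \<noteq> Suc k \<Longrightarrow>
      lk_nuT l r k (lk_w i j) (a, b) = r * lk_w i j (a, b)"
    "Suc k < j \<Longrightarrow> lk_nuT l r k (lk_w k j) (a, b) = lk_w (Suc k) j (a, b)"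
    "Suc k < j \<Longrightarrow> lk_nuT l r k (lk_w (Suc k) j) (a, b) = lk_w k j (a, b) - bmw_m r * lk_w (Suc k) j (a, b)"
    "i < k \<Longrightarrow> lk_nuT l r k (lk_w i k) (a, b) = lk_w i (Suc k) (a, b)"
    "i < k \<Longrightarrow> lk_nuT l r k (lk_w i (Suc k)) (a, b) = lk_w i k (a, b) - bmw_m r * lk_w i (Suc k) (a, b)"
  using assms by (auto simp: lk_nuT_def lk_w_def Let_def)

text \<open>The coordinate at \<open>(k, k + 1)\<close> is left out: it collects contributions from
  every pair containing \<open>k + 1\<close>, while all others depend on at most two coordinates of
  \<open>v\<close>.\<close>

lemma lk_nu_coord:
  assumes k: "k \<in> {1..<n}"
  shows "1 \<le> i \<Longrightarrow> i < j \<Longrightarrow> j \<le> n \<Longrightarrow> i \<noteq> k \<Longrightarrow> i \<noteq> Suc k \<Longrightarrow> j \<noteq> k \<Longrightarrow> j \<noteq> Suc k \<Longrightarrow>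
      lk_nu l r n k v (i, j) = r * v (i, j)"
    "Suc k < j \<Longrightarrow> j \<le> n \<Longrightarrow> lk_nu l r n k v (k, j) = v (Suc k, j)"
    "Suc k < j \<Longrightarrow> j \<le> n \<Longrightarrow> lk_nu l r n k v (Suc k, j) = v (k, j) - bmw_m r * v (Suc k, j)"
    "1 \<le> i \<Longrightarrow> i < k \<Longrightarrow> lk_nu l r n k v (i, k) = v (i, Suc k)"
    "1 \<le> i \<Longrightarrow> i < k \<Longrightarrow> lk_nu l r n k v (i, Suc k) = v (i, k) - bmw_m r * v (i, Suc k)"
proof -
  have c: "lk_nu l r n k v (i, j) = lk_pair n g v"
    if "(i, j) \<in> lk_index n" "\<And>a b. a < b \<Longrightarrow> lk_nuT l r k (lk_w i j) (a, b) = g (a, b)" for i j g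
  proof -
    have "lk_nu l r n k v (i, j) = lk_pair n (lk_nuT l r k (lk_w i j)) v"
      using that(1) by (simp flip: lk_pair_nu[OF k] add: lk_pair_w_left)
    also have "\<dots> = lk_pair n g v"
      using that(2) by (intro lk_pair_cong) (auto simp: lk_index_def)
    finally show ?thesis .
  qed
  have d: "lk_pair n (\<lambda>q. lk_w a b q - c * lk_w i j q) v = v (a, b) - c * v (i, j)"
    if "(a, b) \<in> lk_index n" "(i, j) \<in> lk_index n" for a b c i j
    using lk_pair_add_left[of n "lk_w a b" "\<lambda>q. - c * lk_w i j q" v] lk_pair_scale_left[of n "- c" "lk_w i j" v]
    by (simp add: lk_pair_w_left that)
  show "1 \<le> i \<Longrightarrow> i < j \<Longrightarrow> j \<le> n \<Longrightarrow> i \<noteq> k \<Longrightarrow> i \<noteq> Suc k \<Longrightarrow> j \<noteq> k \<Longrightarrow> j \<noteq> Suc k \<Longrightarrow>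
      lk_nu l r n k v (i, j) = r * v (i, j)"
    using c[of i j "\<lambda>q. r * lk_w i j q"] by (simp add: lk_nuT_w lk_pair_scale_left lk_pair_w_left lk_index_def)
  show "Suc k < j \<Longrightarrow> j \<le> n \<Longrightarrow> lk_nu l r n k v (k, j) = v (Suc k, j)"
    using k c[of k j "lk_w (Suc k) j"] by (simp add: lk_nuT_w lk_pair_w_left lk_index_def)
  show "Suc k < j \<Longrightarrow> j \<le> n \<Longrightarrow> lk_nu l r n k v (Suc k, j) = v (k, j) - bmw_m r * v (Suc k, j)"
    using k c[of "Suc k" j "\<lambda>q. lk_w k j q - bmw_m r * lk_w (Suc k) j q"]
    by (simp add: lk_nuT_w d lk_index_def)
  show "1 \<le> i \<Longrightarrow> i < k \<Longrightarrow> lk_nu l r n k v (i, k) = v (i, Suc k)"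
    using k c[of i k "lk_w i (Suc k)"] by (simp add: lk_nuT_w lk_pair_w_left lk_index_def)
  show "1 \<le> i \<Longrightarrow> i < k \<Longrightarrow> lk_nu l r n k v (i, Suc k) = v (i, k) - bmw_m r * v (i, Suc k)"
    using k c[of i "Suc k" "\<lambda>q. lk_w i k q - bmw_m r * lk_w i (Suc k) q"]
    by (simp add: lk_nuT_w d lk_index_def)
qed

text \<open>
  The factor \<open>r / l\<close> is what makes \<open>c\<^sub>k\<close> a combination of two neighbouring functionals, see \<open>lk_c_phi\<close>.
\<close>

definition lk_phi :: "complex \<Rightarrow> complex \<Rightarrow> nat \<Rightarrow> lk_vec" where
  "lk_phi l r i = (\<lambda>(a, b). if a = i then r ^ (b - i - 1)
     else if b = i then r / l / r ^ (i - a - 1) else 0)"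

lemma lk_phi_closed: "lk_phi l r i p \<in> carrier (base_field l r)"
  by (cases p) (auto simp: lk_phi_def)

lemma lk_c_closed: "lk_c l r i p \<in> carrier (base_field l r)"
  by (cases p) (auto simp: lk_c_def intro!: base_field_closed base_field_closed')

lemma lk_nuT_closed:
  assumes "\<And>p. f p \<in> carrier (base_field l r)"
  shows "lk_nuT l r k f p \<in> carrier (base_field l r)"
  using assms by (cases p)
    (auto simp: lk_nuT_def Let_def intro!: base_field_closed base_field_closed')

text \<open>Only the last rule uses the special parameter. It makes the span of the functionals
  stable under the transposed generators, hence their common kernel invariant. The first two rules
  also serve the case \<open>l = r\<close>.\<close>

lemma lk_nuT_phi:
  assumes lr: "l \<noteq> 0" "r \<noteq> 0" and ab: "a < b"
  shows "i \<noteq> k \<Longrightarrow> i \<noteq> Suc k \<Longrightarrow> lk_nuT l r k (lk_phi l r i) (a, b) = r * lk_phi l r i (a, b)"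
    and "lk_nuT l r k (lk_phi l r k) (a, b) = lk_phi l r (Suc k) (a, b) / r"
    and "l = - (r ^ 3) \<Longrightarrow> lk_nuT l r k (lk_phi l r (Suc k)) (a, b) =
      lk_phi l r k (a, b) / r + (r - 1 / r ^ 3) * lk_phi l r (Suc k) (a, b)"
proof -
  \<comment> \<open>Writing the gaps as \<open>d\<close> turns the truncated subtractions in the
    exponents into plain sums.\<close>
  consider "{a, b} \<inter> {k, Suc k} = {}" | "a = k" "b = Suc k" | d where "a = k" "b = Suc (Suc (k + d))"
    | d where "a = Suc k" "b = Suc (Suc (k + d))" | d where "b = k" "k = Suc (a + d)"
    | d where "b = Suc k" "k = Suc (a + d)"
    using ab less_imp_Suc_add[of "Suc k" b] less_imp_Suc_add[of a k] by force
  note cases = this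
  have q: "r ^ (n - j) = r * r ^ (n - Suc j)" if "j < n" for n j
    using that by (simp flip: power_Suc add: Suc_diff_Suc)
  show "lk_nuT l r k (lk_phi l r i) (a, b) = r * lk_phi l r i (a, b)" if i: "i \<noteq> k" "i \<noteq> Suc k"
    using cases
  proof cases
    case 1
    then show ?thesis by (simp add: lk_nuT_rules)
  next
    case 2
    with i show ?thesis by (simp add: lk_nuT_rules lk_phi_def)
  next
    case 3
    with i lr q[of "Suc k" i] show ?thesis by (auto simp: lk_nuT_rules lk_phi_def)
  next
    case 4
    with i lr show ?thesis by (auto simp: lk_nuT_rules lk_phi_def bmw_m_def field_simps)
  next
    case 5
    with i lr show ?thesis by (auto simp: lk_nuT_rules lk_phi_def)
  next
    case 6
    with i lr show ?thesis by (auto simp: lk_nuT_rules lk_phi_def bmw_m_def field_simps)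
  qed
  show "lk_nuT l r k (lk_phi l r k) (a, b) = lk_phi l r (Suc k) (a, b) / r"
    using cases by cases (insert lr, auto simp: lk_nuT_rules lk_phi_def bmw_m_def field_simps)
  show "lk_nuT l r k (lk_phi l r (Suc k)) (a, b) =
      lk_phi l r k (a, b) / r + (r - 1 / r ^ 3) * lk_phi l r (Suc k) (a, b)" if "l = - (r ^ 3)"
    using cases by cases (insert lr that, auto simp: lk_nuT_rules lk_phi_def bmw_m_def field_simps eval_nat_numeral)
qed

text \<open>Away from \<open>(k, k + 1)\<close> this only compares exponents. At
  \<open>(k, k + 1)\<close> it reads \<open>l / m * (1 / l ^ 2 + m / l - 1) = r / l + l / r\<close>,
  which for nonzero \<open>l\<close>, \<open>r\<close>, \<open>m\<close> is equivalent to
  \<open>(l - r) * (l + r ^ 3) = 0\<close>.\<close>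

lemma lk_c_phi:
  assumes lr: "l \<noteq> 0" "r \<noteq> 0" "bmw_m r \<noteq> 0" and ab: "a < b"
    and "(a, b) \<noteq> (k, Suc k) \<or> (l - r) * (l + r ^ 3) = 0"
  shows "lk_c l r k (a, b) = lk_phi l r (Suc k) (a, b) + l / r * lk_phi l r k (a, b)"
proof -
  consider "{a, b} \<inter> {k, Suc k} = {}" | "a = k" "b = Suc k" | d where "a = k" "b = Suc (Suc (k + d))"
    | d where "a = Suc k" "b = Suc (Suc (k + d))" | d where "b = k" "k = Suc (a + d)"
    | d where "b = Suc k" "k = Suc (a + d)"
    using ab less_imp_Suc_add[of "Suc k" b] less_imp_Suc_add[of a k] by force
  then show ?thesis
  proof cases
    case 2
    with assms have "l = r \<or> l = - (r * (r * r))"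
      by (auto simp: eq_neg_iff_add_eq_0 eval_nat_numeral)
    then have "(r + (1 - r * r) * l - l * (r * l)) * r = (r * r + l * l) * (1 - r * r)"
      by (elim disjE) (simp_all add: algebra_simps)
    moreover have "r * r \<noteq> 1" using lr by (simp add: bmw_m_def field_simps)
    ultimately have "l / bmw_m r * (1 / l ^ 2 + bmw_m r / l - 1) = r / l + l / r"
      using lr by (simp add: bmw_m_def divide_simps eval_nat_numeral)
    with 2 show ?thesis by (simp add: lk_c_def lk_phi_def)
  qed (insert lr, auto simp: lk_c_def lk_phi_def)
qed

section \<open>The dimension forces the parameter\<close>

lemma lk_e_pair:
  assumes lr: "l \<noteq> 0" "r \<noteq> 0" "bmw_m r \<noteq> 0" and k: "k \<in> {1..<n}" and v: "v \<in> lk_supp n"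
  shows "lk_e l r n k v = (\<lambda>p. lk_pair n (lk_c l r k) v * lk_w k (Suc k) p)"
proof (rule lk_lin_eqI[OF lk_lin_e[OF k] _ v])
  have "lk_w k (Suc k) \<in> lk_supp n" using k by (intro lk_supp_w) (auto simp: lk_index_def)
  then show "lk_lin n (\<lambda>v p. lk_pair n (lk_c l r k) v * lk_w k (Suc k) p)"
    by (auto simp: lk_lin_def lk_pair_add lk_pair_scale algebra_simps lk_supp_def)
qed (simp add: lk_e_basis[OF lr k] lk_pair_w)

text \<open>Neighbouring diagonal vectors are linked through \<open>w_i,i+2\<close>:
  \<open>g_(i+1)\<close> sends \<open>w_i,i+1\<close> to it and \<open>g_i\<close> sends it to
  \<open>w_i+1,i+2\<close>. Using inverses to go down to \<open>w_12\<close> and generators to go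
  up, all diagonal vectors are reached; then \<open>g_j\<close> lengthens \<open>w_ij\<close> to
  \<open>w_i,j+1\<close>.\<close>

lemma lk_stable_full:
  assumes lr: "l \<noteq> 0" "r \<noteq> 0" "bmw_m r \<noteq> 0" and W: "lk_stable l r n W"
    and k: "k \<in> {1..<n}" "lk_w k (Suc k) \<in> W"
  shows "W = carrier (lk_space l r n)"
proof -
  have row: "lk_w i j \<in> W" if "lk_w i (Suc i) \<in> W" "1 \<le> i" "Suc i \<le> j" "j \<le> n" for i j
    using that(3,4)
  proof (induction j rule: dec_induct)
    case (step j)
    have "lk_nu l r n j (lk_w i j) = lk_w i (Suc j)"
      using step that by (intro lk_nu_rules) auto
    then show ?case using lk_stableD(7)[OF W, of j "lk_w i j"] step that by simp
  qed (use that in simp)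
  have pull: "u \<in> W" if "lk_nu l r n j u \<in> W" "j \<in> {1..<n}" "u \<in> lk_supp n" for j u
    using lk_stable_nu_inv[OF W that(2,1)] by (simp add: lk_nu_inv[OF lr that(2,3)])
  have up: "lk_w (Suc i) (Suc (Suc i)) \<in> W" if "lk_w i (Suc i) \<in> W" "1 \<le> i" "Suc i < n" for i
  proof -
    have "lk_nu l r n i (lk_w i (Suc (Suc i))) = lk_w (Suc i) (Suc (Suc i))"
      using that by (intro lk_nu_rules) auto
    then show ?thesis
      using lk_stableD(7)[OF W, of i] row[OF that(1,2), of "Suc (Suc i)"] that by (metis Suc_leI Suc_lessD
          atLeastLessThan_iff lessI less_imp_le_nat)
  qed
  have down: "lk_w i (Suc i) \<in> W" if "lk_w (Suc i) (Suc (Suc i)) \<in> W" "1 \<le> i" "Suc i < n" for i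
  proof -
    have "lk_nu l r n i (lk_w i (Suc (Suc i))) = lk_w (Suc i) (Suc (Suc i))"
      using that by (intro lk_nu_rules) auto
    then have "lk_w i (Suc (Suc i)) \<in> W"
      using that by - (rule pull[of i, OF _ _ lk_supp_w]; simp add: lk_index_def)
    moreover have "lk_nu l r n (Suc i) (lk_w i (Suc i)) = lk_w i (Suc (Suc i))"
      using that by (intro lk_nu_rules) auto
    ultimately show ?thesis
      using that by - (rule pull[of "Suc i", OF _ _ lk_supp_w]; simp add: lk_index_def)
  qed
  have w1: "lk_w 1 (Suc 1) \<in> W"
    using k
  proof (induction k)
    case (Suc k)
    then show ?case using down[of k] by (cases "k = 0") auto
  qed simp
  have diag: "lk_w i (Suc i) \<in> W" if "1 \<le> i" "i < n" for i
    using that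
  proof (induction i rule: dec_induct)
    case base
    show ?case by (rule w1)
  next
    case (step i)
    then show ?case by (intro up) simp_all
  qed
  have "v \<in> W" if v: "v \<in> carrier (lk_space l r n)" for v
  proof -
    have "v = (\<lambda>p. \<Sum>q\<in>lk_index n. v q * lk_w (fst q) (snd q) p)"
      using v lk_supp_expand by (auto simp: carrier_lk_space)
    also have "\<dots> \<in> W"
    proof (rule lk_stable_sum[OF W])
      fix q assume "q \<in> lk_index n"
      then have "lk_w (fst q) (snd q) \<in> W" by (auto simp: lk_index_def intro!: row diag)
      then show "(\<lambda>p. v q * lk_w (fst q) (snd q) p) \<in> W"
        using v by (intro lk_stableD(5)[OF W]) (auto simp: carrier_lk_space)
    qed
    finally show ?thesis .
  qed
  then show ?thesis using lk_stableD(1)[OF W] by blast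
qed

lemma lk_c_vanishes:
  assumes lr: "l \<noteq> 0" "r \<noteq> 0" "bmw_m r \<noteq> 0" and W: "lk_stable l r n W"
    and proper: "W \<noteq> carrier (lk_space l r n)" and k: "k \<in> {1..<n}" and v: "v \<in> W"
  shows "lk_pair n (lk_c l r k) v = 0"
proof (rule ccontr)
  let ?c = "lk_pair n (lk_c l r k) v"
  assume *: "?c \<noteq> 0"
  \<comment> \<open>Membership in F is what allows division by \<open>?c\<close> inside
    \<open>W\<close>.\<close>
  have "?c \<in> carrier (base_field l r)"
    using lk_stableD(1)[OF W v] by (intro lk_pair_closed lk_c_closed) (simp add: carrier_lk_space)
  then have "(\<lambda>p. inverse ?c * lk_e l r n k v p) \<in> W"
    using k v by (intro lk_stableD(5)[OF W] lk_stable_e[OF W] base_field_inverse)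
  also have "(\<lambda>p. inverse ?c * lk_e l r n k v p) = lk_w k (Suc k)"
    using * by (simp add: lk_e_pair[OF lr k lk_stableD(2)[OF W v]] flip: mult.assoc)
  finally show False using lk_stable_full[OF lr W k] proper by blast
qed

text \<open>
  With \<open>A\<^sub>i = l a\<^sub>i + r a\<^sub>i\<^sub>-\<^sub>1\<close>, the coefficient of a relation at \<open>w\<^sub>i\<^sub>j\<close>, \<open>j \<ge> i + 2\<close>, involves only \<open>A\<^sub>i\<close> and
  \<open>A\<^sub>j\<close>. Comparing the step from \<open>1\<close> to \<open>5\<close> with the steps through \<open>3\<close> is where \<open>n \<ge> 5\<close> enters.
\<close>

lemma lk_c_independent:
  assumes lr: "l \<noteq> 0" "r \<noteq> 0" "l \<noteq> - (r ^ 3)" and n: "n \<ge> 5"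
    and a: "\<forall>p\<in>lk_index n. (\<Sum>k\<in>{1..<n}. a k * lk_c l r k p) = 0"
  shows "\<forall>k\<in>{1..<n}. a k = 0"
proof -
  \<comment> \<open>Extending \<open>a\<close> by zero, in particular to \<open>0\<close> and
    \<open>n\<close>, gives \<open>A\<close> the same formula at both ends.\<close>
  define b where "b k = (if k \<in> {1..<n} then a k else 0)" for k
  define A where "A i = l * b i + r * b (i - 1)" for i
  have A: "A j = - (l * r ^ (2 * d + 1)) * A i" if "1 \<le> i" "j = i + 2 + d" "j \<le> n" for i j d
  proof -
    \<comment> \<open>The gap of at least two keeps \<open>i - 1\<close>, \<open>i\<close>,
      \<open>j - 1\<close>, \<open>j\<close> distinct; these are the only indices contributing at
      \<open>(i, j)\<close>.\<close>
    have c: "lk_c l r k (i, j) = (if k = i then l * r ^ d else 0) + (if k = i - 1 then r ^ (d + 1) else 0)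
        + (if k = j then 1 / r ^ (d + 1) else 0) + (if k = j - 1 then 1 / (l * r ^ d) else 0)"
      if "k \<in> {1..<n}" for k
      using that \<open>1 \<le> i\<close> \<open>j = i + 2 + d\<close> by (auto simp: lk_c_def)
    have "(\<Sum>k\<in>{1..<n}. a k * lk_c l r k (i, j)) =
        (\<Sum>k\<in>{1..<n}. (if k = i then a i * (l * r ^ d) else 0) + (if k = i - 1 then a (i - 1) * r ^ (d + 1) else 0)
        + (if k = j then a j * (1 / r ^ (d + 1)) else 0) + (if k = j - 1 then a (j - 1) * (1 / (l * r ^ d)) else 0))"
      by (intro sum.cong refl) (simp add: c distrib_left)
    also have "\<dots> = b i * (l * r ^ d) + b (i - 1) * r ^ (d + 1) + b j * (1 / r ^ (d + 1)) + b (j - 1) * (1 / (l * r ^ d))"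
      unfolding sum.distrib by (simp add: b_def)
    also have "\<dots> = r ^ d * A i + A j / (l * r ^ (d + 1))"
      using lr by (simp add: A_def field_simps)
    also have "(\<Sum>k\<in>{1..<n}. a k * lk_c l r k (i, j)) = 0"
      using a that by (simp add: lk_index_def)
    finally have "A j / (l * r ^ (d + 1)) = - (r ^ d * A i)" by (simp add: eq_neg_iff_add_eq_0 add.commute)
    then have "A j = - (r ^ d * A i) * (l * r ^ (d + 1))"
      using lr by (simp add: divide_eq_eq)
    also have "\<dots> = - (l * r ^ (2 * d + 1)) * A i"
      by (simp add: power_add mult_2)
    finally show ?thesis .
  qed
  have "A 5 = - (l * r ^ 5) * A 1" using A[of 1 5 2] n by simp
  moreover have "A 3 = - (l * r) * A 1" using A[of 1 3 0] n by simp
  moreover have "A 5 = - (l * r) * A 3" using A[of 3 5 0] n by simp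
  \<comment> \<open>The direct route from 1 to 5 and the route through 3 multiply \<open>A 1\<close>
    by factors whose difference is \<open>l * r ^ 2 * (l + r ^ 3)\<close>.\<close>
  ultimately have "- (l * r ^ 5) * A 1 = - (l * r) * (- (l * r) * A 1)" by simp
  moreover have "l * r\<^sup>2 * (l + r ^ 3) * A 1 = - (l * r) * (- (l * r) * A 1) - - (l * r ^ 5) * A 1"
    by (simp add: algebra_simps eval_nat_numeral)
  ultimately have "l * r\<^sup>2 * (l + r ^ 3) * A 1 = 0" by simp
  then have A1: "A 1 = 0" using lr by (simp add: eq_neg_iff_add_eq_0)
  \<comment> \<open>Index 2 is too close to 1 for the recursion, so 4 is used as a common
    target.\<close>
  have "A 2 = 0" using A[of 2 4 0] A[of 1 4 1] n lr A1 by simp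
  have A0: "A j = 0" if j: "1 \<le> j" "j \<le> n" for j
  proof -
    consider "j = 1" | "j = 2" | "3 \<le> j" using j by linarith
    then show ?thesis using A1 \<open>A 2 = 0\<close> A[of 1 j "j - 3"] j by cases simp_all
  qed
  \<comment> \<open>With all \<open>A j\<close> zero, \<open>l * b j = - r * b (j - 1)\<close>,
    starting from \<open>b 0 = 0\<close>.\<close>
  have "b j = 0" if "j \<le> n" for j
    using that
  proof (induction j)
    case (Suc j)
    then show ?case using A0[of "Suc j"] lr by (simp add: A_def)
  qed (simp add: b_def)
  then show ?thesis by (auto simp: b_def split: if_splits) (metis less_imp_le_nat One_nat_def)
qed

text \<open>The coefficient of a relation at \<open>(i, j)\<close> gives
  \<open>a i * r ^ d + a j / r ^ d = 0\<close> with \<open>d = j - i - 1\<close>. Neighbours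
  therefore have opposite coefficients, and the pair at distance two yields
  \<open>a i * (r ^ 2 + 1) = 0\<close>.\<close>

lemma lk_phi_independent:
  assumes r: "r \<noteq> 0" "r\<^sup>2 \<noteq> - 1" and n: "n \<ge> 3"
    and a: "\<forall>p\<in>lk_index n. (\<Sum>i\<in>{1..n}. a i * lk_phi r r i p) = 0"
  shows "\<forall>i\<in>{1..n}. a i = 0"
proof -
  have E: "a i * r ^ (j - i - 1) + a j / r ^ (j - i - 1) = 0" if "1 \<le> i" "i < j" "j \<le> n" for i j
  proof -
    have "(\<Sum>k\<in>{1..n}. a k * lk_phi r r k (i, j)) =
        (\<Sum>k\<in>{1..n}. (if k = i then a i * r ^ (j - i - 1) else 0) + (if k = j then a j / r ^ (j - i - 1) else 0))"
      using that r by (intro sum.cong refl) (auto simp: lk_phi_def)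
    also have "\<dots> = a i * r ^ (j - i - 1) + a j / r ^ (j - i - 1)"
      unfolding sum.distrib using that by simp
    finally show ?thesis using a that by (simp add: lk_index_def)
  qed
  have *: "a i = 0 \<and> a (Suc i) = 0 \<and> a (Suc (Suc i)) = 0" if "1 \<le> i" "Suc (Suc i) \<le> n" for i
  proof -
    have 1: "a (Suc i) = - a i" using E[of i "Suc i"] that by (simp add: eq_neg_iff_add_eq_0 add.commute)
    have 2: "a (Suc (Suc i)) = a i"
      using E[of "Suc i" "Suc (Suc i)"] that 1 by simp
    have "a i * r + a i / r = 0" using E[of i "Suc (Suc i)"] that 2 by simp
    then have "a i * (r\<^sup>2 + 1) = 0" using r by (simp add: field_simps power2_eq_square)
    then have "a i = 0" using r by (simp add: eq_neg_iff_add_eq_0)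
    with 1 2 show ?thesis by simp
  qed
  show ?thesis
  proof
    fix i assume i: "i \<in> {1..n}"
    then consider "Suc (Suc i) \<le> n" | "i = Suc (n - 2)" | "i = Suc (Suc (n - 2))" using n by force
    then show "a i = 0" using *[of i] *[of "n - 2"] i n by cases auto
  qed
qed

text \<open>The required dimension has codimension \<open>n - 1\<close>.\<close>

lemma half_mult_pred: "(n - 1) * (n - 2) div 2 + (n - 1) = n * (n - 1) div (2::nat)"
  by (cases n; cases "n - 1") (simp_all add: algebra_simps)

lemma lk_stable_subspace: "lk_stable l r n W \<Longrightarrow> VectorSpace.subspace (base_field l r) W (lk_space l r n)"
  by (simp add: lk_stable_def subspace_lk_space_iff)

lemma lk_stable_dim_imp:
  assumes n: "n \<ge> 5" and lr: "l \<noteq> 0" "r \<noteq> 0" "r\<^sup>2 \<noteq> 1" "r\<^sup>2 \<noteq> - 1"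
    and W: "lk_stable l r n W" and dim: "lk_dim l r n W = (n - 1) * (n - 2) div 2"
  shows "l = - (r ^ 3)"
proof (rule ccontr)
  assume l3: "l \<noteq> - (r ^ 3)"
  have m: "bmw_m r \<noteq> 0"
    using lr by (simp add: bmw_m_def field_simps power2_eq_square)
  have "W \<noteq> carrier (lk_space l r n)"
  proof
    assume "W = carrier (lk_space l r n)"
    then have "lk_dim l r n W = n * (n - 1) div 2"
      by (simp add: lk_dim_def lk_space_dim card_lk_index)
    then show False using dim half_mult_pred[of n] n by simp
  qed
  note van = lk_c_vanishes[OF lr(1,2) m W this]
  have van': "lk_pair n (lk_nuT l r j (lk_c l r k)) v = 0" if "k \<in> {1..<n}" "j \<in> {1..<n}" "v \<in> W" for j k v
    using van[OF that(1) lk_stableD(7)[OF W that(2,3)]] by (simp add: lk_pair_nu[OF that(2)])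
  \<comment> \<open>Codimension \<open>n - 1\<close> leaves room for fewer than \<open>n\<close>
    independent functionals vanishing on \<open>W\<close>; each case below exhibits \<open>n\<close>
    of them.\<close>
  have bound: "card S < n" if "finite S" "\<And>s p. s \<in> S \<Longrightarrow> f s p \<in> carrier (base_field l r)"
      "\<And>a. \<forall>p\<in>lk_index n. (\<Sum>s\<in>S. a s * f s p) = 0 \<Longrightarrow> \<forall>s\<in>S. a s = 0"
      "\<And>s v. s \<in> S \<Longrightarrow> v \<in> W \<Longrightarrow> lk_pair n (f s) v = 0"
    for S :: "nat set" and f
  proof -
    have "lk_dim l r n W + card S \<le> card (lk_index n)"
      by (rule lk_dim_codim_le[OF lk_stable_subspace[OF W] that])
    then have "(n - 1) * (n - 2) div 2 + card S \<le> n * (n - 1) div 2"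
      by (simp only: dim card_lk_index)
    then show ?thesis using half_mult_pred[of n] n by linarith
  qed
  show False
  proof (cases "l = r")
    case False
    let ?h = "lk_nuT l r 3 (lk_c l r 2)"
    \<comment> \<open>The functionals \<open>lk_c l r s\<close> start at \<open>s = 1\<close>, so
      index 0 is free for the additional one.\<close>
    define f where "f s = (if s = 0 then ?h else lk_c l r s)" for s
    \<comment> \<open>This is the value of \<open>?h\<close> on the test vector; cleared of
      denominators it is exactly \<open>(l - r) * (l + r ^ 3)\<close>.\<close>
    have h: "?h (2, 5) - r * ?h (1, 5) - r * ?h (2, 4) + r\<^sup>2 * ?h (1, 4) \<noteq> 0" (is "?E \<noteq> 0")
    proof
      have "1 - r\<^sup>2 \<noteq> 0" using lr by simp
      moreover have "bmw_m r = (1 - r\<^sup>2) / r" using lr by (simp add: bmw_m_def field_simps power2_eq_square)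
      ultimately have "?E * (l * (1 - r\<^sup>2)) = (l - r) * (l + r ^ 3)"
        using lr by (simp add: lk_nuT_def lk_c_def Let_def) (simp add: field_simps eval_nat_numeral)
      moreover assume "?E = 0"
      ultimately show False using False l3 by (simp add: eq_neg_iff_add_eq_0)
    qed
    have c: "lk_c l r s (2, 5) - r * lk_c l r s (1, 5) - r * lk_c l r s (2, 4) + r\<^sup>2 * lk_c l r s (1, 4) = 0"
      if s: "s \<ge> 1" for s
    proof -
      consider "s = 1" | "s = 2" | "s = 3" | "s = 4" | "s = 5" | "s > 5" using s by linarith
      then show ?thesis
        using lr by cases (simp_all add: lk_c_def field_simps eval_nat_numeral)
    qed
    have ind: "\<forall>s\<in>{0..<n}. a s = 0" if a: "\<forall>p\<in>lk_index n. (\<Sum>s\<in>{0..<n}. a s * f s p) = 0" for a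
    proof -
      have split: "(\<Sum>s\<in>{0..<n}. a s * f s p) = a 0 * ?h p + (\<Sum>s\<in>{1..<n}. a s * lk_c l r s p)" for p
      proof -
        have "{0..<n} = insert 0 {1..<n}" using n by auto
        then show ?thesis by (simp add: f_def)
      qed
      have X: "(\<Sum>s\<in>{1..<n}. a s * lk_c l r s p) = - (a 0 * ?h p)" if "p \<in> lk_index n" for p
        using a that split[of p] by (simp add: eq_neg_iff_add_eq_0 add.commute)
      have i: "(2, 5) \<in> lk_index n" "(1, 5) \<in> lk_index n" "(2, 4) \<in> lk_index n" "(1, 4) \<in> lk_index n"
        using n by (simp_all add: lk_index_def)
      \<comment> \<open>Evaluating the relation on the test vector removes all
        \<open>lk_c l r s\<close> and isolates \<open>a 0\<close>.\<close>
      have "0 = (\<Sum>s\<in>{1..<n}. a s * (lk_c l r s (2, 5) - r * lk_c l r s (1, 5) - r * lk_c l r s (2, 4) + r\<^sup>2 * lk_c l r s (1, 4)))"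
        using c by simp
      also have "\<dots> = (\<Sum>s\<in>{1..<n}. a s * lk_c l r s (2, 5)) - r * (\<Sum>s\<in>{1..<n}. a s * lk_c l r s (1, 5))
          - r * (\<Sum>s\<in>{1..<n}. a s * lk_c l r s (2, 4)) + r\<^sup>2 * (\<Sum>s\<in>{1..<n}. a s * lk_c l r s (1, 4))"
        by (simp add: algebra_simps sum.distrib sum_subtractf sum_distrib_left)
      also have "\<dots> = - a 0 * (?h (2, 5) - r * ?h (1, 5) - r * ?h (2, 4) + r\<^sup>2 * ?h (1, 4))"
        unfolding i[THEN X] by (simp add: algebra_simps)
      finally have a0: "a 0 = 0" using h by simp
      have "\<forall>s\<in>{1..<n}. a s = 0"
        using a0 X by (intro lk_c_independent[OF lr(1,2) l3 n]) simp
      with a0 show ?thesis by (metis One_nat_def atLeastLessThan_iff leI less_one)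
    qed
    have closed: "f s p \<in> carrier (base_field l r)" for s p
      by (simp add: f_def lk_c_closed lk_nuT_closed)
    have "lk_pair n (f s) v = 0" if "s \<in> {0..<n}" "v \<in> W" for s v
      using that n van[of s v] van'[of 2 3 v] by (cases "s = 0") (simp_all add: f_def)
    from bound[OF finite_atLeastLessThan closed ind this] have "card {0..<n} < n" .
    then show False by simp
  next
    case True
    \<comment> \<open>For \<open>l = r\<close> the factor \<open>l - r\<close> in
      \<open>lk_c_phi\<close> vanishes, so the decomposition holds at every pair, with
      \<open>l / r = 1\<close>.\<close>
    have c: "lk_pair n (lk_c l r k) v = lk_pair n (lk_phi l r (Suc k)) v + lk_pair n (lk_phi l r k) v" for k v
    proof -
      have "lk_pair n (lk_c l r k) v = lk_pair n (\<lambda>p. lk_phi l r (Suc k) p + l / r * lk_phi l r k p) v"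
      proof (rule lk_pair_cong)
        fix q assume "q \<in> lk_index n"
        then show "lk_c l r k q = lk_phi l r (Suc k) q + l / r * lk_phi l r k q"
          using lk_c_phi[OF lr(1,2) m, of "fst q" "snd q" k] True by (cases q) (simp add: lk_index_def)
      qed
      then show ?thesis using True lr by (simp add: lk_pair_add_left)
    qed
    have next_phi: "lk_pair n (lk_phi l r (Suc k)) v = - lk_pair n (lk_phi l r k) v"
      if "k \<in> {1..<n}" "v \<in> W" for k v
      using van[OF that] c[of k v] by (simp add: eq_neg_iff_add_eq_0)
    \<comment> \<open>On \<open>g_2 v\<close> the functional \<open>phi_1\<close> takes the value
      \<open>r * phi_1(v)\<close> and \<open>phi_2\<close> the value
      \<open>phi_3(v) / r = phi_1(v) / r\<close>. These are opposite, so
      \<open>(r ^ 2 + 1) * phi_1(v) = 0\<close>.\<close>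
    have phi1: "lk_pair n (lk_phi l r 1) v = 0" if v: "v \<in> W" for v
    proof -
      have "lk_pair n (lk_phi l r 1) (lk_nu l r n 2 v) = r * lk_pair n (lk_phi l r 1) v"
        using n lr by (simp add: lk_pair_nu flip: lk_pair_scale_left)
          (intro lk_pair_cong, auto simp: lk_index_def lk_nuT_phi)
      moreover have "lk_pair n (lk_phi l r 2) (lk_nu l r n 2 v) = 1 / r * lk_pair n (lk_phi l r 3) v"
        unfolding lk_pair_scale_left[symmetric] using n lr
        by (simp add: lk_pair_nu) (intro lk_pair_cong, auto simp: lk_index_def lk_nuT_phi eval_nat_numeral)
      moreover have "lk_nu l r n 2 v \<in> W" using n v by (intro lk_stableD(7)[OF W]) auto
      moreover have "lk_pair n (lk_phi l r 3) v = lk_pair n (lk_phi l r 1) v"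
        using next_phi[of 1 v] next_phi[of 2 v] v n by (simp add: eval_nat_numeral)
      ultimately have "r * lk_pair n (lk_phi l r 1) v + 1 / r * lk_pair n (lk_phi l r 1) v = 0"
        using next_phi[of 1 "lk_nu l r n 2 v"] n by (simp add: eval_nat_numeral)
      then have "(r\<^sup>2 + 1) * lk_pair n (lk_phi l r 1) v = 0"
        using lr by (simp add: field_simps power2_eq_square)
      then show ?thesis using lr by (simp add: eq_neg_iff_add_eq_0)
    qed
    have phi: "lk_pair n (lk_phi l r i) v = 0" if "1 \<le> i" "i \<le> n" "v \<in> W" for i v
      using that(1,2) by (induction i rule: dec_induct) (simp_all add: phi1[unfolded One_nat_def] next_phi that(3))
    have "\<forall>i\<in>{1..n}. a i = 0" if "\<forall>p\<in>lk_index n. (\<Sum>i\<in>{1..n}. a i * lk_phi l r i p) = 0" for a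
      by (rule lk_phi_independent[OF lr(2,4)]) (use n that True in simp_all)
    moreover have "lk_pair n (lk_phi l r i) v = 0" if "i \<in> {1..n}" "v \<in> W" for i v
      using that phi by simp
    ultimately have "card {1..n} < n"
      by (intro bound[of "{1..n}" "lk_phi l r", OF finite_atLeastAtMost lk_phi_closed])
    then show False by simp
  qed
qed

section \<open>The irreducible subspace at the special parameter\<close>

definition lk_cycles :: "complex \<Rightarrow> complex \<Rightarrow> nat \<Rightarrow> lk_vec set" where
  "lk_cycles l r n = {v \<in> carrier (lk_space l r n). \<forall>i\<in>{1..n}. lk_pair n (lk_phi l r i) v = 0}"

text \<open>The weighted boundary of the triangle \<open>a < b < c\<close>; for
  \<open>l = - (r ^ 3)\<close> the weights make every \<open>lk_phi l r i\<close> vanish on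
  it.\<close>

definition lk_tri :: "complex \<Rightarrow> nat \<Rightarrow> nat \<Rightarrow> nat \<Rightarrow> lk_vec" where
  "lk_tri r a b c = (\<lambda>p. lk_w b c p - r ^ (b - a) * lk_w a c p + r ^ (c - a) * lk_w a b p)"

lemma lk_pair_subset:
  assumes "A \<subseteq> lk_index n" "\<And>i j. (i, j) \<in> lk_index n \<Longrightarrow> (i, j) \<notin> A \<Longrightarrow> f (i, j) * v (i, j) = 0"
  shows "lk_pair n f v = (\<Sum>q\<in>A. f q * v q)"
  unfolding lk_pair_def using assms by (intro sum.mono_neutral_right) auto

lemma lk_pair_phi12:
  assumes "n \<ge> 2"
  shows "lk_pair n (lk_phi l r 1) v = v (1, 2) + (\<Sum>j\<in>{3..n}. r ^ (j - 2) * v (1, j))" (is ?A)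
    "lk_pair n (lk_phi l r 2) v = r / l * v (1, 2) + (\<Sum>j\<in>{3..n}. r ^ (j - 3) * v (2, j))" (is ?B)
proof -
  have "lk_pair n (lk_phi l r 1) v = (\<Sum>q\<in>insert (1, 2) ((\<lambda>j. (1, j)) ` {3..n}). lk_phi l r 1 q * v q)"
    using assms by (intro lk_pair_subset) (auto simp: lk_index_def lk_phi_def)
  also have "\<dots> = v (1, 2) + (\<Sum>j\<in>{3..n}. r ^ (j - 2) * v (1, j))"
    by (subst sum.insert) (auto simp: sum.reindex inj_on_def lk_phi_def eval_nat_numeral)
  finally show ?A .
  have "lk_pair n (lk_phi l r 2) v = (\<Sum>q\<in>insert (1, 2) ((\<lambda>j. (2, j)) ` {3..n}). lk_phi l r 2 q * v q)"
    using assms by (intro lk_pair_subset) (auto simp: lk_index_def lk_phi_def)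
  also have "\<dots> = r / l * v (1, 2) + (\<Sum>j\<in>{3..n}. r ^ (j - 3) * v (2, j))"
    by (subst sum.insert) (auto simp: sum.reindex inj_on_def lk_phi_def eval_nat_numeral)
  finally show ?B .
qed

lemma lk_stable_cancel:
  assumes "lk_stable l r n U" "c \<in> carrier (base_field l r)" "c \<noteq> 0" "(\<lambda>p. c * v p) \<in> U"
  shows "v \<in> U"
proof -
  have "(\<lambda>p. inverse c * (c * v p)) \<in> U"
    by (intro lk_stableD(5)[OF assms(1)] base_field_inverse assms)
  moreover have "inverse c * (c * x) = x" for x
    using assms(3) by (simp flip: mult.assoc)
  ultimately show ?thesis by simp
qed

context
  fixes n :: nat and l r :: complex
  assumes n: "n \<ge> 5" and r: "r \<noteq> 0" "\<forall>k\<in>{1..n}. (r\<^sup>2) ^ k \<noteq> 1" and l: "l = - (r ^ 3)"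
begin

declare One_nat_def [simp del]

private abbreviation "W0 \<equiv> lk_cycles l r n"
private abbreviation "nu \<equiv> lk_nu l r n"
private abbreviation "F \<equiv> carrier (base_field l r)"

lemma r_props: "l \<noteq> 0" "r\<^sup>2 \<noteq> 1" "r\<^sup>2 \<noteq> - 1" "bmw_m r \<noteq> 0"
proof -
  show "l \<noteq> 0" using l r by simp
  show r2: "r\<^sup>2 \<noteq> 1" using bspec[OF r(2), of 1] n by simp
  have "(r\<^sup>2)\<^sup>2 \<noteq> 1" using bspec[OF r(2), of 2] n by simp
  then show "r\<^sup>2 \<noteq> - 1" by (metis power2_minus one_power2)
  show "bmw_m r \<noteq> 0" using r r2 by (simp add: bmw_m_def field_simps power2_eq_square)
qed

lemma cycles_stable: "lk_stable l r n W0"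
  unfolding lk_stable_def
proof (intro conjI ballI)
  interpret V: vectorspace "base_field l r" "lk_space l r n" by (rule vectorspace_lk_space)
  show "W0 \<subseteq> carrier (lk_space l r n)" by (auto simp: lk_cycles_def)
  show "(\<lambda>p. 0) \<in> W0"
    using V.M.zero_closed by (auto simp: lk_cycles_def lk_pair_zero)
  show "(\<lambda>p. u p + v p) \<in> W0" if "u \<in> W0" "v \<in> W0" for u v
    using that V.M.a_closed[of u v] by (auto simp: lk_cycles_def lk_pair_add)
  show "(\<lambda>p. c * v p) \<in> W0" if "c \<in> F" "v \<in> W0" for c v
    using that V.smult_closed[of c v] by (auto simp: lk_cycles_def lk_pair_scale)
  fix k v assume k: "k \<in> {1..<n}" and v: "v \<in> W0"
  have v0: "lk_pair n (lk_phi l r i) v = 0" if "i \<in> {1..n}" for i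
    using v that by (simp add: lk_cycles_def)
  have "lk_pair n (lk_phi l r i) (nu k v) = 0" if i: "i \<in> {1..n}" for i
  proof -
    consider "i \<noteq> k" "i \<noteq> Suc k" | "i = k" | "i = Suc k" by blast
    then show ?thesis
    proof cases
      case 1
      have "lk_pair n (lk_phi l r i) (nu k v) = lk_pair n (\<lambda>q. r * lk_phi l r i q) v"
        unfolding lk_pair_nu[OF k]
        by (rule lk_pair_cong) (use 1 r r_props in \<open>auto simp: lk_index_def lk_nuT_phi\<close>)
      then show ?thesis using v0[OF i] by (simp add: lk_pair_scale_left)
    next
      case 2
      have "lk_pair n (lk_phi l r i) (nu k v) = lk_pair n (\<lambda>q. 1 / r * lk_phi l r (Suc k) q) v"
        unfolding lk_pair_nu[OF k]
        by (rule lk_pair_cong) (use 2 r r_props in \<open>auto simp: lk_index_def lk_nuT_phi\<close>)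
      then show ?thesis using v0[of "Suc k"] k by (simp only: lk_pair_scale_left) simp
    next
      case 3
      have "lk_pair n (lk_phi l r i) (nu k v) =
          lk_pair n (\<lambda>q. 1 / r * lk_phi l r k q + (r - 1 / r ^ 3) * lk_phi l r (Suc k) q) v"
        unfolding lk_pair_nu[OF k]
        by (rule lk_pair_cong) (use 3 r r_props l in \<open>auto simp: lk_index_def lk_nuT_phi\<close>)
      then show ?thesis using v0[of k] v0[of "Suc k"] k
        by (simp only: lk_pair_scale_left lk_pair_add_left) simp
    qed
  qed
  moreover have "nu k v \<in> carrier (lk_space l r n)"
    using v by (intro lk_nu_closed[OF k]) (simp add: lk_cycles_def)
  ultimately show "nu k v \<in> W0" by (simp add: lk_cycles_def)
qed

section \<open>Triangles through the last vertex as a basis of the cycle space\<close>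

lemma tri_in_cycles:
  assumes "1 \<le> a" "a < b" "b < c" "c \<le> n"
  shows "lk_tri r a b c \<in> W0"
proof -
  have i: "(b, c) \<in> lk_index n" "(a, c) \<in> lk_index n" "(a, b) \<in> lk_index n"
    using assms by (auto simp: lk_index_def)
  have "lk_tri r a b c p \<in> F" for p
    unfolding lk_tri_def by (intro base_field_closed base_field_closed') (simp_all add: lk_w_def)
  moreover have "lk_tri r a b c \<in> lk_supp n"
    unfolding lk_tri_def using i by (intro lk_supp_ops(2,3,4) lk_supp_w)
  moreover have "lk_pair n (lk_phi l r i) (lk_tri r a b c) = 0" for i
  proof -
    obtain d e where d: "b = Suc (a + d)" "c = Suc (Suc (a + d + e))"
      using assms less_imp_Suc_add[of a b] less_imp_Suc_add[of b c] by auto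
    have "lk_pair n (lk_phi l r i) (lk_tri r a b c) =
        lk_phi l r i (b, c) - r ^ (b - a) * lk_phi l r i (a, c) + r ^ (c - a) * lk_phi l r i (a, b)"
      by (simp add: lk_tri_def lk_pair_add lk_pair_diff lk_pair_scale lk_pair_w i)
    also have "\<dots> = 0"
      using r by (auto simp: lk_phi_def d l field_simps power_add eval_nat_numeral One_nat_def)
    finally show ?thesis .
  qed
  ultimately show ?thesis by (simp add: lk_cycles_def carrier_lk_space)
qed

text \<open>On a vector supported on the pairs \<open>(i, n)\<close>, the functional
  \<open>lk_phi l r i\<close> has the value \<open>r ^ (n - i - 1) * v (i, n)\<close>, so these
  coordinates vanish too.\<close>

lemma cycles_eq_zeroI:
  assumes v: "v \<in> W0" and z: "\<And>i j. 1 \<le> i \<Longrightarrow> i < j \<Longrightarrow> j < n \<Longrightarrow> v (i, j) = 0"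
  shows "v = (\<lambda>p. 0)"
proof
  fix p :: "nat \<times> nat"
  have last: "v (i, n) = 0" if i: "1 \<le> i" "i < n" for i
  proof -
    have "lk_pair n (lk_phi l r i) v = (\<Sum>q\<in>{(i, n)}. lk_phi l r i q * v q)"
    proof (rule lk_pair_subset)
      show "{(i, n)} \<subseteq> lk_index n" using i by (simp add: lk_index_def)
      fix a b assume ab: "(a, b) \<in> lk_index n" "(a, b) \<notin> {(i, n)}"
      show "lk_phi l r i (a, b) * v (a, b) = 0"
      proof (cases "b < n")
        case True
        then show ?thesis using ab z by (simp add: lk_index_def)
      next
        case False
        then show ?thesis using ab i by (simp add: lk_index_def lk_phi_def)
      qed
    qed
    also have "\<dots> = r ^ (n - i - 1) * v (i, n)" by (simp add: lk_phi_def)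
    finally show ?thesis using v i r by (simp add: lk_cycles_def)
  qed
  obtain i j where p: "p = (i, j)" by (cases p)
  show "v p = 0"
  proof (cases "(i, j) \<in> lk_index n")
    case True
    then show ?thesis using last z by (cases "j = n") (simp_all add: p lk_index_def)
  qed (use p lk_suppD[OF lk_stableD(2)[OF cycles_stable v]] in simp)
qed

text \<open>Among pairs with both entries below \<open>n\<close>, the triangle on \<open>a\<close>,
  \<open>b\<close>, \<open>n\<close> involves only \<open>(a, b)\<close>, with weight
  \<open>r ^ (n - a)\<close>.\<close>

lemma tri_sum_coord:
  assumes "p \<in> lk_index (n - 1)"
  shows "(\<Sum>q\<in>lk_index (n - 1). u q / r ^ (n - fst q) * lk_tri r (fst q) (snd q) n p) = u p"
proof -
  have "(\<Sum>q\<in>lk_index (n - 1). u q / r ^ (n - fst q) * lk_tri r (fst q) (snd q) n p) =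
      (\<Sum>q\<in>lk_index (n - 1). if q = p then u p else 0)"
    using assms r by (intro sum.cong) (auto simp: lk_tri_def lk_w_def lk_index_def)
  then show ?thesis using assms by simp
qed

lemma tri_sum_in:
  assumes U: "lk_stable l r n U" and tri: "\<And>a b. 1 \<le> a \<Longrightarrow> a < b \<Longrightarrow> b < n \<Longrightarrow> lk_tri r a b n \<in> U"
    and u: "\<And>q. u q \<in> F"
  shows "(\<lambda>p. \<Sum>q\<in>lk_index (n - 1). u q / r ^ (n - fst q) * lk_tri r (fst q) (snd q) n p) \<in> U"
proof (rule lk_stable_sum[OF U])
  fix q assume q: "q \<in> lk_index (n - 1)"
  show "(\<lambda>p. u q / r ^ (n - fst q) * lk_tri r (fst q) (snd q) n p) \<in> U"
    using q by (intro lk_stableD(5)[OF U] tri base_field_closed base_field_closed' u) (auto simp: lk_index_def)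
qed

text \<open>These triangles play the role of the fundamental cycles for the star at vertex
  \<open>n\<close> as spanning tree.\<close>

lemma cycles_expand:
  assumes v: "v \<in> W0"
  shows "v = (\<lambda>p. \<Sum>q\<in>lk_index (n - 1). v q / r ^ (n - fst q) * lk_tri r (fst q) (snd q) n p)"
    (is "v = ?s")
proof -
  have vF: "v q \<in> F" for q using v by (simp add: lk_cycles_def carrier_lk_space)
  have "?s \<in> W0"
    by (intro tri_sum_in cycles_stable tri_in_cycles vF) auto
  then have "(\<lambda>p. v p - ?s p) \<in> W0" by (intro lk_stableD(6)[OF cycles_stable] v)
  then have "(\<lambda>p. v p - ?s p) = (\<lambda>p. 0)"
    by (rule cycles_eq_zeroI) (subst tri_sum_coord, auto simp: lk_index_def)
  from fun_cong[OF this] show ?thesis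
    by (intro ext) (rule eq_iff_diff_eq_0[THEN iffD2])
qed

lemma dim_cycles: "lk_dim l r n W0 = (n - 1) * (n - 2) div 2"
proof -
  \<comment> \<open>Forgetting the pairs with larger entry \<open>n\<close> identifies cycles with
    arbitrary vectors on \<open>n - 1\<close> indices.\<close>
  define T where "T v = (\<lambda>p. if p \<in> lk_index (n - 1) then v p else 0)" for v :: lk_vec
  have "bij_betw T W0 (carrier (lk_space l r (n - 1)))"
  proof (rule bij_betwI')
    fix u v assume uv: "u \<in> W0" "v \<in> W0"
    show "(T u = T v) = (u = v)"
    proof
      assume *: "T u = T v"
      have "u (i, j) = v (i, j)" if "1 \<le> i" "i < j" "j < n" for i j
      proof -
        have "(i, j) \<in> lk_index (n - 1)" using that by (auto simp: lk_index_def)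
        then show ?thesis using fun_cong[OF *, of "(i, j)"] by (simp add: T_def)
      qed
      then have "(\<lambda>p. u p - v p) = (\<lambda>p. 0)"
        using uv by (intro cycles_eq_zeroI lk_stableD(6)[OF cycles_stable]) auto
      then show "u = v" by (simp add: fun_eq_iff)
    qed simp
  next
    fix v assume "v \<in> W0"
    then show "T v \<in> carrier (lk_space l r (n - 1))"
      by (auto simp: T_def lk_cycles_def carrier_lk_space lk_supp_def)
  next
    fix u assume u: "u \<in> carrier (lk_space l r (n - 1))"
    let ?s = "\<lambda>p. \<Sum>q\<in>lk_index (n - 1). u q / r ^ (n - fst q) * lk_tri r (fst q) (snd q) n p"
    have "?s \<in> W0"
      using u by (intro tri_sum_in cycles_stable tri_in_cycles) (auto simp: carrier_lk_space)
    moreover have "u p = T ?s p" for p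
    proof (cases "p \<in> lk_index (n - 1)")
      case True
      then show ?thesis using tri_sum_coord[OF True, of u] by (simp add: T_def)
    next
      case False
      then show ?thesis using u lk_suppD[of u "n - 1" p] by (simp add: T_def carrier_lk_space)
    qed
    ultimately show "\<exists>v\<in>W0. u = T v" by blast
  qed
  then have "lk_dim l r n W0 = card (lk_index (n - 1))"
    by (intro lk_dim_eq[where T = T] lk_stable_subspace cycles_stable) (auto simp: T_def fun_eq_iff)
  then show ?thesis by (simp add: card_lk_index numeral_2_eq_2)
qed

section \<open>All triangles from the first one\<close>

lemma nu_tri:
  assumes "1 \<le> a" "a < b" "b < c" "c \<le> n"
  shows "c < n \<Longrightarrow> nu c (lk_tri r a b c) = lk_tri r a b (Suc c)"
    "Suc b < c \<Longrightarrow> nu b (lk_tri r a b c) = lk_tri r a (Suc b) c"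
    "Suc a < b \<Longrightarrow> nu a (lk_tri r a b c) = (\<lambda>p. r * lk_tri r (Suc a) b c p)"
proof -
  note nus = lk_nu_add lk_nu_diff lk_nu_scale lk_nu_rules
  show "nu c (lk_tri r a b c) = lk_tri r a b (Suc c)" if "c < n"
    using assms that by (simp add: lk_tri_def nus Suc_diff_le, (simp add: mult_ac)?)
  show "nu b (lk_tri r a b c) = lk_tri r a (Suc b) c" if "Suc b < c"
    using assms that by (simp add: lk_tri_def nus Suc_diff_le, (simp add: mult_ac)?)
  show "nu a (lk_tri r a b c) = (\<lambda>p. r * lk_tri r (Suc a) b c p)" if "Suc a < b"
  proof -
    have "r ^ (b - a) = r * r ^ (b - Suc a)" "r ^ (c - a) = r * r ^ (c - Suc a)"
      using assms that by (simp_all flip: power_Suc add: Suc_diff_Suc)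
    then show ?thesis
      using assms that by (simp add: lk_tri_def nus) (simp add: algebra_simps)
  qed
qed

text \<open>The third vertex is raised first, then the second, then the first, so that each move
  goes to a free vertex.\<close>

lemma tri_generates:
  assumes U: "lk_stable l r n U" and t: "lk_tri r 1 2 3 \<in> U"
  shows "W0 \<subseteq> U"
proof -
  have 1: "lk_tri r 1 2 c \<in> U" if "3 \<le> c" "c \<le> n" for c
    using that
  proof (induction c rule: dec_induct)
    case base
    show ?case by (rule t)
  next
    case (step c)
    then have "nu c (lk_tri r 1 2 c) \<in> U" by (intro lk_stableD(7)[OF U]) auto
    then show ?case using step by (simp add: nu_tri)
  qed
  have 2: "lk_tri r 1 b c \<in> U" if "2 \<le> b" "b < c" "c \<le> n" for b c
    using that
  proof (induction b rule: dec_induct)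
    case base
    then show ?case by (intro 1) auto
  next
    case (step b)
    then have "nu b (lk_tri r 1 b c) \<in> U" by (intro lk_stableD(7)[OF U]) auto
    then show ?case using step by (simp add: nu_tri)
  qed
  have 3: "lk_tri r a b c \<in> U" if "1 \<le> a" "a < b" "b < c" "c \<le> n" for a b c
    using that
  proof (induction a rule: dec_induct)
    case base
    then show ?case by (intro 2) auto
  next
    case (step a)
    then have "nu a (lk_tri r a b c) \<in> U" by (intro lk_stableD(7)[OF U]) auto
    then have "(\<lambda>p. r * lk_tri r (Suc a) b c p) \<in> U" using step by (simp add: nu_tri)
    then show ?case by (rule lk_stable_cancel[OF U base_field_closed(4) r(1)])
  qed
  show ?thesis
  proof
    fix v assume v: "v \<in> W0"
    have vF: "v q \<in> F" for q using v by (simp add: lk_cycles_def carrier_lk_space)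
    have "(\<lambda>p. \<Sum>q\<in>lk_index (n - 1). v q / r ^ (n - fst q) * lk_tri r (fst q) (snd q) n p) \<in> U"
      by (rule tri_sum_in[OF U]) (simp_all add: 3 vF)
    then show "v \<in> U" by (simp only: cycles_expand[OF v, symmetric])
  qed
qed

section \<open>Eigenvectors of the first generator among the cycles\<close>

lemma nu1_quadratic:
  assumes v: "v \<in> W0"
  shows "nu 1 (nu 1 v) p = v p - bmw_m r * nu 1 v p"
proof -
  have k: "1 \<in> {1..<n}" using n by simp
  \<comment> \<open>On cycles \<open>lk_c l r 1\<close> is a combination of vanishing functionals,
    so \<open>e_1\<close> acts as zero and \<open>(g_1 - r) * (g_1 + 1 / r) = 0\<close>.\<close>
  have "lk_pair n (lk_c l r 1) v = lk_pair n (\<lambda>q. lk_phi l r (Suc 1) q + l / r * lk_phi l r 1 q) v"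
  proof (rule lk_pair_cong)
    fix q assume "q \<in> lk_index n"
    then show "lk_c l r 1 q = lk_phi l r (Suc 1) q + l / r * lk_phi l r 1 q"
      using lk_c_phi[OF r_props(1) r(1) r_props(4), of "fst q" "snd q" 1] l by (cases q) (simp add: lk_index_def)
  qed
  also have "\<dots> = 0"
    unfolding lk_pair_add_left lk_pair_scale_left using v n by (simp add: lk_cycles_def)
  finally have "lk_e l r n 1 v p = 0"
    by (simp add: lk_e_pair[OF r_props(1) r(1) r_props(4) k lk_stableD(2)[OF cycles_stable v]])
  then have "nu 1 (nu 1 v) p + bmw_m r * nu 1 v p - v p = 0"
    unfolding lk_e_def mult_eq_0_iff using r_props by simp
  then show ?thesis by (simp add: algebra_simps)
qed

definition lk_eig :: "lk_vec set" where
  "lk_eig = {v \<in> W0. \<forall>p. nu 1 v p = - v p / r}"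

lemma lk_eigI:
  assumes v: "v \<in> W0"
  shows "(\<lambda>p. nu 1 v p - r * v p) \<in> lk_eig"
proof -
  have "bmw_m r + r = 1 / r" by (simp add: bmw_m_def)
  then have m: "bmw_m r = 1 / r - r" by (simp add: algebra_simps)
  have "(\<lambda>p. nu 1 v p - r * v p) \<in> W0"
    using v n r by (intro lk_stableD[OF cycles_stable] base_field_closed) auto
  moreover have "nu 1 (\<lambda>p. nu 1 v p - r * v p) p = - (nu 1 v p - r * v p) / r" for p
    using r by (simp add: lk_nu_diff lk_nu_scale nu1_quadratic[OF v] m field_simps)
  ultimately show ?thesis by (simp add: lk_eig_def diff_divide_distrib)
qed

text \<open>The coordinates \<open>v (2, j)\<close> with \<open>j >= 3\<close> determine an
  eigenvector. For \<open>i >= 3\<close>, \<open>g_1\<close> multiplies the coordinate by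
  \<open>r\<close>, which differs from \<open>- 1 / r\<close>; at \<open>(1, j)\<close> it reads off
  \<open>v (2, j)\<close>; and \<open>v (1, 2)\<close> follows from
  \<open>phi_1(v) = 0\<close>.\<close>

lemma lk_eig_coord:
  assumes v: "v \<in> lk_eig"
  shows "3 \<le> i \<Longrightarrow> v (i, j) = 0" "3 \<le> j \<Longrightarrow> j \<le> n \<Longrightarrow> v (1, j) = - r * v (2, j)"
    "v (1, 2) = (\<Sum>j\<in>{3..n}. r ^ (j - 1) * v (2, j))"
proof -
  have k: "1 \<in> {1..<n}" using n by simp
  have v0: "v \<in> W0" and e: "nu 1 v p = - v p / r" for p using v by (auto simp: lk_eig_def)
  show "v (i, j) = 0" if "3 \<le> i"
  proof (cases "(i, j) \<in> lk_index n")
    case True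
    then have "r * v (i, j) = - v (i, j) / r"
      using that e[of "(i, j)"] lk_nu_coord(1)[OF k, of i j l r v] by (simp add: lk_index_def)
    then have "(r\<^sup>2 + 1) * v (i, j) = 0"
      using r by (simp add: field_simps power2_eq_square)
    then show ?thesis using r_props by (simp add: eq_neg_iff_add_eq_0)
  qed (use lk_suppD[OF lk_stableD(2)[OF cycles_stable v0]] in auto)
  show 12: "v (1, j) = - r * v (2, j)" if "3 \<le> j" "j \<le> n" for j
    using e[of "(1, j)"] lk_nu_coord(2)[OF k, of j l r v] that r by (simp add: field_simps)
  have "lk_pair n (lk_phi l r 1) v = 0" using v0 n by (simp add: lk_cycles_def)
  then have "v (1, 2) = - (\<Sum>j\<in>{3..n}. r ^ (j - 2) * v (1, j))"
    using n by (simp add: lk_pair_phi12 eq_neg_iff_add_eq_0)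
  also have "\<dots> = (\<Sum>j\<in>{3..n}. r ^ (j - 1) * v (2, j))"
    unfolding sum_negf[symmetric]
  proof (rule sum.cong)
    fix j assume j: "j \<in> {3..n}"
    then have "j - 1 = Suc (j - 2)" by auto
    with j show "- (r ^ (j - 2) * v (1, j)) = r ^ (j - 1) * v (2, j)" by (simp add: 12)
  qed simp
  finally show "v (1, 2) = (\<Sum>j\<in>{3..n}. r ^ (j - 1) * v (2, j))" .
qed

lemma lk_eig_eq_zeroI:
  assumes v: "v \<in> lk_eig" and z: "\<And>j. 3 \<le> j \<Longrightarrow> j \<le> n \<Longrightarrow> v (2, j) = 0"
  shows "v = (\<lambda>p. 0)"
proof (rule cycles_eq_zeroI)
  show "v \<in> W0" using v by (simp add: lk_eig_def)
  fix i j :: nat assume ij: "1 \<le> i" "i < j" "j < n"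
  then have "i = 1 \<and> j = 2 \<or> i = 1 \<and> 3 \<le> j \<or> i = 2 \<and> 3 \<le> j \<or> 3 \<le> i" by arith
  then show "v (i, j) = 0"
    using ij by (elim disjE conjE) (simp_all add: z lk_eig_coord[OF v])
qed

lemma lk_eig_add: "u \<in> lk_eig \<Longrightarrow> v \<in> lk_eig \<Longrightarrow> (\<lambda>p. u p + v p) \<in> lk_eig"
  and lk_eig_scale: "c \<in> F \<Longrightarrow> v \<in> lk_eig \<Longrightarrow> (\<lambda>p. c * v p) \<in> lk_eig"
  using lk_stableD(4,5)[OF cycles_stable]
  by (auto simp: lk_eig_def lk_nu_add lk_nu_scale add_divide_distrib)

text \<open>For \<open>k >= 3\<close> the generator \<open>g_k\<close> commutes with
  \<open>g_1\<close>, so it preserves the eigenspace.\<close>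

lemma lk_eig_nu:
  assumes v: "v \<in> lk_eig" and k: "3 \<le> k" "k < n"
  shows "nu k v \<in> lk_eig"
proof -
  have v0: "v \<in> W0" and e: "nu 1 v = (\<lambda>p. - (1 / r) * v p)" using v by (auto simp: lk_eig_def)
  have "nu 1 (nu k v) = nu k (nu 1 v)"
    using n k r r_props lk_stableD(2)[OF cycles_stable v0] by (intro lk_nu_commute) auto
  then have "nu 1 (nu k v) p = - nu k v p / r" for p
    unfolding e lk_nu_scale by simp
  moreover have "nu k v \<in> W0" using k by (intro lk_stableD(7)[OF cycles_stable] v0) auto
  ultimately show ?thesis by (simp add: lk_eig_def)
qed

lemma tri_eig: "lk_tri r 1 2 3 \<in> lk_eig"
proof -
  have "nu 1 (lk_tri r 1 2 3) p = - lk_tri r 1 2 3 p / r" for p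
    using n r lk_nu_rules(2)[of 1 n l r] lk_nu_rules(3)[of 1 n 3 l r] lk_nu_rules(4)[of 1 n 3 l r]
    by (simp add: lk_tri_def lk_nu_add lk_nu_diff lk_nu_scale l bmw_m_def field_simps power2_eq_square power3_eq_cube)
  then show ?thesis using n tri_in_cycles[of 1 2 3] by (simp add: lk_eig_def)
qed

text \<open>The coordinate at \<open>(2, 3)\<close> of \<open>(g_1 - r) g_2 v + r ^ 2 * v\<close>
  for an eigenvector \<open>v\<close>; the triangle on 1, 2, 3 has coordinate 1 there.\<close>

definition lk_beta :: "lk_vec \<Rightarrow> complex" where
  "lk_beta v = v (1, 2) + (1 + 1 / r\<^sup>2) * v (2, 3)"

text \<open>This is the coordinate missing from \<open>lk_nu_coord\<close>. Contributions come from
  pairs containing 3, and the pairs \<open>(3, j)\<close> drop out for an eigenvector.\<close>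

lemma lk_eig_nu2_coord:
  assumes v: "v \<in> lk_eig"
  shows "nu 2 v (2, 3) = - v (2, 3) / r"
proof -
  have k: "2 \<in> {1..<n}" using n by simp
  have "nu 2 v (2, 3) = lk_pair n (lk_nuT l r 2 (lk_w 2 3)) v"
    using n by (simp flip: lk_pair_nu[OF k] add: lk_pair_w_left lk_index_def)
  also have "\<dots> = (\<Sum>q\<in>{(1, 3), (2, 3)}. lk_nuT l r 2 (lk_w 2 3) q * v q)"
  proof (rule lk_pair_subset)
    show "{(1, 3), (2, 3)} \<subseteq> lk_index n" using n by (auto simp: lk_index_def)
    fix i j assume ij: "(i, j) \<in> lk_index n" "(i, j) \<notin> {(1, 3), (2, 3)}"
    then have "1 \<le> i" "i < j" "i = 1 \<longrightarrow> j \<noteq> 3" "i = 2 \<longrightarrow> j \<noteq> 3" by (auto simp: lk_index_def)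
    then have "3 \<le> i \<or> i = 1 \<and> j = 2 \<or> i = 1 \<and> 3 < j \<or> i = 2 \<and> 3 < j" by arith
    then show "lk_nuT l r 2 (lk_w 2 3) (i, j) * v (i, j) = 0"
      by (elim disjE conjE) (simp_all add: lk_eig_coord(1)[OF v] lk_nuT_def lk_w_def)
  qed
  also have "\<dots> = bmw_m r / l * v (1, 3) + 1 / l * v (2, 3)"
    by (simp add: lk_nuT_def lk_w_def)
  also have "\<dots> = - v (2, 3) / r"
    using n r by (simp add: lk_eig_coord(2)[OF v] bmw_m_def l field_simps power3_eq_cube)
  finally show ?thesis .
qed

text \<open>The difference of the two sides is again an eigenvector, so only its coordinates
  \<open>(2, j)\<close> need checking: at \<open>j = 3\<close> it vanishes by the choice of
  \<open>lk_beta\<close>, and for larger \<open>j\<close> both sides are zero.\<close>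

lemma nu_beta:
  assumes v: "v \<in> lk_eig"
  shows "(\<lambda>p. (nu 1 (nu 2 v) p - r * nu 2 v p) + r\<^sup>2 * v p) = (\<lambda>p. lk_beta v * lk_tri r 1 2 3 p)"
proof -
  have k: "1 \<in> {1..<n}" "2 \<in> {1..<n}" using n by auto
  have v0: "v \<in> W0" using v by (simp add: lk_eig_def)
  have vF: "v q \<in> F" for q using v0 by (simp add: lk_cycles_def carrier_lk_space)
  have bF: "lk_beta v \<in> F" unfolding lk_beta_def
    by (intro base_field_closed base_field_closed' vF)
  let ?z = "\<lambda>p. nu 1 (nu 2 v) p - r * nu 2 v p"
  let ?D = "\<lambda>p. (?z p + r\<^sup>2 * v p) + - lk_beta v * lk_tri r 1 2 3 p"
  have z: "?z (2, j) = nu 2 v (1, j) - nu 2 v (2, j) / r" if "3 \<le> j" "j \<le> n" for j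
    using lk_nu_coord(3)[OF k(1), of j l r "nu 2 v"] that r
    by (simp add: bmw_m_def field_simps)
  have "?D \<in> lk_eig"
    using v k(2) by (intro lk_eig_add lk_eig_scale lk_eigI tri_eig lk_stableD(7)[OF cycles_stable] v0
        base_field_closed base_field_closed' bF)
  moreover have "?D (2, j) = 0" if j: "3 \<le> j" "j \<le> n" for j
  proof (cases "j = 3")
    case True
    have "nu 2 v (1, 3) = v (1, 2) - bmw_m r * v (1, 3)"
      using lk_nu_coord(5)[OF k(2), of 1 l r v] by simp
    also have "\<dots> = v (1, 2) + (1 - r\<^sup>2) * v (2, 3)"
      using n r by (simp add: lk_eig_coord(2)[OF v] bmw_m_def algebra_simps power2_eq_square)
    finally have y: "nu 2 v (1, 3) = v (1, 2) + (1 - r\<^sup>2) * v (2, 3)" .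
    have "?z (2, 3) = nu 2 v (1, 3) - nu 2 v (2, 3) / r" using n by (intro z) auto
    then have "?z (2, 3) = v (1, 2) + (1 + 1 / r\<^sup>2 - r\<^sup>2) * v (2, 3)"
      unfolding y lk_eig_nu2_coord[OF v] by (simp add: algebra_simps power2_eq_square)
    then show ?thesis using True by (simp add: lk_beta_def lk_tri_def lk_w_def algebra_simps)
  next
    case False
    then have j: "3 < j" "j \<le> n" using j by auto
    have "nu 2 v (1, j) = r * v (1, j)"
      using j by (intro lk_nu_coord(1)[OF k(2)]) auto
    moreover have "nu 2 v (2, j) = 0"
      using lk_nu_coord(2)[OF k(2), of j l r v] j by (simp add: lk_eig_coord[OF v])
    ultimately have "?z (2, j) = - r\<^sup>2 * v (2, j)"
      using z[of j] j by (simp add: lk_eig_coord(2)[OF v] power2_eq_square)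
    then show ?thesis using j by (simp add: lk_tri_def lk_w_def)
  qed
  ultimately have "?D = (\<lambda>p. 0)" by (rule lk_eig_eq_zeroI)
  then show ?thesis by (simp add: fun_eq_iff)
qed

text \<open>Vanishing of \<open>lk_beta\<close> on all translates forces the coordinates
  \<open>(2, j)\<close> into a geometric progression with ratio \<open>r\<close>. Then
  \<open>lk_beta v = 0\<close> says that \<open>v (2, 3)\<close> times the sum of
  \<open>(r ^ 2) ^ i\<close> over \<open>i < n\<close> is zero, and \<open>(r ^ 2) ^ n\<close> is
  not 1.\<close>

lemma lk_eig_beta_zero:
  assumes U: "lk_stable l r n U" and v: "v \<in> lk_eig \<inter> U" and b: "\<And>u. u \<in> lk_eig \<inter> U \<Longrightarrow> lk_beta u = 0"
  shows "v = (\<lambda>p. 0)"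
proof -
  have nuU: "nu k u \<in> lk_eig \<inter> U" if "u \<in> lk_eig \<inter> U" "3 \<le> k" "k < n" for u k
    using that by (auto intro!: lk_eig_nu lk_stableD(7)[OF U])
  have c: "1 + 1 / r\<^sup>2 \<noteq> 0"
    using r r_props by (simp add: field_simps eq_neg_iff_add_eq_0 add.commute)
  have geo: "u (2, j) = r ^ (j - 3) * u (2, 3)" if u: "u \<in> lk_eig \<inter> U" and j: "3 \<le> j" "j \<le> n" for u j
    using j u
  proof (induction j arbitrary: u rule: dec_induct)
    case (step j)
    have k: "j \<in> {1..<n}" using step by simp
    have up: "nu j u (2, j) = u (2, Suc j)"
      using step by (intro lk_nu_coord(4)[OF k]) auto
    show ?case
    proof (cases "j = 3")
      case True
      \<comment> \<open>Comparing \<open>lk_beta (nu 3 u) = 0\<close> with \<open>r\<close> times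
        \<open>lk_beta u = 0\<close> eliminates \<open>u (1, 2)\<close>.\<close>
      have "nu 3 u (1, 2) = r * u (1, 2)"
        using n by (intro lk_nu_coord(1)) auto
      then have 1: "r * u (1, 2) + (1 + 1 / r\<^sup>2) * u (2, 4) = 0"
        using b[OF nuU[OF step.prems(2), of 3]] n up True by (simp add: lk_beta_def)
      have 2: "u (1, 2) + (1 + 1 / r\<^sup>2) * u (2, 3) = 0"
        using b[OF step.prems(2)] by (simp only: lk_beta_def)
      have "(1 + 1 / r\<^sup>2) * (u (2, 4) - r * u (2, 3)) =
          (r * u (1, 2) + (1 + 1 / r\<^sup>2) * u (2, 4)) - r * (u (1, 2) + (1 + 1 / r\<^sup>2) * u (2, 3))"
        by (simp only: algebra_simps)
      then have "(1 + 1 / r\<^sup>2) * (u (2, 4) - r * u (2, 3)) = 0"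
        unfolding 1 2 by simp
      then show ?thesis using c True by simp
    next
      case False
      \<comment> \<open>The induction hypothesis is applied to the translate, whose coordinate
        \<open>(2, j)\<close> is \<open>u (2, j + 1)\<close>; this is why \<open>u\<close> is
        generalized.\<close>
      then have "nu j u (2, 3) = r * u (2, 3)"
        using step by (intro lk_nu_coord(1)[OF k]) auto
      moreover have "nu j u (2, j) = r ^ (j - 3) * nu j u (2, 3)"
        using step nuU[of u j] by (intro step.IH) auto
      moreover have "Suc j - 3 = Suc (j - 3)" using step by auto
      ultimately show ?thesis using up by (simp only: power_Suc mult_ac)
    qed
  qed simp
  have "v (1, 2) = (\<Sum>j\<in>{3..n}. r ^ (j - 1) * v (2, j))"
    using v by (intro lk_eig_coord(3)) simp
  also have "\<dots> = (\<Sum>j\<in>{3..n}. (r\<^sup>2) ^ (j - 1)) / r\<^sup>2 * v (2, 3)"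
    unfolding sum_divide_distrib sum_distrib_right
  proof (rule sum.cong)
    fix j assume j: "j \<in> {3..n}"
    then obtain i where i: "j = i + 3" by (metis atLeastAtMost_iff le_Suc_ex add.commute)
    have "v (2, j) = r ^ i * v (2, 3)" using geo[OF v, of j] j i by simp
    moreover have "j - 1 = i + 2" using i by simp
    moreover have "(r\<^sup>2) ^ (i + 2) = r ^ (i + 2) * r ^ i * r\<^sup>2"
      unfolding power_add[symmetric] power_mult[symmetric] by (rule arg_cong[of _ _ "(^) r"]) simp
    ultimately show "r ^ (j - 1) * v (2, j) = (r\<^sup>2) ^ (j - 1) / r\<^sup>2 * v (2, 3)"
      using r by simp
  qed simp
  also have "(\<Sum>j\<in>{3..n}. (r\<^sup>2) ^ (j - 1)) = (\<Sum>i\<in>{2..<n}. (r\<^sup>2) ^ i)"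
    by (rule sum.reindex_bij_witness[of _ Suc "\<lambda>j. j - 1"]) auto
  also have "\<dots> = (\<Sum>i<n. (r\<^sup>2) ^ i) - 1 - r\<^sup>2"
  proof -
    have "{..<n} = insert 0 (insert 1 {2..<n})" using n by auto
    then show ?thesis by simp
  qed
  finally have A: "v (1, 2) = ((\<Sum>i<n. (r\<^sup>2) ^ i) - 1 - r\<^sup>2) / r\<^sup>2 * v (2, 3)" .
  have B: "v (1, 2) + (1 + 1 / r\<^sup>2) * v (2, 3) = 0"
    using b[OF v] by (simp only: lk_beta_def)
  have C: "s * x = r\<^sup>2 * ((s - 1 - r\<^sup>2) / r\<^sup>2 * x + (1 + 1 / r\<^sup>2) * x)" for s x
    using r(1) by (simp add: field_simps)
  have "(\<Sum>i<n. (r\<^sup>2) ^ i) * v (2, 3) = 0"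
    by (subst C) (simp only: B[unfolded A] mult_zero_right)
  moreover have "(\<Sum>i<n. (r\<^sup>2) ^ i) \<noteq> 0"
    using bspec[OF r(2), of n] n r_props(2) by (simp add: geometric_sum)
  ultimately have "v (2, 3) = 0" by simp
  then have "v (2, j) = 0" if "3 \<le> j" "j \<le> n" for j
    using geo[OF v that] by simp
  then show ?thesis using v by (intro lk_eig_eq_zeroI) simp_all
qed

text \<open>If \<open>g_1\<close> acts as \<open>r\<close> on \<open>U\<close>, the two functionals
  \<open>phi_1\<close> and \<open>phi_2\<close> force \<open>x (1, 2) = 0\<close> for every
  \<open>x\<close> in \<open>U\<close>. Since \<open>U\<close> is stable, applying this to
  translates moves the zero to every other coordinate.\<close>

lemma nu1_scalar_zero:
  assumes U: "lk_stable l r n U" "U \<subseteq> W0" and s: "\<And>x p. x \<in> U \<Longrightarrow> nu 1 x p = r * x p"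
  shows "U = {\<lambda>p. 0}"
proof -
  have k: "1 \<in> {1..<n}" using n by simp
  have x12: "x (1, 2) = 0" if x: "x \<in> U" for x
  proof -
    have x2: "x (2, j) = r * x (1, j)" if "3 \<le> j" "j \<le> n" for j
      using s[OF x, of "(1, j)"] lk_nu_coord(2)[OF k, of j l r x] that by simp
    have phi: "lk_pair n (lk_phi l r 1) x = 0" "lk_pair n (lk_phi l r 2) x = 0"
      using x U(2) n by (auto simp: lk_cycles_def subset_iff)
    have "(\<Sum>j\<in>{3..n}. r ^ (j - 3) * x (2, j)) = (\<Sum>j\<in>{3..n}. r ^ (j - 2) * x (1, j))"
    proof (rule sum.cong)
      fix j assume j: "j \<in> {3..n}"
      then have "j - 2 = Suc (j - 3)" by auto
      with j show "r ^ (j - 3) * x (2, j) = r ^ (j - 2) * x (1, j)" by (simp add: x2)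
    qed simp
    \<comment> \<open>This is \<open>phi_1(x) - phi_2(x)\<close>; for \<open>l = - (r ^ 3)\<close>
      the factor is \<open>1 + 1 / r ^ 2\<close>.\<close>
    then have "(1 - r / l) * x (1, 2) = 0"
      using phi n by (simp add: lk_pair_phi12 algebra_simps) (metis add_right_cancel)
    moreover have "1 - r / l \<noteq> 0"
    proof
      assume "1 - r / l = 0"
      then have "r - l = 0" using r_props(1) by simp
      moreover have "r * (r\<^sup>2 + 1) = r - l"
        unfolding l by (simp add: algebra_simps power2_eq_square power3_eq_cube)
      ultimately have "r\<^sup>2 + 1 = 0" using r(1) by simp
      then show False using r_props(3) by (simp add: eq_neg_iff_add_eq_0)
    qed
    ultimately show ?thesis unfolding mult_eq_0_iff by blast
  qed
  have x1: "x (1, j) = 0" if "2 \<le> j" "j \<le> n" "x \<in> U" for x j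
    using that
  proof (induction j arbitrary: x rule: dec_induct)
    case base
    then show ?case by (intro x12)
  next
    case (step j)
    then have k: "j \<in> {1..<n}" by simp
    have "nu j x (1, j) = x (1, Suc j)"
      using step by (intro lk_nu_coord(4)[OF k]) auto
    then show ?case using step.IH[of "nu j x"] step lk_stableD(7)[OF U(1) k] by simp
  qed
  have xi: "x (i, j) = 0" if "1 \<le> i" "i < j" "j \<le> n" "x \<in> U" for x i j
    using that
  proof (induction i arbitrary: x rule: dec_induct)
    case base
    then show ?case by (intro x1) auto
  next
    case (step i)
    then have k: "i \<in> {1..<n}" by simp
    have "nu i x (i, j) = x (Suc i, j)"
      using step by (intro lk_nu_coord(2)[OF k]) auto
    then show ?case using step.IH[of "nu i x"] step lk_stableD(7)[OF U(1) k] by simp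
  qed
  have "x = (\<lambda>p. 0)" if "x \<in> U" for x
    using that U(2) by (intro cycles_eq_zeroI xi) auto
  then show ?thesis using lk_stableD(3)[OF U(1)] by blast
qed

text \<open>If the first triangle is not in \<open>U\<close>, then by \<open>nu_beta\<close> the
  function \<open>lk_beta\<close> vanishes on the eigenvectors in \<open>U\<close>, so there is no
  nonzero one. As \<open>g_1 - r\<close> maps \<open>U\<close> into them, \<open>g_1\<close> acts on
  \<open>U\<close> as the scalar \<open>r\<close>.\<close>

lemma cycles_irreducible:
  assumes U: "lk_stable l r n U" "U \<subseteq> W0"
  shows "U = {\<lambda>p. 0} \<or> U = W0"
proof (cases "lk_tri r 1 2 3 \<in> U")
  case True
  then show ?thesis using tri_generates[OF U(1)] U(2) by blast
next
  case False
  have k: "1 \<in> {1..<n}" "2 \<in> {1..<n}" using n by auto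
  have b: "lk_beta v = 0" if v: "v \<in> lk_eig \<inter> U" for v
  proof (rule ccontr)
    assume *: "lk_beta v \<noteq> 0"
    have vU: "v \<in> U" "v \<in> lk_eig" using v by auto
    have vF: "v q \<in> F" for q using lk_stableD(1)[OF U(1) vU(1)] by (simp add: carrier_lk_space)
    have bF: "lk_beta v \<in> F" unfolding lk_beta_def by (intro base_field_closed base_field_closed' vF)
    have "(\<lambda>p. (nu 1 (nu 2 v) p - r * nu 2 v p) + r\<^sup>2 * v p) \<in> U"
      using vU k by (intro lk_stableD(4-7)[OF U(1)] base_field_closed base_field_closed')
    then have "lk_tri r 1 2 3 \<in> U"
      unfolding nu_beta[OF vU(2)] by (rule lk_stable_cancel[OF U(1) bF *])
    then show False using False by simp
  qed
  have "nu 1 x p = r * x p" if x: "x \<in> U" for x p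
  proof -
    let ?v = "\<lambda>p. nu 1 x p - r * x p"
    have "?v \<in> U" using x k by (intro lk_stableD(5-7)[OF U(1)] base_field_closed)
    moreover have "?v \<in> lk_eig" using x U(2) by (intro lk_eigI) auto
    ultimately have "?v = (\<lambda>p. 0)" using b by (intro lk_eig_beta_zero[OF U(1)]) auto
    from fun_cong[OF this, of p] show ?thesis by simp
  qed
  then show ?thesis using nu1_scalar_zero[OF U] by blast
qed

end

section \<open>Uniqueness and conclusion\<close>

lemma irreducible_eq:
  assumes n: "n \<ge> 5" and lr: "l \<noteq> 0" "r \<noteq> 0" "r\<^sup>2 \<noteq> 1"
    and W: "irreducible_subspace l r n W" "lk_dim l r n W = (n - 1) * (n - 2) div 2"
    and U: "irreducible_subspace l r n U" "lk_dim l r n U = (n - 1) * (n - 2) div 2"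
  shows "U = W"
proof -
  note inv = invariant_subspace_iff[OF lr]
  have st: "lk_stable l r n W" "lk_stable l r n U"
    using W(1) U(1) by (simp_all add: irreducible_subspace_def inv)
  have "lk_stable l r n (W \<inter> U)"
    using st unfolding lk_stable_def by blast
  then have *: "W \<inter> U = {\<lambda>p. 0} \<or> W \<inter> U = W" "W \<inter> U = {\<lambda>p. 0} \<or> W \<inter> U = U"
    using W(1) U(1) by (simp_all add: irreducible_subspace_def inv)
  have "W \<inter> U \<noteq> {\<lambda>p. 0}"
  proof
    assume "W \<inter> U = {\<lambda>p. 0}"
    then have "lk_dim l r n W + lk_dim l r n U \<le> card (lk_index n)"
      by (intro lk_dim_add_le lk_stable_subspace st) simp
    then have "2 * ((n - 1) * (n - 2) div 2) \<le> n * (n - 1) div 2"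
      using W(2) U(2) by (simp only: card_lk_index mult_2)
    then have le: "(n - 1) * (n - 2) div 2 \<le> n - 1"
      using half_mult_pred[of n] by linarith
    \<comment> \<open>For \<open>n >= 5\<close> the factor \<open>n - 2\<close> is at least 3, so
      \<open>(n - 1) * (n - 2) div 2\<close> exceeds \<open>n - 1\<close>.\<close>
    obtain d where "n = 5 + d" using n le_Suc_ex by blast
    then have "2 * (n - 1) + (n - 1) \<le> (n - 1) * (n - 2)" by (simp add: algebra_simps)
    then show False using le n by linarith
  qed
  with * show ?thesis by blast
qed

theorem theoremD:
  fixes n :: nat and l r :: complex
  assumes "n \<ge> 5" and "l \<noteq> 0" and "r \<noteq> 0"
    and "\<forall>k \<in> {1..n}. (r ^ 2) ^ k \<noteq> 1"
  shows "((\<exists>W. irreducible_subspace l r n W \<and> lk_dim l r n W = (n - 1) * (n - 2) div 2)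
            \<longleftrightarrow> l = - (r ^ 3)) \<and>
         (l = - (r ^ 3) \<longrightarrow>
            (\<exists>!W. irreducible_subspace l r n W \<and> lk_dim l r n W = (n - 1) * (n - 2) div 2))"
proof -
  \<comment> \<open>Exponents 1 and 2 in the hypothesis exclude \<open>r ^ 2 = 1\<close> and
    \<open>r ^ 2 = - 1\<close>; exponent \<open>n\<close> enters through the geometric sum in
    \<open>lk_eig_beta_zero\<close>.\<close>
  have r2: "r\<^sup>2 \<noteq> 1" using bspec[OF assms(4), of 1] assms(1) by simp
  have "(r\<^sup>2)\<^sup>2 \<noteq> 1" using bspec[OF assms(4), of 2] assms(1) by simp
  then have r4: "r\<^sup>2 \<noteq> - 1" by (metis power2_minus one_power2)
  note inv = invariant_subspace_iff[OF assms(2,3) r2]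
  have 1: "l = - (r ^ 3)" if "irreducible_subspace l r n W" "lk_dim l r n W = (n - 1) * (n - 2) div 2" for W
    using that(1) lk_stable_dim_imp[OF assms(1-3) r2 r4 _ that(2)]
    by (simp add: irreducible_subspace_def inv)
  have 2: "irreducible_subspace l r n (lk_cycles l r n)"
      "lk_dim l r n (lk_cycles l r n) = (n - 1) * (n - 2) div 2" if l: "l = - (r ^ 3)"
  proof -
    note H = assms(1,3,4) l
    show "lk_dim l r n (lk_cycles l r n) = (n - 1) * (n - 2) div 2"
      by (rule dim_cycles[OF H])
    have "lk_tri r 1 2 3 \<in> lk_cycles l r n"
      using assms(1) by (intro tri_in_cycles[OF H]) auto
    moreover have "lk_tri r 1 2 3 (2, 3) \<noteq> 0" by (simp add: lk_tri_def lk_w_def)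
    ultimately have "lk_cycles l r n \<noteq> {\<lambda>p. 0}" by auto
    then show "irreducible_subspace l r n (lk_cycles l r n)"
      using cycles_stable[OF H] cycles_irreducible[OF H]
      by (auto simp: irreducible_subspace_def inv)
  qed
  show ?thesis
    using 1 2 irreducible_eq[OF assms(1-3) r2] by blast
qed

end
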